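(* Let $W$ be an infinite small Coxeter group (of finite rank) which is not virtually abelian. Then $W$ does not have the congruence subgroup property.
   Context: A Coxeter system $(W,S)$ of finite rank $r$ consists of a group $W$ and a finite set $S=\{w_1,\dots,w_r\}$ such that $W$ has the presentation $\langle S\mid (w_iw_j)^{m_{i,j}}=1\rangle$, where $m_{i,j}=m_{j,i}\in\mathbb{N}\cup\{\infty\}$, $m_{i,j}=1$ if and only if $i=j$ (no relation is imposed when $m_{i,j}=\infty$). A group is a small Coxeter group if it admits a Coxeter system in which every exponent $m_{i,j}$ is either $\infty$ or at most $3$; a small Coxeter group is always considered with such a system. Tits representation: let $V$ be the real vector space with basis $e_1,\dots,e_r$, and let $B$ be the symmetric bilinear form with $B(e_i,e_j)=-\cos(\pi/m_{i,j})$ if $m_{i,j}\neq\infty$ and $B(e_i,e_j)=-1$ if $m_{i,j}=\infty$. The Tits representation $\rho:W\to \mathrm{GL}(V)$ is the (faithful) representation given by $\rho(w_i)(v)=v-2B(e_i,v)e_i$. For a small Coxeter system the matrices of $\rho$ in the basis $e_1,\dots,e_r$ have integer entries, so $\rho:W\to \mathrm{GL}(r,\mathbb{Z})$. For $m\ge 2$, the principal congruence subgroup $W[m]$ of level $m$ is the kernel of the composition of $\rho$ with the reduction $\mathrm{GL}(r,\mathbb{Z})\to \mathrm{GL}(r,\mathbb{Z}/m\mathbb{Z})$. $W$ has the congruence subgroup property if every finite index subgroup of $W$ contains $W[m]$ for some $m\ge2$. A group is virtually abelian if it has an abelian subgroup of finite index. *)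

theory Defs
  imports
    "HOL-Algebra.Coset"
    "HOL-Library.Extended_Nat"
    "Jordan_Normal_Form.Matrix"
    Complex_Main
begin

section \<open>Group presentations\<close>

text \<open>A word over the alphabet of generators \<open>x\<^sub>i\<close> and their formal inverses is a list of
  pairs; \<open>(i, True)\<close> stands for \<open>x\<^sub>i\<close> and \<open>(i, False)\<close> for its inverse.\<close>

type_synonym 'i word = "('i \<times> bool) list"

abbreviation words :: "'i set \<Rightarrow> 'i word set" where
  "words I \<equiv> lists (I \<times> UNIV)"

fun eval_word :: "('g, 'x) monoid_scheme \<Rightarrow> ('i \<Rightarrow> 'g) \<Rightarrow> 'i word \<Rightarrow> 'g" where
  "eval_word G w [] = \<one>\<^bsub>G\<^esub>"
| "eval_word G w ((i, b) # u) = (if b then w i else inv\<^bsub>G\<^esub> (w i)) \<otimes>\<^bsub>G\<^esub> eval_word G w u"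

text \<open>The quotient of the words by this congruence is the free group on \<open>I\<close> modulo the
  normal closure of the relators \<open>R\<close>.\<close>

inductive pres_cong :: "'i set \<Rightarrow> 'i word set \<Rightarrow> 'i word \<Rightarrow> 'i word \<Rightarrow> bool"
  for I R where
  refl: "u \<in> words I \<Longrightarrow> pres_cong I R u u"
| sym: "pres_cong I R u v \<Longrightarrow> pres_cong I R v u"
| trans: "pres_cong I R u v \<Longrightarrow> pres_cong I R v z \<Longrightarrow> pres_cong I R u z"
| cancel: "i \<in> I \<Longrightarrow> u \<in> words I \<Longrightarrow> v \<in> words I \<Longrightarrow>
    pres_cong I R (u @ [(i, b), (i, \<not> b)] @ v) (u @ v)"
| relator: "s \<in> R \<Longrightarrow> s \<in> words I \<Longrightarrow> u \<in> words I \<Longrightarrow> v \<in> words I \<Longrightarrow>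
    pres_cong I R (u @ s @ v) (u @ v)"

text \<open>\<open>G = \<langle>I | R\<rangle>\<close> with generator \<open>i\<close> realised by \<open>w i\<close>: evaluation of words induces a
  bijection (hence an isomorphism) from the group presented by \<open>I\<close> and \<open>R\<close> onto \<open>G\<close>.\<close>

definition has_presentation ::
    "('g, 'x) monoid_scheme \<Rightarrow> ('i \<Rightarrow> 'g) \<Rightarrow> 'i set \<Rightarrow> 'i word set \<Rightarrow> bool" where
  "has_presentation G w I R \<longleftrightarrow>
     w \<in> I \<rightarrow> carrier G \<and>
     eval_word G w ` words I = carrier G \<and>
     (\<forall>u \<in> words I. \<forall>v \<in> words I. eval_word G w u = eval_word G w v \<longleftrightarrow> pres_cong I R u v)"


section \<open>Coxeter systems\<close>

text \<open>The generators are indexed by \<open>0, \<dots>, r - 1\<close>.\<close>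

definition coxeter_matrix :: "nat \<Rightarrow> (nat \<Rightarrow> nat \<Rightarrow> enat) \<Rightarrow> bool" where
  "coxeter_matrix r m \<longleftrightarrow>
     (\<forall>i<r. \<forall>j<r. m i j = m j i \<and> 1 \<le> m i j \<and> (m i j = 1 \<longleftrightarrow> i = j))"

definition coxeter_relators :: "nat \<Rightarrow> (nat \<Rightarrow> nat \<Rightarrow> enat) \<Rightarrow> nat word set" where
  "coxeter_relators r m =
     {concat (replicate k [(i, True), (j, True)]) | i j k. i < r \<and> j < r \<and> m i j = enat k}"

definition coxeter_system ::
    "('g, 'x) monoid_scheme \<Rightarrow> nat \<Rightarrow> (nat \<Rightarrow> 'g) \<Rightarrow> (nat \<Rightarrow> nat \<Rightarrow> enat) \<Rightarrow> bool" where
  "coxeter_system W r w m \<longleftrightarrow>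
     group W \<and> coxeter_matrix r m \<and> has_presentation W w {..<r} (coxeter_relators r m)"

definition small_coxeter_system ::
    "('g, 'x) monoid_scheme \<Rightarrow> nat \<Rightarrow> (nat \<Rightarrow> 'g) \<Rightarrow> (nat \<Rightarrow> nat \<Rightarrow> enat) \<Rightarrow> bool" where
  "small_coxeter_system W r w m \<longleftrightarrow>
     coxeter_system W r w m \<and> (\<forall>i<r. \<forall>j<r. m i j = \<infinity> \<or> m i j \<le> 3)"


section \<open>The Tits representation\<close>

text \<open>\<open>V\<close> is \<^term>\<open>carrier_vec r :: real vec set\<close> with basis \<^term>\<open>unit_vec r i\<close>, and
  \<open>GL(V)\<close> is identified with the group of invertible matrices.\<close>

abbreviation GL :: "'a :: comm_ring_1 itself \<Rightarrow> nat \<Rightarrow> 'a mat monoid" where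
  "GL ty r \<equiv> units_of (ring_mat ty r ())"

definition tits_coeff :: "(nat \<Rightarrow> nat \<Rightarrow> enat) \<Rightarrow> nat \<Rightarrow> nat \<Rightarrow> real" where
  "tits_coeff m i j = (case m i j of enat k \<Rightarrow> - cos (pi / real k) | \<infinity> \<Rightarrow> - 1)"

definition tits_form ::
    "nat \<Rightarrow> (nat \<Rightarrow> nat \<Rightarrow> enat) \<Rightarrow> real vec \<Rightarrow> real vec \<Rightarrow> real" where
  "tits_form r m u v = (\<Sum>i<r. \<Sum>j<r. (u $ i) * (v $ j) * tits_coeff m i j)"

text \<open>Since the \<open>w i\<close> generate, such a homomorphism is unique as a function on the carrier, whence
  \<^const>\<open>extensional\<close>; it exists because the reflections satisfy the Coxeter relations.\<close>

definition is_tits_rep ::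
    "('g, 'x) monoid_scheme \<Rightarrow> nat \<Rightarrow> (nat \<Rightarrow> 'g) \<Rightarrow> (nat \<Rightarrow> nat \<Rightarrow> enat) \<Rightarrow>
     ('g \<Rightarrow> real mat) \<Rightarrow> bool" where
  "is_tits_rep W r w m \<rho> \<longleftrightarrow>
     \<rho> \<in> hom W (GL TYPE(real) r) \<and> \<rho> \<in> extensional (carrier W) \<and>
     (\<forall>i<r. \<forall>v \<in> carrier_vec r.
        \<rho> (w i) *\<^sub>v v = v - (2 * tits_form r m (unit_vec r i) v) \<cdot>\<^sub>v unit_vec r i)"

definition tits_rep ::
    "('g, 'x) monoid_scheme \<Rightarrow> nat \<Rightarrow> (nat \<Rightarrow> 'g) \<Rightarrow> (nat \<Rightarrow> nat \<Rightarrow> enat) \<Rightarrow>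
     'g \<Rightarrow> real mat" where
  "tits_rep W r w m = (THE \<rho>. is_tits_rep W r w m \<rho>)"

text \<open>Meaningful when the matrix of \<open>g\<close> has integer entries, as for small systems.\<close>

definition tits_rep_int ::
    "('g, 'x) monoid_scheme \<Rightarrow> nat \<Rightarrow> (nat \<Rightarrow> 'g) \<Rightarrow> (nat \<Rightarrow> nat \<Rightarrow> enat) \<Rightarrow>
     'g \<Rightarrow> int mat" where
  "tits_rep_int W r w m g = (THE A. map_mat real_of_int A = tits_rep W r w m g)"


section \<open>Congruence subgroups\<close>

definition reduce_mat :: "nat \<Rightarrow> int mat \<Rightarrow> int mat" where
  "reduce_mat n = map_mat (\<lambda>x. x mod int n)"

text \<open>\<open>GL(r, \<int>/n\<int>)\<close>, the residue classes being represented by \<open>0, \<dots>, n - 1\<close>.\<close>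

definition GL_mod :: "nat \<Rightarrow> nat \<Rightarrow> int mat monoid" where
  "GL_mod r n = units_of
     \<lparr>carrier = reduce_mat n ` carrier_mat r r,
      monoid.mult = (\<lambda>A B. reduce_mat n (A * B)),
      one = reduce_mat n (1\<^sub>m r)\<rparr>"

definition principal_congruence_subgroup ::
    "('g, 'x) monoid_scheme \<Rightarrow> nat \<Rightarrow> (nat \<Rightarrow> 'g) \<Rightarrow> (nat \<Rightarrow> nat \<Rightarrow> enat) \<Rightarrow>
     nat \<Rightarrow> 'g set" where
  "principal_congruence_subgroup W r w m n =
     kernel W (GL_mod r n) (reduce_mat n \<circ> tits_rep_int W r w m)"

definition congruence_subgroup_property ::
    "('g, 'x) monoid_scheme \<Rightarrow> nat \<Rightarrow> (nat \<Rightarrow> 'g) \<Rightarrow> (nat \<Rightarrow> nat \<Rightarrow> enat) \<Rightarrow> bool" where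
  "congruence_subgroup_property W r w m \<longleftrightarrow>
     (\<forall>H. subgroup H W \<and> finite (rcosets\<^bsub>W\<^esub> H) \<longrightarrow>
        (\<exists>n\<ge>2. principal_congruence_subgroup W r w m n \<subseteq> H))"

definition virtually_abelian :: "('g, 'x) monoid_scheme \<Rightarrow> bool" where
  "virtually_abelian G \<longleftrightarrow>
     (\<exists>A. subgroup A G \<and> finite (rcosets\<^bsub>G\<^esub> A) \<and> comm_group (G\<lparr>carrier := A\<rparr>))"

end

theory Submission
  imports Defs "HOL-Algebra.Sylow" "HOL-Algebra.Group_Action" "HOL-Algebra.Multiplicative_Group"
    "HOL-Combinatorics.Permutations" "HOL-Number_Theory.Cong"
begin

text \<open>The proof exhibits finite quotients of \<open>W\<close> that no congruence quotient \<open>W/W[n]\<close> can have.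

\<^emph>\<open>What congruence quotients cannot do.\<close> Let \<open>l > r\<^sup>2\<close> be a prime not dividing \<open>n\<close>. Then every
\<open>l\<close>-subgroup of \<open>W/W[n]\<close> is abelian (\<open>p_subgroups_mod_cgr_abelian\<close>): otherwise there are \<open>x\<close>, \<open>y\<close>
whose commutator \<open>z\<close> has order \<open>l\<close> and commutes with both, and conjugating an integral linear
dependency between \<open>1, y, \<dots>, y^(r\<^sup>2)\<close> by the powers of \<open>x\<close> multiplies its \<open>i\<close>-th term by
powers of \<open>z^i\<close>; a discrete Fourier transform over \<open>\<langle>z\<rangle>\<close> separates the terms and gives \<open>z = 1\<close>.
Consequently, if a finite-index subgroup of \<open>W\<close> maps onto a finite group \<open>Q\<close> containing a nonabelian
\<open>l\<close>-group, some commutator of that \<open>l\<close>-group lifts into \<open>W[a]\<close>, where \<open>a\<close> is the part of \<open>n\<close> prime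
to \<open>l\<close> (\<open>commuting_p_lifts\<close>, by Sylow). For two primes \<open>l\<^sub>1 \<noteq> l\<^sub>2\<close> such lifts lie in \<open>W[a\<^sub>1]\<close> and
\<open>W[a\<^sub>2]\<close> with \<open>n\<close> dividing \<open>a\<^sub>1 a\<^sub>2\<close>, so they commute modulo \<open>W[n]\<close> (\<open>cgr_commutator\<close>). A kernel
containing \<open>W[n]\<close> would therefore force commutators of \<open>l\<^sub>1\<close>-subgroups and of \<open>l\<^sub>2\<close>-subgroups of
\<open>Q\<close> to commute, which fails in a large symmetric group.

\<^emph>\<open>Where symmetric quotients come from.\<close> Fix a simple reflection \<open>w\<^sub>j\<close> and consider the reflections in
the coset \<open>W[3] w\<^sub>j\<close>. No two of them lie in a common finite rank two parabolic, because \<open>W[3]\<close>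
contains none of the products \<open>w\<^sub>i w\<^sub>k\<close> with \<open>i \<noteq> k\<close>; so their walls are pairwise disjoint. Hence galleries can be
folded along these walls: instead of crossing such a wall one stays put and applies an involution
attached to the wall. The folded steps still satisfy the Coxeter relations
(\<open>coxeter_maps_step\<close>) and define actions of \<open>W\<close>. If the component of the identity chamber is bounded by at least
three walls, three arbitrary involutions can be attached to them at a suitable finite level, for
instance three generators of a symmetric group (\<open>fold_kernel_not_congruence\<close>).

\<^emph>\<open>What remains.\<close> If for each \<open>j\<close> there are at most two bounding walls, folding writes every element
as \<open>x q\<close> with \<open>x\<close> in the component and \<open>q\<close> in a dihedral group. On a finite-index subgroup \<open>q\<close> is
multiplicative with values in a cyclic group, so commutators have \<open>q = 1\<close> and lie in the component
for every \<open>j\<close>. By Tits' theorem on the signs of roots such elements keep every simple root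
nonnegative and are trivial, so \<open>W\<close> is virtually abelian (\<open>few_panels_imp_virtually_abelian\<close>).\<close>

section \<open>Actions defined on the generators\<close>

text \<open>The invariant \<open>f\<close> factors the map sending \<open>g\<close> to its coset through a finite set.\<close>

lemma (in group) finite_rcosets_if_finite_invariant:
  assumes "subgroup H G" "finite (f ` carrier G)"
    and sep: "\<And>g h. g \<in> carrier G \<Longrightarrow> h \<in> carrier G \<Longrightarrow> f g = f h \<Longrightarrow> g \<otimes> inv h \<in> H"
  shows "finite (rcosets H)"
proof -
  have "H #> g = H #> (SOME h. h \<in> carrier G \<and> f h = f g)" if g: "g \<in> carrier G" for g
  proof -
    define h where "h = (SOME h. h \<in> carrier G \<and> f h = f g)"
    have h: "h \<in> carrier G \<and> f h = f g"
      unfolding h_def by (rule someI[of _ g]) (use g in simp)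
    then have "g \<otimes> inv h \<in> H" using sep[of g h] g by simp
    then have "H #> g = H #> h"
      using coset_join1 h g assms(1)
      by (metis (no_types, lifting) coset_mult_inv1 inv_closed m_closed
          subgroup.rcos_const subgroup.subset coset_mult_assoc is_group l_inv r_one m_assoc)
    then show ?thesis by (simp add: h_def)
  qed
  then have "rcosets H \<subseteq> (\<lambda>y. H #> (SOME h. h \<in> carrier G \<and> f h = y)) ` f ` carrier G"
    unfolding RCOSETS_def by blast
  then show ?thesis using assms(2) finite_surj by blast
qed

text \<open>The exponent signs in the word are ignored, since the letters will act by involutions.\<close>

definition act_word :: "('i \<Rightarrow> 'b \<Rightarrow> 'b) \<Rightarrow> 'i word \<Rightarrow> 'b \<Rightarrow> 'b" where
  "act_word f u = foldr (\<lambda>(i, b). f i) u"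

lemma act_word_simps [simp]:
  "act_word f [] = id"
  "act_word f ((i, b) # u) = f i \<circ> act_word f u"
  by (auto simp: act_word_def fun_eq_iff)

lemma act_word_append [simp]: "act_word f (u @ v) = act_word f u \<circ> act_word f v"
  by (induction u) auto

lemma eval_word_append:
  assumes "group G" "\<And>i. i \<in> I \<Longrightarrow> w i \<in> carrier G" "u \<in> words I" "v \<in> words I"
  shows "eval_word G w u \<in> carrier G"
    and "eval_word G w (u @ v) = eval_word G w u \<otimes>\<^bsub>G\<^esub> eval_word G w v"
proof -
  interpret group G by fact
  have cl: "eval_word G w u \<in> carrier G" if "u \<in> words I" for u
    using that by (induction u) (auto simp: assms(2))
  show "eval_word G w u \<in> carrier G" using cl assms by blast
  show "eval_word G w (u @ v) = eval_word G w u \<otimes>\<^bsub>G\<^esub> eval_word G w v"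
    using assms(3)
  proof (induction u)
    case (Cons x u)
    then show ?case using cl[of u] cl[of v] assms(2,4) by (cases x) (auto simp: m_assoc)
  qed (use cl assms(4) in simp)
qed

lemma act_word_cong:
  assumes "pres_cong I R u v"
    and inv: "\<And>i z. i \<in> I \<Longrightarrow> f i (f i z) = z"
    and rel: "\<And>s z. s \<in> R \<Longrightarrow> act_word f s z = z"
  shows "act_word f u = act_word f v"
  using assms(1) by induction (auto simp: fun_eq_iff inv rel)

locale small_coxeter =
  fixes W :: "('g, 'x) monoid_scheme" (structure)
    and r :: nat and w :: "nat \<Rightarrow> 'g" and m :: "nat \<Rightarrow> nat \<Rightarrow> enat"
  assumes small: "small_coxeter_system W r w m"
begin

lemma group_W: "group W"
  using small by (simp add: small_coxeter_system_def coxeter_system_def)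

sublocale group W by (rule group_W)

lemma presentation: "has_presentation W w {..<r} (coxeter_relators r m)"
  using small by (simp add: small_coxeter_system_def coxeter_system_def)

lemma gen_closed [simp, intro]: "i < r \<Longrightarrow> w i \<in> carrier W"
  using presentation by (auto simp: has_presentation_def)

lemma exponent_sym: "i < r \<Longrightarrow> j < r \<Longrightarrow> m i j = m j i"
  using small by (simp add: small_coxeter_system_def coxeter_system_def coxeter_matrix_def)

lemma exponent_diag: "i < r \<Longrightarrow> m i i = 1"
  using small by (simp add: small_coxeter_system_def coxeter_system_def coxeter_matrix_def)

lemma exponent_cases:
  assumes "i < r" "j < r" "i \<noteq> j"
  obtains "m i j = 2" | "m i j = 3" | "m i j = \<infinity>"
proof (cases "m i j")
  case (enat k)
  have "m i j \<le> 3" "1 \<le> m i j" "m i j \<noteq> 1"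
    using small assms enat
    by (metis enat.distinct(2) small_coxeter_system_def coxeter_system_def coxeter_matrix_def)+
  then have "k \<le> 3" "1 \<le> k" "k \<noteq> 1"
    by (simp_all add: enat numeral_eq_enat one_enat_def)
  then have "k = 2 \<or> k = 3" by linarith
  then show ?thesis using that enat by (auto simp: numeral_eq_enat)
qed (use that in auto)

lemma relator_word:
  "i < r \<Longrightarrow> j < r \<Longrightarrow> concat (replicate k [(i, True), (j, True)]) \<in> words {..<r}"
  by (induction k) auto

lemma eval_relator:
  assumes "i < r" "j < r" "m i j = enat k"
  shows "eval_word W w (concat (replicate k [(i, True), (j, True)])) = \<one>"
proof -
  let ?s = "concat (replicate k [(i, True), (j, True)])"
  have "pres_cong {..<r} (coxeter_relators r m) ([] @ ?s @ []) ([] @ [])"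
    by (rule pres_cong.relator) (use assms relator_word in \<open>auto simp: coxeter_relators_def\<close>)
  then have "eval_word W w ?s = eval_word W w []"
    using presentation relator_word[OF assms(1,2), of k]
    unfolding has_presentation_def by (simp only: append_Nil append_Nil2) blast
  then show ?thesis by simp
qed

lemma gen_sq [simp]: "i < r \<Longrightarrow> w i \<otimes> w i = \<one>"
  using eval_relator[of i i 1] exponent_diag[of i] by (simp add: one_enat_def)

lemma gen_inv [simp]: "i < r \<Longrightarrow> inv (w i) = w i"
  by (rule inv_equality) auto

lemma gen_cancel [simp]: "i < r \<Longrightarrow> g \<in> carrier W \<Longrightarrow> w i \<otimes> (w i \<otimes> g) = g"
  by (simp flip: m_assoc)

text \<open>The relator \<open>(w\<^sub>i w\<^sub>j)\<^sup>2\<close> makes \<open>w\<^sub>i w\<^sub>j\<close> equal to its own inverse \<open>w\<^sub>j w\<^sub>i\<close>.\<close>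

lemma gen_commute:
  assumes "i < r" "j < r" "m i j = 2"
  shows "w i \<otimes> w j = w j \<otimes> w i"
proof -
  have "w i \<otimes> (w j \<otimes> (w i \<otimes> w j)) = \<one>"
    using eval_relator[of i j 2] assms by (simp add: numeral_2_eq_2 numeral_eq_enat)
  then have "(w i \<otimes> w j) \<otimes> (w i \<otimes> w j) = \<one>"
    using assms by (simp add: m_assoc)
  then have "w i \<otimes> w j = inv (w i \<otimes> w j)"
    using assms by (metis inv_equality gen_closed m_closed)
  then show ?thesis using assms by (simp add: inv_mult_group)
qed

lemma gen_braid:
  assumes "i < r" "j < r" "m i j = 3"
  shows "w i \<otimes> (w j \<otimes> w i) = w j \<otimes> (w i \<otimes> w j)"
proof -
  have "w i \<otimes> (w j \<otimes> (w i \<otimes> (w j \<otimes> (w i \<otimes> w j)))) = \<one>"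
    using eval_relator[of i j 3] assms by (simp add: numeral_3_eq_3 numeral_eq_enat)
  then have "(w i \<otimes> (w j \<otimes> w i)) \<otimes> (w j \<otimes> (w i \<otimes> w j)) = \<one>"
    using assms by (simp add: m_assoc)
  then have "w i \<otimes> (w j \<otimes> w i) = inv (w j \<otimes> (w i \<otimes> w j))"
    using assms by (metis inv_equality gen_closed m_closed inv_inv inv_closed)
  then show ?thesis using assms by (simp add: inv_mult_group m_assoc)
qed

text \<open>No clause for inverses is needed because the generators are involutions.\<close>

lemma word_induct [consumes 1, case_names one mult]:
  assumes "g \<in> carrier W" "P \<one>"
    and step: "\<And>i h. i < r \<Longrightarrow> h \<in> carrier W \<Longrightarrow> P h \<Longrightarrow> P (w i \<otimes> h)"
  shows "P g"
proof -
  have "eval_word W w u \<in> carrier W \<and> P (eval_word W w u)" if "u \<in> words {..<r}" for u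
    using that by (induction u) (auto simp: assms(2) step)
  moreover obtain u where "u \<in> words {..<r}" "g = eval_word W w u"
    using presentation assms(1) unfolding has_presentation_def by blast
  ultimately show ?thesis by blast
qed

text \<open>Involutions satisfying the commutation and braid forms of the Coxeter relations.\<close>

definition coxeter_maps :: "(nat \<Rightarrow> 'b \<Rightarrow> 'b) \<Rightarrow> bool" where
  "coxeter_maps f \<longleftrightarrow> (\<forall>i<r. \<forall>z. f i (f i z) = z) \<and>
     (\<forall>i<r. \<forall>j<r. \<forall>z. m i j = 2 \<longrightarrow> f i (f j z) = f j (f i z)) \<and>
     (\<forall>i<r. \<forall>j<r. \<forall>z. m i j = 3 \<longrightarrow> f i (f j (f i z)) = f j (f i (f j z)))"

text \<open>The action of \<open>W\<close> induced by such maps. The choice of a word is harmless by \<open>lift_eval\<close>.\<close>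

definition lift :: "(nat \<Rightarrow> 'b \<Rightarrow> 'b) \<Rightarrow> 'g \<Rightarrow> 'b \<Rightarrow> 'b" where
  "lift f g = act_word f (SOME u. u \<in> words {..<r} \<and> eval_word W w u = g)"

lemma lift_eval:
  assumes "coxeter_maps f" "u \<in> words {..<r}"
  shows "lift f (eval_word W w u) = act_word f u"
proof -
  have rel: "act_word f s z = z" if s_rel: "s \<in> coxeter_relators r m" for s z
  proof -
    obtain i j k where s: "s = concat (replicate k [(i, True), (j, True)])" "i < r" "j < r"
      "m i j = enat k" using s_rel unfolding coxeter_relators_def by blast
    show ?thesis
    proof (cases "i = j")
      case True
      then have "k = 1" using s exponent_diag by (simp add: one_enat_def)
      then show ?thesis using s assms(1) True by (simp add: coxeter_maps_def)
    next
      case False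
      then consider "m i j = 2" | "m i j = 3" using s exponent_cases[of i j] by auto
      then show ?thesis
      proof cases
        case 1
        then have "k = 2" using s by (simp add: numeral_eq_enat)
        then show ?thesis using s assms(1) 1 by (auto simp: coxeter_maps_def numeral_2_eq_2)
      next
        case 2
        then have "k = 3" using s by (simp add: numeral_eq_enat)
        then show ?thesis using s assms(1) 2 by (auto simp: coxeter_maps_def numeral_3_eq_3)
      qed
    qed
  qed
  define v where "v = (SOME v. v \<in> words {..<r} \<and> eval_word W w v = eval_word W w u)"
  have "v \<in> words {..<r} \<and> eval_word W w v = eval_word W w u"
    unfolding v_def by (rule someI[of _ u]) (use assms in simp)
  then have "pres_cong {..<r} (coxeter_relators r m) v u"
    using presentation assms(2) unfolding has_presentation_def by blast
  then have "act_word f v = act_word f u"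
    by (rule act_word_cong) (use assms(1) rel in \<open>auto simp: coxeter_maps_def\<close>)
  then show ?thesis by (simp add: lift_def v_def)
qed

lemma lift_one [simp]: "coxeter_maps f \<Longrightarrow> lift f \<one> z = z"
  using lift_eval[of f "[]"] by simp

lemma lift_gen [simp]: "coxeter_maps f \<Longrightarrow> i < r \<Longrightarrow> lift f (w i) z = f i z"
  using lift_eval[of f "[(i, True)]"] by simp

lemma lift_mult:
  assumes "coxeter_maps f" "g \<in> carrier W" "h \<in> carrier W"
  shows "lift f (g \<otimes> h) z = lift f g (lift f h z)"
proof -
  have surj: "carrier W = eval_word W w ` words {..<r}"
    using presentation by (simp add: has_presentation_def)
  obtain u where u: "u \<in> words {..<r}" "g = eval_word W w u" using assms(2) unfolding surj by (rule imageE)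
  obtain v where v: "v \<in> words {..<r}" "h = eval_word W w v" using assms(3) unfolding surj by (rule imageE)
  have "g \<otimes> h = eval_word W w (u @ v)"
    using eval_word_append(2)[OF is_group _ u(1) v(1), of w] u v by simp
  then have "lift f (g \<otimes> h) = act_word f (u @ v)"
    using lift_eval[OF assms(1), of "u @ v"] u v by simp
  then show ?thesis using lift_eval[OF assms(1)] u v by simp
qed

lemma lift_inv [simp]:
  assumes "coxeter_maps f" "g \<in> carrier W"
  shows "lift f (inv g) (lift f g z) = z" "lift f g (lift f (inv g) z) = z"
  using assms by (simp_all flip: lift_mult)

end

section \<open>The Tits representation on integer coordinates and the signs of roots\<close>

definition unit_fun :: "nat \<Rightarrow> nat \<Rightarrow> int" where
  "unit_fun i = (\<lambda>k. if k = i then 1 else 0)"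

definition nonneg :: "(nat \<Rightarrow> int) \<Rightarrow> bool" where
  "nonneg v \<longleftrightarrow> (\<forall>k. 0 \<le> v k)"

text \<open>A named binary linear combination, so that linearity of the action becomes a rewrite rule.\<close>

definition comb :: "int \<Rightarrow> (nat \<Rightarrow> int) \<Rightarrow> int \<Rightarrow> (nat \<Rightarrow> int) \<Rightarrow> nat \<Rightarrow> int" where
  "comb a u b v = (\<lambda>k. a * u k + b * v k)"

lemma nonneg_comb: "nonneg u \<Longrightarrow> nonneg v \<Longrightarrow> 0 \<le> a \<Longrightarrow> 0 \<le> b \<Longrightarrow> nonneg (comb a u b v)"
  by (simp add: nonneg_def comb_def)

context small_coxeter
begin

text \<open>The integer \<open>2 B(e\<^sub>i, e\<^sub>j)\<close>.\<close>

definition cartan :: "nat \<Rightarrow> nat \<Rightarrow> int" where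
  "cartan i j = (if m i j = 1 then 2 else if m i j = 2 then 0 else if m i j = 3 then - 1 else - 2)"

text \<open>The functional \<open>v \<mapsto> 2 B(e\<^sub>i, v)\<close>.\<close>

definition coroot :: "nat \<Rightarrow> (nat \<Rightarrow> int) \<Rightarrow> int" where
  "coroot i v = (\<Sum>j<r. cartan i j * v j)"

text \<open>The reflection \<open>v \<mapsto> v - 2 B(e\<^sub>i, v) e\<^sub>i\<close> in coordinates.\<close>

definition rfl :: "nat \<Rightarrow> (nat \<Rightarrow> int) \<Rightarrow> nat \<Rightarrow> int" where
  "rfl i v = v(i := v i - coroot i v)"

abbreviation act :: "'g \<Rightarrow> (nat \<Rightarrow> int) \<Rightarrow> nat \<Rightarrow> int" where
  "act \<equiv> lift rfl"

lemma cartan_diag [simp]: "i < r \<Longrightarrow> cartan i i = 2"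
  by (simp add: cartan_def exponent_diag)

lemma cartan_sym: "i < r \<Longrightarrow> j < r \<Longrightarrow> cartan i j = cartan j i"
  by (simp add: cartan_def exponent_sym)

lemma cartan_simps:
  "m i j = 2 \<Longrightarrow> cartan i j = 0" "m i j = 3 \<Longrightarrow> cartan i j = - 1" "m i j = \<infinity> \<Longrightarrow> cartan i j = - 2"
  by (simp_all add: cartan_def numeral_eq_enat one_enat_def)

lemma coroot_upd:
  assumes "k < r"
  shows "coroot i (v(k := a)) = coroot i v + cartan i k * (a - v k)"
proof -
  have "(\<Sum>j<r. cartan i j * (v(k := a)) j) =
      (\<Sum>j<r. cartan i j * v j + (if j = k then cartan i k * (a - v k) else 0))"
    by (rule sum.cong) (auto simp: algebra_simps)
  then show ?thesis using assms by (simp add: coroot_def sum.distrib)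
qed

lemma coroot_rfl: "k < r \<Longrightarrow> coroot i (rfl k v) = coroot i v - cartan i k * coroot k v"
  by (simp add: rfl_def coroot_upd)

lemma coroot_unit: "j < r \<Longrightarrow> coroot i (unit_fun j) = cartan i j"
  by (simp add: coroot_def unit_fun_def if_distrib[of "\<lambda>x. cartan i _ * x"] cong: if_cong)

lemma coroot_comb: "coroot i (comb a u b v) = a * coroot i u + b * coroot i v"
  by (simp add: coroot_def comb_def sum.distrib sum_distrib_left algebra_simps)

lemma rfl_comb: "rfl i (comb a u b v) = comb a (rfl i u) b (rfl i v)"
  by (auto simp: rfl_def fun_eq_iff coroot_comb) (auto simp: comb_def algebra_simps)

lemma rfl_apply: "rfl i v k = v k - (if k = i then coroot i v else 0)"
  by (simp add: rfl_def)

lemma coxeter_maps_rfl [simp]: "coxeter_maps rfl"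
  unfolding coxeter_maps_def
proof (intro conjI allI impI)
  fix i j v assume ij0: "i < r" "j < r" "m i j = 2"
  then have ij: "i < r" "j < r" "m i j = 2" "i \<noteq> j"
    using exponent_diag[of i] by (auto simp: numeral_eq_enat one_enat_def)
  then have c: "cartan i j = 0" "cartan j i = 0" using cartan_sym by (simp_all add: cartan_simps)
  show "rfl i (rfl j v) = rfl j (rfl i v)"
    by (rule ext) (use ij c in \<open>simp add: rfl_apply coroot_rfl\<close>)
next
  fix i j v assume ij0: "i < r" "j < r" "m i j = 3"
  then have ij: "i < r" "j < r" "m i j = 3" "i \<noteq> j"
    using exponent_diag[of i] by (auto simp: numeral_eq_enat one_enat_def)
  then have c: "cartan i j = -1" "cartan j i = -1" using cartan_sym by (simp_all add: cartan_simps)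
  show "rfl i (rfl j (rfl i v)) = rfl j (rfl i (rfl j v))"
    by (rule ext) (use ij c in \<open>simp add: rfl_apply coroot_rfl algebra_simps\<close>)
qed (rule ext, simp add: rfl_apply coroot_rfl)

lemma act_comb:
  assumes "g \<in> carrier W"
  shows "act g (comb a u b v) = comb a (act g u) b (act g v)"
  using assms by (induction rule: word_induct) (simp_all add: lift_mult rfl_comb)

lemma act_zero: "g \<in> carrier W \<Longrightarrow> act g (\<lambda>k. 0) = (\<lambda>k. 0)"
  using act_comb[of g 0 "\<lambda>k. 0" 0 "\<lambda>k. 0"] by (simp add: comb_def)

lemma act_scale: "g \<in> carrier W \<Longrightarrow> act g (\<lambda>k. c * v k) = (\<lambda>k. c * act g v k)"
  using act_comb[of g c v 0 "\<lambda>k. 0"] by (simp add: comb_def)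

lemma act_sum:
  assumes "g \<in> carrier W" "finite I"
  shows "act g (\<lambda>k. \<Sum>i\<in>I. c i * v i k) = (\<lambda>k. \<Sum>i\<in>I. c i * act g (v i) k)"
  using assms(2)
proof (induction I)
  case (insert i I)
  have "act g (\<lambda>k. \<Sum>i\<in>insert i I. c i * v i k) = act g (comb (c i) (v i) 1 (\<lambda>k. \<Sum>i\<in>I. c i * v i k))"
    using insert by (simp add: comb_def)
  also have "\<dots> = comb (c i) (act g (v i)) 1 (\<lambda>k. \<Sum>i\<in>I. c i * act g (v i) k)"
    using assms insert by (simp add: act_comb)
  finally show ?case using insert by (simp add: comb_def)
qed (use assms act_zero in simp)

lemma rfl_unit:
  "i < r \<Longrightarrow> rfl j (unit_fun i) = comb 1 (unit_fun i) (- cartan j i) (unit_fun j)"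
  by (rule ext) (simp add: rfl_apply coroot_unit comb_def, simp add: unit_fun_def)

lemma rfl_unit_self: "i < r \<Longrightarrow> rfl i (unit_fun i) = (\<lambda>k. - unit_fun i k)"
  by (auto simp: rfl_unit comb_def)

lemma act_neg: "g \<in> carrier W \<Longrightarrow> act g (\<lambda>k. - v k) = (\<lambda>k. - act g v k)"
  using act_scale[of g "- 1" v] by simp

text \<open>Twice the Tits form, which is integral on the lattice.\<close>

definition form :: "(nat \<Rightarrow> int) \<Rightarrow> (nat \<Rightarrow> int) \<Rightarrow> int" where
  "form u v = (\<Sum>i<r. u i * coroot i v)"

lemma form_unit: "i < r \<Longrightarrow> form (unit_fun i) v = coroot i v"
  by (simp add: form_def unit_fun_def if_distrib[of "\<lambda>x. x * _"] cong: if_cong)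

lemma form_rfl:
  assumes "k < r"
  shows "form (rfl k u) (rfl k v) = form u v"
proof -
  have "form (rfl k u) (rfl k v) =
      (\<Sum>i<r. u i * coroot i (rfl k v) - (if i = k then coroot k u * coroot k (rfl k v) else 0))"
    unfolding form_def by (rule sum.cong) (auto simp: rfl_apply algebra_simps)
  also have "\<dots> = (\<Sum>i<r. u i * coroot i (rfl k v)) - coroot k u * coroot k (rfl k v)"
    using assms by (simp add: sum_subtractf)
  also have "coroot k (rfl k v) = - coroot k v" using assms by (simp add: coroot_rfl)
  also have "(\<Sum>i<r. u i * coroot i (rfl k v)) = form u v - (\<Sum>i<r. cartan k i * u i) * coroot k v"
    using assms cartan_sym
    by (simp add: coroot_rfl form_def algebra_simps sum_subtractf sum_distrib_left)
  finally show ?thesis by (simp add: coroot_def)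
qed

lemma form_act: "g \<in> carrier W \<Longrightarrow> form (act g u) (act g v) = form u v"
  by (induction rule: word_induct) (simp_all add: lift_mult form_rfl)

text \<open>If \<open>h\<close> carries the root \<open>e\<^sub>j\<close> to \<open>e\<^sub>i\<close>, it conjugates one reflection into the other, because a
reflection is determined by its root and the invariant form.\<close>

lemma reflection_conjugate:
  assumes "h \<in> carrier W" "i < r" "j < r" "act h (unit_fun j) = unit_fun i"
  shows "act (h \<otimes> w j) v = act (w i \<otimes> h) v"
proof -
  have "rfl j v = comb 1 v (- coroot j v) (unit_fun j)"
    by (rule ext) (simp add: rfl_apply comb_def unit_fun_def)
  then have "act h (rfl j v) = comb 1 (act h v) (- coroot j v) (unit_fun i)"
    using assms by (simp add: act_comb)
  moreover have "coroot j v = coroot i (act h v)"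
    using form_act[OF assms(1), of "unit_fun j" v] assms by (simp add: form_unit)
  moreover have "rfl i (act h v) = comb 1 (act h v) (- coroot i (act h v)) (unit_fun i)"
    by (rule ext) (simp add: rfl_apply comb_def unit_fun_def)
  ultimately show ?thesis using assms by (simp add: lift_mult)
qed

definition prodl :: "nat list \<Rightarrow> 'g" where
  "prodl xs = foldr (\<lambda>i h. w i \<otimes> h) xs \<one>"

lemma prodl_simps [simp]: "prodl [] = \<one>" "prodl (i # xs) = w i \<otimes> prodl xs"
  by (simp_all add: prodl_def)

lemma prodl_closed [simp, intro]: "set xs \<subseteq> {..<r} \<Longrightarrow> prodl xs \<in> carrier W"
  by (induction xs) auto

lemma prodl_snoc: "set xs \<subseteq> {..<r} \<Longrightarrow> i < r \<Longrightarrow> prodl (xs @ [i]) = prodl xs \<otimes> w i"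
  by (induction xs) (auto simp: m_assoc)

lemma prodl_surj: "g \<in> carrier W \<Longrightarrow> \<exists>xs. set xs \<subseteq> {..<r} \<and> prodl xs = g"
proof (induction rule: word_induct)
  case one
  show ?case by (rule exI[of _ "[]"]) simp
next
  case (mult i h)
  then obtain xs where "set xs \<subseteq> {..<r} \<and> prodl xs = h" by blast
  then show ?case using mult by (intro exI[of _ "i # xs"]) simp
qed

definition len :: "'g \<Rightarrow> nat" where
  "len g = (LEAST n. \<exists>xs. length xs = n \<and> set xs \<subseteq> {..<r} \<and> prodl xs = g)"

lemma len_word:
  assumes "g \<in> carrier W"
  obtains xs where "length xs = len g" "set xs \<subseteq> {..<r}" "prodl xs = g"
proof -
  have "\<exists>n xs. length xs = n \<and> set xs \<subseteq> {..<r} \<and> prodl xs = g"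
    using prodl_surj[OF assms] by blast
  from LeastI_ex[OF this] show ?thesis using that unfolding len_def by blast
qed

lemma len_le: "set xs \<subseteq> {..<r} \<Longrightarrow> prodl xs = g \<Longrightarrow> len g \<le> length xs"
  unfolding len_def by (rule Least_le) blast

lemma coxeter_maps_flip: "coxeter_maps (\<lambda>_. Not)"
  by (simp add: coxeter_maps_def)

lemma flip_prodl: "set xs \<subseteq> {..<r} \<Longrightarrow> lift (\<lambda>_. Not) (prodl xs) True = even (length xs)"
  by (induction xs) (auto simp: coxeter_maps_flip lift_mult)

lemma even_len: "g \<in> carrier W \<Longrightarrow> even (len g) = lift (\<lambda>_. Not) g True"
  using flip_prodl by (metis len_word)

text \<open>The sign homomorphism shows that multiplication by a generator always changes the length.\<close>

lemma even_len_gen: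
  assumes "g \<in> carrier W" "i < r"
  shows "even (len (g \<otimes> w i)) \<longleftrightarrow> odd (len g)"
proof -
  obtain xs where xs: "length xs = len g" "set xs \<subseteq> {..<r}" "prodl xs = g"
    using len_word assms by blast
  then have "g \<otimes> w i = prodl (xs @ [i])" using assms by (simp add: prodl_snoc)
  then show ?thesis using xs assms flip_prodl[of "xs @ [i]"] by (simp add: even_len flip: xs(1))
qed

lemma len_gen_le: 
  assumes "g \<in> carrier W" "i < r"
  shows "len (g \<otimes> w i) \<le> Suc (len g)"
proof -
  obtain xs where xs: "length xs = len g" "set xs \<subseteq> {..<r}" "prodl xs = g"
    using len_word assms by blast
  then show ?thesis using len_le[of "xs @ [i]"] assms by (simp add: prodl_snoc)
qed

lemma gen_cancel_right [simp]: "g \<in> carrier W \<Longrightarrow> i < r \<Longrightarrow> g \<otimes> w i \<otimes> w i = g"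
  by (simp add: m_assoc)

lemma len_gen_cases:
  assumes "g \<in> carrier W" "i < r"
  shows "len (g \<otimes> w i) = Suc (len g) \<or> len g = Suc (len (g \<otimes> w i))"
proof -
  have "len g \<le> Suc (len (g \<otimes> w i))" using len_gen_le[of "g \<otimes> w i" i] assms by simp
  moreover have "len (g \<otimes> w i) \<noteq> len g" using even_len_gen[OF assms] by metis
  ultimately show ?thesis using len_gen_le[OF assms] by linarith
qed

lemma descent_exists:
  assumes "g \<in> carrier W" "g \<noteq> \<one>"
  obtains j where "j < r" "len g = Suc (len (g \<otimes> w j))"
proof -
  obtain xs where xs: "length xs = len g" "set xs \<subseteq> {..<r}" "prodl xs = g"
    using len_word assms by blast
  then obtain ys j where ys: "xs = ys @ [j]" using assms by (cases xs rule: rev_cases) auto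
  then have "g \<otimes> w j = prodl ys" using xs by (auto simp: prodl_snoc)
  then have "len (g \<otimes> w j) < len g" using len_le[of ys] xs ys by fastforce
  then show ?thesis using that len_gen_cases[OF assms(1), of j] xs ys by auto
qed

text \<open>Tits' theorem, by induction on length: write \<open>g = g\<^sub>1 w\<^sub>j\<close> with \<open>g\<^sub>1\<close> shorter. When \<open>m\<^sub>i\<^sub>j\<close> is finite,
at most two letters have to be stripped before the induction hypothesis applies, since otherwise the
relation between \<open>w\<^sub>i\<close> and \<open>w\<^sub>j\<close> would shorten \<open>g w\<^sub>i\<close>. When \<open>m\<^sub>i\<^sub>j = \<infinity>\<close> arbitrarily many alternating letters can
occur, and the second conjunct is the invariant that survives stripping them: \<open>w\<^sub>j\<close> sends
\<open>a e\<^sub>i + b e\<^sub>j\<close> to \<open>a e\<^sub>i + (2a - b) e\<^sub>j\<close>, and \<open>2a - b \<ge> a\<close>.\<close>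

lemma simple_root_ascent:
  assumes "g \<in> carrier W"
  shows "(\<forall>i<r. len g < len (g \<otimes> w i) \<longrightarrow> nonneg (act g (unit_fun i))) \<and>
    (\<forall>i<r. \<forall>j<r. \<forall>a b. m i j = \<infinity> \<longrightarrow> len g < len (g \<otimes> w i) \<longrightarrow> 0 \<le> b \<longrightarrow> b \<le> a \<longrightarrow>
      nonneg (act g (comb a (unit_fun i) b (unit_fun j))))"
  using assms
proof (induction "len g" arbitrary: g rule: less_induct)
  case less
  note g = \<open>g \<in> carrier W\<close>
  have IH1: "nonneg (act h (unit_fun i))"
    if "len h < len g" "h \<in> carrier W" "i < r" "len h < len (h \<otimes> w i)" for h i
    using less.hyps[OF that(1,2)] that by blast
  have IH2: "nonneg (act h (comb a (unit_fun i) b (unit_fun j)))"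
    if "len h < len g" "h \<in> carrier W" "i < r" "j < r" "m i j = \<infinity>" "len h < len (h \<otimes> w i)"
      "0 \<le> b" "b \<le> a" for h i j a b
    using less.hyps[OF that(1,2)] that by blast
  have ord: "nonneg (act g (unit_fun i))" if i: "i < r" "len g < len (g \<otimes> w i)" for i
  proof (cases "g = \<one>")
    case True
    then have "act g (unit_fun i) = unit_fun i" by auto
    then show ?thesis by (simp add: nonneg_def unit_fun_def)
  next
    case False
    obtain j where j: "j < r" "len g = Suc (len (g \<otimes> w j))"
      by (rule descent_exists[OF g False])
    define g1 where "g1 = g \<otimes> w j"
    have g1: "g1 \<in> carrier W" "g = g1 \<otimes> w j" "len g = Suc (len g1)"
      using g j by (simp_all add: g1_def)
    have asc: "len g1 < len (g1 \<otimes> w j)" using g1 by simp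
    have "i \<noteq> j" using i j by auto
    have gi: "act g (unit_fun i) = act g1 (comb 1 (unit_fun i) (- cartan j i) (unit_fun j))"
      using g1 i j by (simp add: lift_mult rfl_unit)
    consider "m i j = 2" | "m i j = 3" | "m i j = \<infinity>"
      by (rule exponent_cases[OF i(1) j(1) \<open>i \<noteq> j\<close>])
    then show ?thesis
    proof cases
      case 1
      have "len g1 < len (g1 \<otimes> w i)"
      proof (rule ccontr)
        assume "\<not> ?thesis"
        then have "len g1 = Suc (len (g1 \<otimes> w i))" using len_gen_cases[of g1 i] g1 i by linarith
        moreover have "g \<otimes> w i = g1 \<otimes> w i \<otimes> w j"
          using g1 i j gen_commute[OF _ _ 1] by (simp add: m_assoc)
        ultimately show False using len_gen_le[of "g1 \<otimes> w i" j] g1 i j by simp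
      qed
      then have "nonneg (act g1 (unit_fun i))" using IH1 g1 i by simp
      moreover have "cartan j i = 0" using 1 i j cartan_sym by (simp add: cartan_simps)
      ultimately show ?thesis by (simp add: gi comb_def)
    next
      case 2
      have c: "cartan j i = -1" "cartan i j = -1" using 2 i j cartan_sym by (simp_all add: cartan_simps)
      show ?thesis
      proof (cases "len g1 < len (g1 \<otimes> w i)")
        case True
        then have "nonneg (act g1 (unit_fun i))" "nonneg (act g1 (unit_fun j))"
          using IH1 g1 i j asc by simp_all
        then show ?thesis unfolding gi using g1(1) by (simp add: act_comb nonneg_comb c)
      next
        case False
        then have l1: "len g1 = Suc (len (g1 \<otimes> w i))" using len_gen_cases[of g1 i] g1 i by linarith
        define g2 where "g2 = g1 \<otimes> w i"
        have g2: "g2 \<in> carrier W" "g1 = g2 \<otimes> w i" "len g1 = Suc (len g2)"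
          using g1 i l1 by (simp_all add: g2_def)
        have "len g2 < len (g2 \<otimes> w j)"
        proof (rule ccontr)
          assume "\<not> ?thesis"
          then have l2: "len g2 = Suc (len (g2 \<otimes> w j))"
            using len_gen_cases[of g2 j] g2 j by linarith
          define g3 where "g3 = g2 \<otimes> w j"
          have g3: "g3 \<in> carrier W" "g2 = g3 \<otimes> w j" "len g2 = Suc (len g3)"
            using g2 j l2 by (simp_all add: g3_def)
          have "g \<otimes> w i = g3 \<otimes> (w j \<otimes> (w i \<otimes> w j)) \<otimes> w i"
            using g1 g2 g3 i j by (simp add: m_assoc)
          also have "\<dots> = g3 \<otimes> (w i \<otimes> (w j \<otimes> w i)) \<otimes> w i"
            using gen_braid[OF _ _ 2] i j by simp
          also have "\<dots> = g3 \<otimes> w i \<otimes> w j" using g3 i j by (simp add: m_assoc)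
          finally show False
            using len_gen_le[of "g3 \<otimes> w i" j] len_gen_le[of g3 i] g1 g2 g3 i j by simp
        qed
        then have "nonneg (act g2 (unit_fun j))" using IH1 g1 g2 j by simp
        moreover have "rfl i (comb 1 (unit_fun i) 1 (unit_fun j)) = unit_fun j"
          using i j c \<open>i \<noteq> j\<close>
          by (intro ext, simp add: rfl_apply coroot_comb coroot_unit)
            (simp add: comb_def unit_fun_def)
        ultimately show ?thesis unfolding gi using g2(1) i c by (simp add: g2(2) lift_mult)
      qed
    next
      case 3
      then have c: "cartan j i = -2" "m j i = \<infinity>"
        using i j cartan_sym exponent_sym by (simp_all add: cartan_simps)
      have "nonneg (act g1 (comb 2 (unit_fun j) 1 (unit_fun i)))"
        using IH2 g1 i j asc c by simp
      then show ?thesis by (simp add: gi c comb_def add.commute)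
    qed
  qed
  have "nonneg (act g (comb a (unit_fun i) b (unit_fun j)))"
    if i: "i < r" "j < r" "m i j = \<infinity>" "len g < len (g \<otimes> w i)" "0 \<le> b" "b \<le> a" for i j a b
  proof (cases "len g < len (g \<otimes> w j)")
    case True
    then show ?thesis using ord i g by (simp add: act_comb nonneg_comb)
  next
    case False
    then have l1: "len g = Suc (len (g \<otimes> w j))" using len_gen_cases[of g j] g i by linarith
    define g1 where "g1 = g \<otimes> w j"
    have g1: "g1 \<in> carrier W" "g = g1 \<otimes> w j" "len g = Suc (len g1)"
      using g l1 i by (simp_all add: g1_def)
    have c: "cartan j i = -2" "m j i = \<infinity>" "i \<noteq> j"
      using i cartan_sym exponent_sym exponent_diag[of i]
      by (auto simp: cartan_simps one_enat_def)
    have "rfl j (comb a (unit_fun i) b (unit_fun j)) = comb (2 * a - b) (unit_fun j) a (unit_fun i)"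
      using i c by (intro ext, simp add: rfl_apply coroot_comb coroot_unit)
          (simp add: comb_def unit_fun_def)
    moreover have "nonneg (act g1 (comb (2 * a - b) (unit_fun j) a (unit_fun i)))"
      using IH2 g1 i c by simp
    ultimately show ?thesis using g1 i by (simp add: lift_mult)
  qed
  then show ?case using ord by blast
qed

lemma act_gen_unit_self:
  assumes "g \<in> carrier W" "i < r"
  shows "act (g \<otimes> w i) (unit_fun i) = (\<lambda>k. - act g (unit_fun i) k)"
  using assms by (simp add: lift_mult rfl_unit_self act_neg)

lemma root_sign:
  assumes "g \<in> carrier W" "i < r"
  shows "nonneg (act g (unit_fun i)) \<or> nonneg (\<lambda>k. - act g (unit_fun i) k)"
proof (cases "len g < len (g \<otimes> w i)")
  case True
  then show ?thesis using simple_root_ascent assms by blast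
next
  case False
  then have "len (g \<otimes> w i) < len (g \<otimes> w i \<otimes> w i)"
    using len_gen_cases[OF assms] assms by auto
  then have "nonneg (act (g \<otimes> w i) (unit_fun i))"
    using simple_root_ascent assms by blast
  then show ?thesis using act_gen_unit_self assms by simp
qed

lemma act_unit_nonzero:
  assumes "g \<in> carrier W" "act g (unit_fun i) = (\<lambda>k. 0)"
  shows False
proof -
  have "unit_fun i = act (inv g) (\<lambda>k. 0)" using assms lift_inv(1)[of rfl g "unit_fun i"] by simp
  then have "unit_fun i = (\<lambda>k. 0)" using act_zero assms(1) by simp
  then show False by (metis unit_fun_def zero_neq_one)
qed

text \<open>A nontrivial element has a descent, where it makes a simple root negative.\<close>

theorem positive_imp_one:
  assumes "g \<in> carrier W" "\<And>j. j < r \<Longrightarrow> nonneg (act g (unit_fun j))"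
  shows "g = \<one>"
proof (rule ccontr)
  assume "g \<noteq> \<one>"
  then obtain j where j: "j < r" "len g = Suc (len (g \<otimes> w j))" using descent_exists assms by blast
  then have "nonneg (act (g \<otimes> w j) (unit_fun j))"
    using simple_root_ascent[of "g \<otimes> w j"] assms by simp
  then have "nonneg (\<lambda>k. - act g (unit_fun j) k)" using act_gen_unit_self assms j by simp
  then have "act g (unit_fun j) = (\<lambda>k. 0)"
    using assms(2)[OF j(1)] unfolding nonneg_def fun_eq_iff by (metis antisym neg_0_le_iff_le)
  then show False using act_unit_nonzero assms by blast
qed

lemma act_faithful:
  assumes "g \<in> carrier W" "h \<in> carrier W" "\<And>v. act g v = act h v"
  shows "g = h"
proof -
  have "inv h \<otimes> g = \<one>"
  proof (rule positive_imp_one)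
    fix j show "nonneg (act (inv h \<otimes> g) (unit_fun j))"
      using assms by (simp add: lift_mult) (simp add: nonneg_def unit_fun_def)
  qed (use assms in simp)
  then show ?thesis using assms by (metis inv_closed inv_equality inv_inv)
qed

text \<open>The reflection \<open>w\<^sub>i\<close> changes only the \<open>i\<close>-th coordinate, so a positive root made negative by it is a
multiple of \<open>e\<^sub>i\<close>; integrality of the inverse action makes the factor \<open>1\<close>.\<close>

lemma sign_change_imp_conjugate:
  assumes "h \<in> carrier W" "i < r" "j < r"
    and pos: "nonneg (act h (unit_fun j))" and neg: "\<not> nonneg (act (w i \<otimes> h) (unit_fun j))"
  shows "inv h \<otimes> w i \<otimes> h = w j"
proof -
  let ?b = "act h (unit_fun j)"
  have neg': "nonneg (\<lambda>k. - rfl i ?b k)"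
    using root_sign[of "w i \<otimes> h" j] neg assms by (simp add: lift_mult)
  have z: "?b k = 0" if "k \<noteq> i" for k
  proof -
    have "0 \<le> ?b k" using pos by (simp add: nonneg_def)
    moreover have "0 \<le> - rfl i ?b k" using neg' unfolding nonneg_def by blast
    ultimately show ?thesis using that by (simp add: rfl_apply)
  qed
  then have b: "?b = (\<lambda>k. ?b i * unit_fun i k)" by (auto simp: unit_fun_def fun_eq_iff)
  have "unit_fun j = act (inv h) ?b" using assms by simp
  also have "\<dots> = act (inv h) (\<lambda>k. ?b i * unit_fun i k)" by (rule arg_cong[OF b])
  also have "\<dots> = (\<lambda>k. ?b i * act (inv h) (unit_fun i) k)" using assms by (simp add: act_scale)
  finally have "1 = ?b i * act (inv h) (unit_fun i) j" by (metis unit_fun_def)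
  moreover have "0 \<le> ?b i" using pos by (simp add: nonneg_def)
  ultimately have "?b i = 1" by (metis dvd_triv_left zdvd1_eq abs_of_nonneg)
  then have "(\<lambda>k. ?b i * unit_fun i k) = unit_fun i" by simp
  then have "?b = unit_fun i" by (rule HOL.trans[OF b])
  then have "h \<otimes> w j = w i \<otimes> h"
    by (intro act_faithful[OF _ _ reflection_conjugate]) (use assms(1-3) in simp_all)
  then have "inv h \<otimes> (w i \<otimes> h) = inv h \<otimes> (h \<otimes> w j)" by (rule arg_cong[OF HOL.sym])
  also have "\<dots> = w j"
    using assms(1-3) by (subst m_assoc[symmetric]) auto
  finally show ?thesis using assms(1-3) by (simp add: m_assoc)
qed

end

section \<open>Congruence subgroups\<close>

lemma mat_eq_of_mult_vec:
  fixes A B :: "'a :: comm_ring_1 mat"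
  assumes "A \<in> carrier_mat n k" "B \<in> carrier_mat n k"
    and "\<And>v. v \<in> carrier_vec k \<Longrightarrow> A *\<^sub>v v = B *\<^sub>v v"
  shows "A = B"
proof (rule eq_matI)
  fix i j assume ij: "i < dim_row B" "j < dim_col B"
  have "(A *\<^sub>v unit_vec k j) $ i = (B *\<^sub>v unit_vec k j) $ i" using assms(3) by simp
  then show "A $$ (i, j) = B $$ (i, j)" using assms(1,2) ij by simp
qed (use assms in auto)

context small_coxeter
begin

definition rep_mat :: "'g \<Rightarrow> int mat" where
  "rep_mat g = mat r r (\<lambda>(k, j). act g (unit_fun j) k)"

lemma rep_mat_carrier [simp]: "rep_mat g \<in> carrier_mat r r"
  by (simp add: rep_mat_def)

text \<open>Coroots read only the first \<open>r\<close> coordinates.\<close>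

lemma act_outside:
  assumes "g \<in> carrier W" "\<And>k. k < r \<Longrightarrow> v k = 0"
  shows "act g v = v"
  using assms(1)
proof (induction rule: word_induct)
  case (mult i h)
  have "coroot i v = 0" using assms(2) by (simp add: coroot_def)
  then show ?case using mult by (simp add: lift_mult) (simp add: rfl_def)
qed auto

lemma act_expand:
  assumes "g \<in> carrier W" "k < r"
  shows "act g v k = (\<Sum>j<r. act g (unit_fun j) k * v j)"
proof -
  define u where "u = (\<lambda>k. \<Sum>j<r. v j * unit_fun j k)"
  define o' where "o' = (\<lambda>k. v k - u k)"
  have u: "u k = v k" if "k < r" for k
    using that by (simp add: u_def unit_fun_def if_distrib[of "\<lambda>x. _ * x"] cong: if_cong)
  have "v = comb 1 u 1 o'" by (simp add: comb_def o'_def)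
  then have "act g v k = act g u k + act g o' k"
    using assms act_comb[of g 1 u 1 o'] by (simp add: comb_def)
  also have "act g o' = o'" by (rule act_outside) (use assms u in \<open>simp_all add: o'_def\<close>)
  also have "act g u = (\<lambda>k. \<Sum>j<r. v j * act g (unit_fun j) k)"
    unfolding u_def using assms by (simp add: act_sum)
  finally show ?thesis using assms u by (simp add: o'_def mult.commute)
qed

lemma rep_mat_mult:
  assumes "g \<in> carrier W" "h \<in> carrier W"
  shows "rep_mat (g \<otimes> h) = rep_mat g * rep_mat h"
proof (rule eq_matI)
  fix k j assume "k < dim_row (rep_mat g * rep_mat h)" "j < dim_col (rep_mat g * rep_mat h)"
  then have kj: "k < r" "j < r" by (simp_all add: rep_mat_def)
  then have "act (g \<otimes> h) (unit_fun j) k = (\<Sum>l<r. act g (unit_fun l) k * act h (unit_fun j) l)"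
    using assms by (simp add: lift_mult act_expand[of g k "act h (unit_fun j)"])
  then show "rep_mat (g \<otimes> h) $$ (k, j) = (rep_mat g * rep_mat h) $$ (k, j)"
    using kj by (simp add: rep_mat_def scalar_prod_def lessThan_atLeast0)
qed (simp_all add: rep_mat_def)

lemma rep_mat_one: "rep_mat \<one> = 1\<^sub>m r"
  by (rule eq_matI) (auto simp: rep_mat_def unit_fun_def)

definition real_rep :: "'g \<Rightarrow> real mat" where
  "real_rep = restrict (\<lambda>g. map_mat real_of_int (rep_mat g)) (carrier W)"

lemma real_rep_carrier: "g \<in> carrier W \<Longrightarrow> real_rep g \<in> carrier_mat r r"
  by (simp add: real_rep_def rep_mat_def)

lemma real_rep_mult:
  "g \<in> carrier W \<Longrightarrow> h \<in> carrier W \<Longrightarrow> real_rep (g \<otimes> h) = real_rep g * real_rep h"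
  by (simp add: real_rep_def rep_mat_mult of_int_hom.mat_hom_mult[of _ r r _ r])

lemma real_rep_one: "real_rep \<one> = 1\<^sub>m r"
  by (simp add: real_rep_def rep_mat_one of_int_hom.mat_hom_one)

lemma real_rep_hom: "real_rep \<in> hom W (GL TYPE(real) r)"
proof (rule homI)
  fix g assume g: "g \<in> carrier W"
  have "real_rep g * real_rep (inv g) = 1\<^sub>m r" "real_rep (inv g) * real_rep g = 1\<^sub>m r"
    using g by (simp_all flip: real_rep_mult add: real_rep_one)
  then show "real_rep g \<in> carrier (GL TYPE(real) r)"
    using real_rep_carrier g by (auto simp: units_of_def Units_def ring_mat_def intro!: bexI[of _ "real_rep (inv g)"])
qed (simp add: units_of_def ring_mat_def real_rep_mult)

lemma two_tits_coeff:
  assumes "i < r" "j < r"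
  shows "2 * tits_coeff m i j = real_of_int (cartan i j)"
proof (cases "i = j")
  case True
  then show ?thesis using assms exponent_diag[of i] by (simp add: tits_coeff_def cartan_def one_enat_def)
next
  case False
  show ?thesis
    by (rule exponent_cases[OF assms False])
      (simp_all add: tits_coeff_def cartan_def one_enat_def numeral_eq_enat cos_60)
qed

lemma tits_form_unit:
  assumes "i < r" "v \<in> carrier_vec r"
  shows "2 * tits_form r m (unit_vec r i) v = (\<Sum>j<r. real_of_int (cartan i j) * v $ j)"
proof -
  have "tits_form r m (unit_vec r i) v =
      (\<Sum>k<r. if k = i then (\<Sum>j<r. (v $ j) * tits_coeff m i j) else 0)"
    unfolding tits_form_def by (rule sum.cong) (auto simp: assms)
  also have "\<dots> = (\<Sum>j<r. (v $ j) * tits_coeff m i j)" using assms by simp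
  finally have "2 * tits_form r m (unit_vec r i) v = (\<Sum>j<r. (2 * tits_coeff m i j) * v $ j)"
    by (simp add: sum_distrib_left algebra_simps)
  also have "\<dots> = (\<Sum>j<r. real_of_int (cartan i j) * v $ j)"
    by (rule sum.cong) (use assms in \<open>simp_all add: two_tits_coeff\<close>)
  finally show ?thesis .
qed

lemma real_rep_gen:
  assumes "i < r" "v \<in> carrier_vec r"
  shows "real_rep (w i) *\<^sub>v v = v - (2 * tits_form r m (unit_vec r i) v) \<cdot>\<^sub>v unit_vec r i"
proof (rule eq_vecI)
  fix k assume "k < dim_vec (v - (2 * tits_form r m (unit_vec r i) v) \<cdot>\<^sub>v unit_vec r i)"
  then have k: "k < r" by simp
  have "(real_rep (w i) *\<^sub>v v) $ k = (\<Sum>j<r. real_of_int (rfl i (unit_fun j) k) * v $ j)"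
    using k assms by (simp add: real_rep_def rep_mat_def scalar_prod_def lessThan_atLeast0)
  also have "\<dots> = (\<Sum>j<r. (if j = k then v $ k else 0) -
      (if k = i then real_of_int (cartan i j) * v $ j else 0))"
    by (rule sum.cong, simp, simp add: rfl_apply coroot_unit)
      (auto simp: unit_fun_def algebra_simps)
  also have "\<dots> = v $ k - (if k = i then 2 * tits_form r m (unit_vec r i) v else 0)"
    using k assms by (auto simp: sum_subtractf tits_form_unit)
  finally show "(real_rep (w i) *\<^sub>v v) $ k =
      (v - (2 * tits_form r m (unit_vec r i) v) \<cdot>\<^sub>v unit_vec r i) $ k"
    using k assms by simp
qed (use assms in \<open>simp_all add: real_rep_def rep_mat_def\<close>)

lemma GL_group: "group (GL TYPE(real) r)"
proof -
  interpret R: ring "ring_mat TYPE(real) r ()" by (rule ring_mat)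
  show ?thesis by (rule R.units_group)
qed

text \<open>Existence comes from the integer action; uniqueness from the fact that the generators determine a homomorphism.\<close>

lemma tits_rep_eq: "tits_rep W r w m = real_rep"
  unfolding tits_rep_def
proof (rule the_equality)
  show "is_tits_rep W r w m real_rep"
    using real_rep_hom real_rep_gen by (simp add: is_tits_rep_def real_rep_def)
next
  fix \<rho> assume "is_tits_rep W r w m \<rho>"
  then have \<rho>: "\<rho> \<in> hom W (GL TYPE(real) r)" "\<rho> \<in> extensional (carrier W)"
    "\<And>i v. i < r \<Longrightarrow> v \<in> carrier_vec r \<Longrightarrow>
      \<rho> (w i) *\<^sub>v v = v - (2 * tits_form r m (unit_vec r i) v) \<cdot>\<^sub>v unit_vec r i"
    by (simp_all add: is_tits_rep_def)
  have c: "\<rho> g \<in> carrier_mat r r" if "g \<in> carrier W" for g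
    using hom_in_carrier[OF \<rho>(1) that] by (auto simp: units_of_def Units_def ring_mat_def)
  have "\<rho> g = real_rep g" if "g \<in> carrier W" for g
    using that
  proof (induction rule: word_induct)
    case one
    have "\<rho> \<one> = \<one>\<^bsub>GL TYPE(real) r\<^esub>" using hom_one[OF \<rho>(1) group_W GL_group] .
    then show ?case by (simp add: units_of_def ring_mat_def real_rep_one)
  next
    case (mult i h)
    have "\<rho> (w i) = real_rep (w i)"
      by (rule mat_eq_of_mult_vec[of _ r r]) (use mult c real_rep_carrier \<rho>(3) real_rep_gen in auto)
    moreover have "\<rho> (w i \<otimes> h) = \<rho> (w i) * \<rho> h"
      using hom_mult[OF \<rho>(1), of "w i" h] mult by (simp add: units_of_def ring_mat_def)
    ultimately show ?case using mult by (simp add: real_rep_mult)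
  qed
  then show "\<rho> = real_rep" 
    by (intro extensionalityI[OF \<rho>(2)]) (simp_all add: real_rep_def)
qed

lemma tits_rep_int_eq:
  assumes "g \<in> carrier W"
  shows "tits_rep_int W r w m g = rep_mat g"
  unfolding tits_rep_int_def tits_rep_eq
  by (rule the_equality) (use assms in \<open>simp_all add: real_rep_def of_int_hom.mat_hom_inj\<close>)

text \<open>The principal congruence subgroup, as the elements acting trivially on the lattice modulo \<open>n\<close>.
For \<open>n = 1\<close> it is the whole group.\<close>

definition cgr :: "nat \<Rightarrow> 'g set" where
  "cgr n = {g \<in> carrier W. \<forall>v k. int n dvd act g v k - v k}"

lemma cgr_subset_principal: "cgr n \<subseteq> principal_congruence_subgroup W r w m n"
proof
  fix g assume g: "g \<in> cgr n"
  then have "int n dvd act g (unit_fun j) k - unit_fun j k" for j k by (simp add: cgr_def)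
  then have "act g (unit_fun j) k mod int n = unit_fun j k mod int n" for j k
    by (simp add: mod_eq_dvd_iff)
  then have "reduce_mat n (rep_mat g) = reduce_mat n (1\<^sub>m r)"
    by (intro eq_matI) (simp_all add: reduce_mat_def rep_mat_def, simp add: unit_fun_def)
  then show "g \<in> principal_congruence_subgroup W r w m n"
    using g by (simp add: principal_congruence_subgroup_def kernel_def GL_mod_def units_of_def
        tits_rep_int_eq cgr_def)
qed

lemma cgrD: "g \<in> cgr n \<Longrightarrow> g \<in> carrier W" "g \<in> cgr n \<Longrightarrow> int n dvd act g v k - v k"
  by (simp_all add: cgr_def)

lemma cgr_witness:
  assumes "g \<in> cgr n"
  obtains t where "act g v = comb 1 v (int n) t"
proof
  show "act g v = comb 1 v (int n) (\<lambda>k. (act g v k - v k) div int n)"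
    using cgrD(2)[OF assms] by (auto simp: comb_def fun_eq_iff)
qed

lemma cgrI:
  assumes "g \<in> carrier W" "\<And>v. \<exists>t. act g v = comb 1 v (int n) t"
  shows "g \<in> cgr n"
  unfolding cgr_def using assms(1)
proof (intro CollectI conjI allI)
  fix v k
  obtain t where "act g v = comb 1 v (int n) t" using assms(2) by blast
  then show "int n dvd act g v k - v k" by (simp add: comb_def)
qed

lemma cgr_normal: "cgr n \<lhd> W"
proof (rule normal_invI)
  show "subgroup (cgr n) W"
  proof (rule subgroupI)
    show "cgr n \<subseteq> carrier W" by (auto simp: cgr_def)
    show "cgr n \<noteq> {}" by (auto simp: cgr_def)
  next
    fix g assume g: "g \<in> cgr n"
    show "inv g \<in> cgr n" unfolding cgr_def
    proof (intro CollectI conjI allI)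
      fix v k
      have "int n dvd act g (act (inv g) v) k - act (inv g) v k" using cgrD g by blast
      then show "int n dvd act (inv g) v k - v k" using cgrD g by (simp add: dvd_diff_commute)
    qed (use g cgrD in simp)
  next
    fix g h assume g: "g \<in> cgr n" "h \<in> cgr n"
    show "g \<otimes> h \<in> cgr n" unfolding cgr_def
    proof (intro CollectI conjI allI)
      fix v k
      have "int n dvd (act g (act h v) k - act h v k) + (act h v k - v k)"
        by (rule dvd_add) (use cgrD g in blast)+
      then show "int n dvd act (g \<otimes> h) v k - v k" using cgrD g by (simp add: lift_mult)
    qed (use g cgrD in simp)
  qed
next
  fix x g assume x: "x \<in> carrier W" and g: "g \<in> cgr n"
  show "x \<otimes> g \<otimes> inv x \<in> cgr n"
  proof (rule cgrI)
    fix v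
    obtain t where t: "act g (act (inv x) v) = comb 1 (act (inv x) v) (int n) t"
      using cgr_witness[OF g] by blast
    have "act (x \<otimes> g \<otimes> inv x) v = comb 1 v (int n) (act x t)"
      using x cgrD[OF g] t by (simp add: lift_mult act_comb)
    then show "\<exists>t. act (x \<otimes> g \<otimes> inv x) v = comb 1 v (int n) t" by blast
  qed (use x g cgrD in simp)
qed

lemma cgr_mono: "a dvd b \<Longrightarrow> cgr b \<subseteq> cgr a"
  unfolding cgr_def using int_dvd_int_iff dvd_trans by blast

text \<open>Writing \<open>g = 1 + a t\<close> and \<open>h = 1 + b s\<close>, the products \<open>g h\<close> and \<open>h g\<close> differ by \<open>a b (t s - s t)\<close>.\<close>

lemma cgr_commutator:
  assumes g: "g \<in> cgr a" and h: "h \<in> cgr b"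
  shows "g \<otimes> h \<otimes> inv (h \<otimes> g) \<in> cgr (a * b)"
proof (rule cgrI)
  have cl: "g \<in> carrier W" "h \<in> carrier W" using g h cgrD by auto
  fix v
  define u where "u = act (inv (h \<otimes> g)) v"
  have "v = act (h \<otimes> g) u" using cl by (simp add: u_def del: inv_mult_group)
  then have v: "v = act h (act g u)" using cl by (simp add: lift_mult)
  obtain s where s: "act h u = comb 1 u (int b) s" using cgr_witness[OF h] by blast
  obtain t where t: "act g u = comb 1 u (int a) t" using cgr_witness[OF g] by blast
  obtain s' where s': "act h t = comb 1 t (int b) s'" using cgr_witness[OF h] by blast
  obtain t' where t': "act g s = comb 1 s (int a) t'" using cgr_witness[OF g] by blast
  have "act g (act h u) = comb 1 (act h (act g u)) (int (a * b)) (comb 1 t' (-1) s')"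
    using cl s t s' t' by (simp add: act_comb) (auto simp: comb_def algebra_simps)
  moreover have "act (g \<otimes> h \<otimes> inv (h \<otimes> g)) v = act g (act h u)"
    using cl by (simp add: u_def lift_mult)
  ultimately show "\<exists>t. act (g \<otimes> h \<otimes> inv (h \<otimes> g)) v = comb 1 v (int (a * b)) t"
    using v by auto
qed (use g h cgrD in auto)

lemma cgr_finite_index:
  assumes "0 < n"
  shows "finite (rcosets (cgr n))"
proof (rule finite_rcosets_if_finite_invariant)
  let ?f = "\<lambda>g. \<lambda>(j, k) \<in> {..<r} \<times> {..<r}. act g (unit_fun j) k mod int n"
  show "subgroup (cgr n) W" using cgr_normal by (simp add: normal_imp_subgroup)
  have "?f ` carrier W \<subseteq> PiE ({..<r} \<times> {..<r}) (\<lambda>_. {0..<int n})"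
    by (intro image_subsetI, subst restrict_PiE_iff) (use assms in auto)
  then show "finite (?f ` carrier W)" by (rule finite_subset) (simp add: finite_PiE)
next
  fix g h assume gh: "g \<in> carrier W" "h \<in> carrier W"
    and eq: "(\<lambda>(j, k) \<in> {..<r} \<times> {..<r}. act g (unit_fun j) k mod int n) =
      (\<lambda>(j, k) \<in> {..<r} \<times> {..<r}. act h (unit_fun j) k mod int n)"
  have e: "int n dvd act g (unit_fun j) k - act h (unit_fun j) k" if "j < r" "k < r" for j k
    using fun_cong[OF eq, of "(j, k)"] that by (simp add: mod_eq_dvd_iff)
  have d: "int n dvd act g v k - act h v k" for v k
  proof (cases "k < r")
    case True
    then have "act g v k - act h v k =
        (\<Sum>j<r. (act g (unit_fun j) k - act h (unit_fun j) k) * v j)"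
      using gh by (simp add: act_expand[of _ k v] sum_subtractf left_diff_distrib)
    also have "int n dvd \<dots>" by (rule dvd_sum) (use e True in auto)
    finally show ?thesis .
  next
    case False
    have "act g v k = v k" if "g \<in> carrier W" for g
      using that
    proof (induction rule: word_induct)
      case (mult i h)
      have "rfl i u k = u k" for u using False mult by (simp add: rfl_def)
      then show ?case using mult by (simp add: lift_mult)
    qed simp
    then show ?thesis using gh by simp
  qed
  show "g \<otimes> inv h \<in> cgr n" unfolding cgr_def
  proof (intro CollectI conjI allI)
    fix v k
    show "int n dvd act (g \<otimes> inv h) v k - v k" using d[of "act (inv h) v" k] gh by (simp add: lift_mult)
  qed (use gh in simp)
qed

lemma not_in_cgr:
  assumes "g \<in> carrier W" "g \<noteq> \<one>"
  shows "\<exists>b. \<forall>n>b. g \<notin> cgr n"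
proof -
  obtain v where "act g v \<noteq> act \<one> v" using act_faithful[of g \<one>] assms by auto
  then obtain k where k: "act g v k \<noteq> v k" by (auto simp: fun_eq_iff)
  have "g \<notin> cgr n" if "n > nat \<bar>act g v k - v k\<bar>" for n
  proof
    assume "g \<in> cgr n"
    then have "int n dvd act g v k - v k" by (rule cgrD)
    then have "int n \<le> \<bar>act g v k - v k\<bar>" using k dvd_imp_le_int[of "act g v k - v k" "int n"] by simp
    then show False using that by linarith
  qed
  then show ?thesis by blast
qed

text \<open>Residual finiteness, a consequence of faithfulness: a nonzero integer is nonzero modulo every larger number.\<close>

lemma separating_level:
  assumes "finite A" "A \<subseteq> carrier W" "\<one> \<notin> A"
  shows "\<exists>n>0. 3 dvd n \<and> A \<inter> cgr n = {}"
proof -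
  have "\<exists>b. \<forall>n>b. A \<inter> cgr n = {}"
    using assms
  proof (induction A)
    case (insert g A)
    then obtain b c where "\<forall>n>b. A \<inter> cgr n = {}" "\<forall>n>c. g \<notin> cgr n" using not_in_cgr[of g] by auto
    then have "\<forall>n>max b c. insert g A \<inter> cgr n = {}" by simp
    then show ?case by blast
  qed auto
  then obtain b where "\<forall>n>b. A \<inter> cgr n = {}" by blast
  then show ?thesis by (intro exI[of _ "3 * (b + 1)"]) auto
qed

text \<open>The coefficient of \<open>e\<^sub>j\<close> in \<open>w\<^sub>i w\<^sub>j e\<^sub>j\<close> is \<open>- 1\<close>, which is not \<open>1\<close> modulo \<open>3\<close>.\<close>

lemma gen_mult_gen_notin_cgr:
  assumes "i < r" "j < r" "i \<noteq> j"
  shows "w i \<otimes> w j \<notin> cgr 3"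
proof
  assume "w i \<otimes> w j \<in> cgr 3"
  then have "int 3 dvd act (w i \<otimes> w j) (unit_fun j) j - unit_fun j j" by (rule cgrD)
  moreover have "act (w i \<otimes> w j) (unit_fun j) j = - 1"
    using assms by (simp add: lift_mult rfl_unit_self rfl_apply) (simp add: unit_fun_def)
  ultimately show False by (simp add: unit_fun_def)
qed

end

section \<open>Folding galleries along disjoint walls\<close>

text \<open>Elements \<open>x\<close> play the role of chambers, and passing from \<open>x\<close> to \<open>w\<^sub>i x\<close> crosses the wall of the reflection
\<open>x\<inverse> w\<^sub>i x\<close>. The set \<open>F\<close> holds the reflections at which galleries are folded, and \<open>lab\<close> gives the involution
applied there. Everything is read off in a quotient \<open>\<Gamma>\<close> of \<open>W\<close>, so that finite quotients give actions
on finite sets. The condition \<open>F_separated\<close> says that walls of \<open>F\<close> do not meet inside a finite rank two residue.\<close>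

locale fold_action = small_coxeter W r w m + \<Gamma>: group \<Gamma>
  for W :: "('g, 'x) monoid_scheme" (structure) and r w m and \<Gamma> :: "('h, 'y) monoid_scheme" +
  fixes \<pi> :: "'g \<Rightarrow> 'h" and F :: "'g set" and lab :: "'h \<Rightarrow> 'p \<Rightarrow> 'p"
  assumes \<pi>_hom: "\<pi> \<in> hom W \<Gamma>" and \<pi>_surj: "\<pi> ` carrier W = carrier \<Gamma>"
    and F_saturated: "\<And>g h. g \<in> F \<Longrightarrow> h \<in> carrier W \<Longrightarrow> \<pi> g = \<pi> h \<Longrightarrow> h \<in> F"
    and F_separated: "\<And>x i j. x \<in> carrier W \<Longrightarrow> i < r \<Longrightarrow> j < r \<Longrightarrow> i \<noteq> j \<Longrightarrow> m i j \<noteq> \<infinity> \<Longrightarrow>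
      inv x \<otimes> w i \<otimes> x \<in> F \<Longrightarrow> inv x \<otimes> w j \<otimes> x \<notin> F"
    and lab_lab: "\<And>x i p. x \<in> carrier W \<Longrightarrow> i < r \<Longrightarrow> inv x \<otimes> w i \<otimes> x \<in> F \<Longrightarrow>
      lab (\<pi> (inv x \<otimes> w i \<otimes> x)) (lab (\<pi> (inv x \<otimes> w i \<otimes> x)) p) = p"
begin

lemma \<pi>_closed: "x \<in> carrier W \<Longrightarrow> \<pi> x \<in> carrier \<Gamma>"
  using hom_in_carrier[OF \<pi>_hom] .

lemma \<pi>_mult: "x \<in> carrier W \<Longrightarrow> y \<in> carrier W \<Longrightarrow> \<pi> (x \<otimes> y) = \<pi> x \<otimes>\<^bsub>\<Gamma>\<^esub> \<pi> y"
  using hom_mult[OF \<pi>_hom] .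

lemma \<pi>_one: "\<pi> \<one> = \<one>\<^bsub>\<Gamma>\<^esub>"
  using hom_one[OF \<pi>_hom group_W \<Gamma>.is_group] .

lemma \<pi>_inv: "x \<in> carrier W \<Longrightarrow> \<pi> (inv x) = inv\<^bsub>\<Gamma>\<^esub> \<pi> x"
  using group_hom.hom_inv[of W \<Gamma> \<pi>] \<pi>_hom group_W \<Gamma>.is_group
  by (simp add: group_hom_def group_hom_axioms_def)

definition wall :: "nat \<Rightarrow> 'h \<Rightarrow> 'h" where
  "wall i y = inv\<^bsub>\<Gamma>\<^esub> y \<otimes>\<^bsub>\<Gamma>\<^esub> \<pi> (w i) \<otimes>\<^bsub>\<Gamma>\<^esub> y"

definition step :: "nat \<Rightarrow> 'h \<times> 'p \<Rightarrow> 'h \<times> 'p" where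
  "step i = (\<lambda>(y, p). if y \<notin> carrier \<Gamma> then (y, p)
     else if wall i y \<in> \<pi> ` F then (y, lab (wall i y) p) else (\<pi> (w i) \<otimes>\<^bsub>\<Gamma>\<^esub> y, p))"

lemma wall_image: "x \<in> carrier W \<Longrightarrow> i < r \<Longrightarrow> wall i (\<pi> x) = \<pi> (inv x \<otimes> w i \<otimes> x)"
  by (simp add: wall_def \<pi>_mult \<pi>_inv \<pi>_closed)

lemma image_mem_F: "x \<in> carrier W \<Longrightarrow> \<pi> x \<in> \<pi> ` F \<longleftrightarrow> x \<in> F"
  using F_saturated by (metis imageE imageI)

lemma wall_mem_F:
  "x \<in> carrier W \<Longrightarrow> i < r \<Longrightarrow> wall i (\<pi> x) \<in> \<pi> ` F \<longleftrightarrow> inv x \<otimes> w i \<otimes> x \<in> F"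
  by (simp only: wall_image image_mem_F m_closed inv_closed gen_closed)

lemma step_image:
  assumes "x \<in> carrier W" "i < r"
  shows "step i (\<pi> x, p) = (if inv x \<otimes> w i \<otimes> x \<in> F
     then (\<pi> x, lab (\<pi> (inv x \<otimes> w i \<otimes> x)) p) else (\<pi> (w i \<otimes> x), p))"
  using wall_mem_F[OF assms] wall_image[OF assms] assms by (simp add: step_def \<pi>_mult \<pi>_closed)

lemma conj_gen:
  assumes "x \<in> carrier W" "i < r" "j < r"
  shows "inv (w j \<otimes> x) \<otimes> w i \<otimes> (w j \<otimes> x) = inv x \<otimes> (w j \<otimes> (w i \<otimes> w j)) \<otimes> x"
  using assms by (simp add: inv_mult_group m_assoc)

text \<open>Around a finite rank two residue each wall is met exactly twice. At most one of these walls belongs to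
\<open>F\<close>, so the two visits contribute the same involution on both sides of the relation.\<close>

lemma coxeter_maps_step [simp]: "coxeter_maps step"
proof -
  have sq: "step i (step i (\<pi> x, p)) = (\<pi> x, p)" if "i < r" "x \<in> carrier W" for i x p
  proof -
    have "inv (w i \<otimes> x) \<otimes> w i \<otimes> (w i \<otimes> x) = inv x \<otimes> w i \<otimes> x"
      using that by (subst conj_gen) auto
    then show ?thesis using that by (simp add: step_image lab_lab)
  qed
  have comm: "step i (step j (\<pi> x, p)) = step j (step i (\<pi> x, p))"
    if ij: "i < r" "j < r" "m i j = 2" and x: "x \<in> carrier W" for i j x p
  proof -
    have ne: "i \<noteq> j" "m i j \<noteq> \<infinity>" "m j i = 2"
      using ij exponent_diag[of i] exponent_sym by (auto simp: numeral_eq_enat one_enat_def)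
    have c: "w i \<otimes> w j = w j \<otimes> w i" using gen_commute ij by blast
    have "w j \<otimes> (w i \<otimes> w j) = w i" "w i \<otimes> (w j \<otimes> w i) = w j"
      using c ij by (metis gen_cancel gen_closed)+
    then have "inv (w j \<otimes> x) \<otimes> w i \<otimes> (w j \<otimes> x) = inv x \<otimes> w i \<otimes> x"
      "inv (w i \<otimes> x) \<otimes> w j \<otimes> (w i \<otimes> x) = inv x \<otimes> w j \<otimes> x"
      using ij x by (simp_all only: conj_gen)
    moreover have "w i \<otimes> (w j \<otimes> x) = w j \<otimes> (w i \<otimes> x)"
      using c ij x by (metis gen_closed m_assoc)
    ultimately show ?thesis
      using ij x F_separated[OF x ij(1,2) ne(1,2)] by (auto simp: step_image)
  qed
  have braid: "step i (step j (step i (\<pi> x, p))) = step j (step i (step j (\<pi> x, p)))"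
    if ij: "i < r" "j < r" "m i j = 3" and x: "x \<in> carrier W" for i j x p
  proof -
    have ne: "i \<noteq> j" "m i j \<noteq> \<infinity>" "m j i \<noteq> \<infinity>"
      using ij exponent_diag[of i] exponent_sym by (auto simp: numeral_eq_enat one_enat_def)
    have c: "w i \<otimes> (w j \<otimes> w i) = w j \<otimes> (w i \<otimes> w j)" using gen_braid ij by blast
    define ti tj tk where "ti = inv x \<otimes> w i \<otimes> x" and "tj = inv x \<otimes> w j \<otimes> x"
      and "tk = inv x \<otimes> (w i \<otimes> (w j \<otimes> w i)) \<otimes> x"
    have ii: "inv (w i \<otimes> x) \<otimes> w i \<otimes> (w i \<otimes> x) = ti" "inv (w j \<otimes> x) \<otimes> w j \<otimes> (w j \<otimes> x) = tj"
      using ij x by (simp_all add: conj_gen ti_def tj_def)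
    have k: "inv (w i \<otimes> x) \<otimes> w j \<otimes> (w i \<otimes> x) = tk" "inv (w j \<otimes> x) \<otimes> w i \<otimes> (w j \<otimes> x) = tk"
      using ij x c by (simp_all add: conj_gen tk_def)
    have c': "w i \<otimes> (w j \<otimes> (w i \<otimes> y)) = w j \<otimes> (w i \<otimes> (w j \<otimes> y))" if "y \<in> carrier W" for y
      using arg_cong[OF c, of "\<lambda>g. g \<otimes> y"] ij that by (simp add: m_assoc)
    have "w j \<otimes> (w i \<otimes> (w j \<otimes> (w i \<otimes> (w j \<otimes> x)))) = w i \<otimes> x"
      "w i \<otimes> (w j \<otimes> (w i \<otimes> (w j \<otimes> (w i \<otimes> x)))) = w j \<otimes> x"
      using c'[of "w j \<otimes> x"] c'[of "w i \<otimes> x", symmetric] ij x by simp_all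
    then have kk: "inv (w i \<otimes> (w j \<otimes> x)) \<otimes> w j \<otimes> (w i \<otimes> (w j \<otimes> x)) = ti"
      "inv (w j \<otimes> (w i \<otimes> x)) \<otimes> w i \<otimes> (w j \<otimes> (w i \<otimes> x)) = tj"
      using ij x by (simp_all add: ti_def tj_def inv_mult_group m_assoc)
    have "ti \<in> F \<Longrightarrow> tj \<notin> F" using F_separated[OF x ij(1,2) ne(1,2)] by (simp add: ti_def tj_def)
    moreover have "ti \<in> F \<Longrightarrow> tk \<notin> F"
      using F_separated[of "w i \<otimes> x" i j] x ij ne ii k by simp
    moreover have "tj \<in> F \<Longrightarrow> tk \<notin> F"
      using F_separated[of "w j \<otimes> x" j i] x ij ne ii k by simp
    ultimately show ?thesis
      using ij x
      by (cases "ti \<in> F"; cases "tj \<in> F"; cases "tk \<in> F";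
          simp add: step_image ii k kk c'[OF x] flip: ti_def tj_def)
  qed
  have out: "step i s = s" if "fst s \<notin> carrier \<Gamma>" for i s
    using that by (cases s) (simp add: step_def)
  have all: "P s" if "\<And>x p. x \<in> carrier W \<Longrightarrow> P (\<pi> x, p)" "\<And>s. fst s \<notin> carrier \<Gamma> \<Longrightarrow> P s" for P s
    using that \<pi>_surj by (cases s) (metis fst_conv imageE)
  have "step i (step i s) = s" if "i < r" for i s
    by (rule all[of "\<lambda>s. step i (step i s) = s"]) (use that in \<open>simp_all add: sq out\<close>)
  moreover have "step i (step j s) = step j (step i s)" if "i < r" "j < r" "m i j = 2" for i j s
    by (rule all[of "\<lambda>s. step i (step j s) = step j (step i s)"])
      (use that comm in \<open>auto simp: out\<close>)
  moreover have "step i (step j (step i s)) = step j (step i (step j s))"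
    if "i < r" "j < r" "m i j = 3" for i j s
    by (rule all[of "\<lambda>s. step i (step j (step i s)) = step j (step i (step j s))"])
      (use that braid in \<open>auto simp: out\<close>)
  ultimately show ?thesis unfolding coxeter_maps_def by blast
qed

abbreviation fold :: "'g \<Rightarrow> 'h \<times> 'p \<Rightarrow> 'h \<times> 'p" where
  "fold \<equiv> lift step"

lemma fold_gen_mult:
  assumes "i < r" "g \<in> carrier W" "fold g s = (\<pi> x, p)" "x \<in> carrier W"
  shows "fold (w i \<otimes> g) s = (if inv x \<otimes> w i \<otimes> x \<in> F
     then (\<pi> x, lab (\<pi> (inv x \<otimes> w i \<otimes> x)) p) else (\<pi> (w i \<otimes> x), p))"
  using assms by (simp add: lift_mult step_image)

end

context small_coxeter
begin

text \<open>The chambers that can be reached from the identity without crossing a wall of \<open>F\<close>.\<close>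

inductive_set chamber :: "'g set \<Rightarrow> 'g set" for F where
  one: "\<one> \<in> chamber F"
| mult: "x \<in> chamber F \<Longrightarrow> i < r \<Longrightarrow> inv x \<otimes> w i \<otimes> x \<notin> F \<Longrightarrow> w i \<otimes> x \<in> chamber F"

lemma chamber_closed: "x \<in> chamber F \<Longrightarrow> x \<in> carrier W"
  by (induction rule: chamber.induct) auto

text \<open>The reflections of \<open>F\<close> whose walls bound the component of the identity.\<close>

definition panels :: "'g set \<Rightarrow> 'g set" where
  "panels F = {inv x \<otimes> w i \<otimes> x | x i. x \<in> chamber F \<and> i < r \<and> inv x \<otimes> w i \<otimes> x \<in> F}"

lemma panelsI: "x \<in> chamber F \<Longrightarrow> i < r \<Longrightarrow> inv x \<otimes> w i \<otimes> x \<in> F \<Longrightarrow> inv x \<otimes> w i \<otimes> x \<in> panels F"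
  by (auto simp: panels_def)

lemma panels_closed: "t \<in> panels F \<Longrightarrow> t \<in> carrier W"
  by (auto simp: panels_def chamber_closed)

lemma cancel_inv [simp]:
  assumes "x \<in> carrier W" "y \<in> carrier W"
  shows "x \<otimes> (inv x \<otimes> y) = y" "inv x \<otimes> (x \<otimes> y) = y"
  using assms by (simp_all add: m_assoc[symmetric])

lemma conj_gen_sq:
  assumes "x \<in> carrier W" "i < r"
  shows "(inv x \<otimes> w i \<otimes> x) \<otimes> (inv x \<otimes> w i \<otimes> x) = \<one>"
  using assms by (simp add: m_assoc)

lemma panels_sq: "t \<in> panels F \<Longrightarrow> t \<otimes> t = \<one>"
  by (auto simp: panels_def chamber_closed conj_gen_sq)

end

context fold_action
begin

lemma fold_chamber:
  assumes "x \<in> chamber F"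
  shows "fold x (\<one>\<^bsub>\<Gamma>\<^esub>, p) = (\<pi> x, p)"
  using assms
proof (induction rule: chamber.induct)
  case (mult x i)
  then show ?case using fold_gen_mult[of i x _ x] chamber_closed by simp
qed (simp add: \<pi>_one)

text \<open>Go to the wall inside the component, reflect there, and return along the same gallery.\<close>

lemma fold_panel:
  assumes "t \<in> panels F"
  shows "fold t (\<one>\<^bsub>\<Gamma>\<^esub>, p) = (\<one>\<^bsub>\<Gamma>\<^esub>, lab (\<pi> t) p)"
proof -
  obtain x i where x: "x \<in> chamber F" "i < r" "t \<in> F" "t = inv x \<otimes> w i \<otimes> x"
    using assms by (auto simp: panels_def)
  have xc: "x \<in> carrier W" using x chamber_closed by simp
  have "fold t (\<one>\<^bsub>\<Gamma>\<^esub>, p) = fold (inv x) (fold (w i \<otimes> x) (\<one>\<^bsub>\<Gamma>\<^esub>, p))"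
    using x(2,4) xc by (simp add: m_assoc lift_mult)
  also have "fold (w i \<otimes> x) (\<one>\<^bsub>\<Gamma>\<^esub>, p) = (\<pi> x, lab (\<pi> t) p)"
    using fold_gen_mult[OF x(2) xc fold_chamber[OF x(1)] xc] x(3,4) by simp
  also have "\<dots> = fold x (\<one>\<^bsub>\<Gamma>\<^esub>, lab (\<pi> t) p)" using fold_chamber[OF x(1)] by simp
  finally show ?thesis using xc by simp
qed

lemma fold_carrier:
  assumes "g \<in> carrier W" "fst s \<in> carrier \<Gamma>"
  shows "fst (fold g s) \<in> carrier \<Gamma>"
  using assms(1)
proof (induction rule: word_induct)
  case (mult i h)
  have "fst (step i s) \<in> carrier \<Gamma>" if "fst s \<in> carrier \<Gamma>" for s
    using that mult by (cases s) (simp add: step_def \<pi>_closed)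
  then show ?case using mult by (simp add: lift_mult)
qed (use assms(2) in simp)

end

context small_coxeter
begin

text \<open>The walls at which galleries will be folded are those of the reflections congruent to \<open>w\<^sub>j\<close> modulo \<open>3\<close>.\<close>

definition family :: "nat \<Rightarrow> 'g set" where
  "family j = cgr 3 #> w j"

lemma cgr_subgroup: "subgroup (cgr n) W"
  using cgr_normal by (rule normal_imp_subgroup)

lemma family_iff:
  assumes "j < r"
  shows "t \<in> family j \<longleftrightarrow> t \<in> carrier W \<and> t \<otimes> w j \<in> cgr 3"
proof
  assume "t \<in> family j"
  then obtain k where "k \<in> cgr 3" "t = k \<otimes> w j" by (auto simp: family_def r_coset_def)
  then show "t \<in> carrier W \<and> t \<otimes> w j \<in> cgr 3" using assms cgrD(1) by simp
next
  assume t: "t \<in> carrier W \<and> t \<otimes> w j \<in> cgr 3"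
  then have "t = (t \<otimes> w j) \<otimes> w j" using assms by simp
  then show "t \<in> family j" using t unfolding family_def r_coset_def by blast
qed

lemma family_conj:
  assumes j: "j < r" and t: "t \<in> carrier W" and n: "n \<in> cgr 3"
  shows "inv n \<otimes> t \<otimes> n \<in> family j \<longleftrightarrow> t \<in> family j"
proof -
  interpret K: normal "cgr 3" W by (rule cgr_normal)
  have *: "inv n \<otimes> t \<otimes> n \<in> family j" if n: "n \<in> cgr 3" and t: "t \<in> family j" for n t
  proof -
    have tc: "t \<in> carrier W" "t \<otimes> w j \<in> cgr 3" using t family_iff[OF j] by auto
    have nc: "n \<in> carrier W" using n cgrD by simp
    have "inv n \<otimes> (t \<otimes> w j) \<otimes> (w j \<otimes> n \<otimes> inv (w j)) \<in> cgr 3"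
      by (rule K.m_closed[OF K.m_closed[OF K.m_inv_closed[OF n] tc(2)]
            K.inv_op_closed2[OF gen_closed[OF j] n]])
    also have "inv n \<otimes> (t \<otimes> w j) \<otimes> (w j \<otimes> n \<otimes> inv (w j)) = inv n \<otimes> t \<otimes> n \<otimes> w j"
      using nc tc j by (simp add: m_assoc)
    finally show ?thesis using nc tc family_iff[OF j] by simp
  qed
  have nc: "n \<in> carrier W" using n cgrD by simp
  have "inv (inv n) \<otimes> (inv n \<otimes> t \<otimes> n) \<otimes> inv n = t"
    using nc t by (simp add: m_assoc)
  then show ?thesis using *[OF n, of t] *[OF K.m_inv_closed[OF n], of "inv n \<otimes> t \<otimes> n"] by auto
qed

text \<open>Two such reflections would have a product conjugate to \<open>w\<^sub>i w\<^sub>j\<close> in \<open>W[3]\<close>.\<close>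

lemma family_separated:
  assumes "l < r" "x \<in> carrier W" "i < r" "j < r" "i \<noteq> j" "inv x \<otimes> w i \<otimes> x \<in> family l"
  shows "inv x \<otimes> w j \<otimes> x \<notin> family l"
proof
  assume "inv x \<otimes> w j \<otimes> x \<in> family l"
  interpret K: normal "cgr 3" W by (rule cgr_normal)
  let ?a = "inv x \<otimes> w i \<otimes> x" and ?b = "inv x \<otimes> w j \<otimes> x"
  have "?a \<otimes> w l \<in> cgr 3" "?b \<otimes> w l \<in> cgr 3"
    using assms \<open>?b \<in> family l\<close> family_iff by auto
  then have "(?a \<otimes> w l) \<otimes> inv (?b \<otimes> w l) \<in> cgr 3" by simp
  also have "(?a \<otimes> w l) \<otimes> inv (?b \<otimes> w l) = inv x \<otimes> (w i \<otimes> w j) \<otimes> x"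
    using assms by (simp add: inv_mult_group m_assoc)
  finally have "x \<otimes> (inv x \<otimes> (w i \<otimes> w j) \<otimes> x) \<otimes> inv x \<in> cgr 3"
    using assms by (intro K.inv_op_closed2) auto
  also have "x \<otimes> (inv x \<otimes> (w i \<otimes> w j) \<otimes> x) \<otimes> inv x = w i \<otimes> w j"
    using assms by (simp add: m_assoc)
  finally show False using gen_mult_gen_notin_cgr assms by blast
qed

text \<open>A gallery that changes the sign of the root \<open>e\<^sub>j\<close> crosses the wall of \<open>w\<^sub>j\<close>, which belongs to the family.\<close>

lemma chamber_positive:
  assumes j: "j < r" and x: "x \<in> chamber (family j)"
  shows "nonneg (act x (unit_fun j))"
  using x
proof (induction rule: chamber.induct)
  case one
  then show ?case by (simp add: nonneg_def unit_fun_def)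
next
  case (mult x i)
  then have "x \<in> carrier W" using chamber_closed by blast
  have "w j \<in> family j"
    using j family_iff[OF j] subgroup.one_closed[OF cgr_subgroup, of 3] by simp
  then show ?case
    using sign_change_imp_conjugate[OF \<open>x \<in> carrier W\<close> mult.hyps(2) j mult.IH] mult.hyps by metis
qed

lemma fold_action_quotient:
  assumes j: "j < r" and n: "3 dvd n"
    and lab: "\<And>t p. t \<in> rcosets (cgr n) \<Longrightarrow> lab t (lab t p) = p"
  shows "fold_action W r w m (W Mod cgr n) (\<lambda>g. cgr n #> g) (family j) lab"
proof -
  interpret N: normal "cgr n" W by (rule cgr_normal)
  interpret Q: group "W Mod cgr n" by (rule N.factorgroup_is_group)
  show ?thesis
  proof
    show "(\<lambda>g. cgr n #> g) \<in> hom W (W Mod cgr n)" by (rule N.r_coset_hom_Mod)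
    show "(\<lambda>g. cgr n #> g) ` carrier W = carrier (W Mod cgr n)"
      by (auto simp: FactGroup_def RCOSETS_def)
  next
    fix g h assume g: "g \<in> family j" and h: "h \<in> carrier W" and eq: "cgr n #> g = cgr n #> h"
    have "h \<in> cgr n #> g" using eq h cgr_subgroup by (simp add: rcos_self)
    then obtain k where k: "k \<in> cgr n" "h = k \<otimes> g" by (auto simp: r_coset_def)
    then have "k \<in> cgr 3" using cgr_mono[OF n] by blast
    moreover have "g \<in> carrier W" "g \<otimes> w j \<in> cgr 3" using g family_iff[OF j] by auto
    ultimately have "k \<otimes> (g \<otimes> w j) \<in> cgr 3" using subgroup.m_closed[OF cgr_subgroup] by blast
    then show "h \<in> family j" using k h \<open>g \<in> carrier W\<close> j cgrD(1)[OF k(1)] family_iff[OF j] by (simp add: m_assoc)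
  next
    fix x i k assume "x \<in> carrier W" "i < r" "k < r" "i \<noteq> k" "inv x \<otimes> w i \<otimes> x \<in> family j"
    then show "inv x \<otimes> w k \<otimes> x \<notin> family j" using family_separated[OF j] by blast
  next
    fix x i p assume "x \<in> carrier W" "i < r"
    then have "cgr n #> (inv x \<otimes> w i \<otimes> x) \<in> rcosets (cgr n)"
      using rcosetsI[OF N.subset] by simp
    then show "lab (cgr n #> (inv x \<otimes> w i \<otimes> x)) (lab (cgr n #> (inv x \<otimes> w i \<otimes> x)) p) = p"
      by (rule lab)
  qed
qed

text \<open>With this label, folding \<open>g\<close> from \<open>(1, 1)\<close> records the factorisation \<open>g = x q\<close>; outside the carrier the
label is the identity so that it is an involution everywhere.\<close>

definition left_label :: "'g \<Rightarrow> 'g \<Rightarrow> 'g" where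
  "left_label t q = (if q \<in> carrier W then t \<otimes> q else q)"

lemma fold_action_self:
  assumes j: "j < r"
  shows "fold_action W r w m W (\<lambda>g. g) (family j) left_label"
proof
  show "(\<lambda>g. g) \<in> hom W W" by (simp add: hom_def)
next
  fix x i p assume x: "x \<in> carrier W" "i < r"
  have "(inv x \<otimes> w i \<otimes> x) \<otimes> ((inv x \<otimes> w i \<otimes> x) \<otimes> p) = p" if "p \<in> carrier W"
    using x that conj_gen_sq[OF x] by (subst m_assoc[symmetric]) auto
  then show "left_label ((inv x \<otimes> w i \<otimes> x)) (left_label ((inv x \<otimes> w i \<otimes> x)) p) = p"
    using x by (simp add: left_label_def)
qed (use family_separated[OF j] in auto)

end

section \<open>Components with at most two bounding walls\<close>

context small_coxeter
begin

lemma conj_wall_translate: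
  assumes "x \<in> carrier W" "n \<in> carrier W" "i < r"
  shows "inv (x \<otimes> n) \<otimes> w i \<otimes> (x \<otimes> n) = inv n \<otimes> (inv x \<otimes> w i \<otimes> x) \<otimes> n"
  using assms by (simp add: inv_mult_group m_assoc)

lemma chamber_translate:
  assumes j: "j < r" and n: "n \<in> chamber (family j)" "n \<in> cgr 3"
    and x: "x \<in> chamber (family j)"
  shows "x \<otimes> n \<in> chamber (family j)"
  using x
proof (induction rule: chamber.induct)
  case one
  then show ?case using n chamber_closed by simp
next
  case (mult x i)
  have cl: "x \<in> carrier W" "n \<in> carrier W" using mult n chamber_closed by auto
  have "inv (x \<otimes> n) \<otimes> w i \<otimes> (x \<otimes> n) \<notin> family j"
    using mult cl family_conj[OF j _ n(2), of "inv x \<otimes> w i \<otimes> x"] by (simp add: conj_wall_translate)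
  then have "w i \<otimes> (x \<otimes> n) \<in> chamber (family j)" using mult by (intro chamber.mult) auto
  then show ?case using cl mult by (simp add: m_assoc)
qed

lemma panels_translate:
  assumes j: "j < r" and n: "n \<in> chamber (family j)" "n \<in> cgr 3"
    and t: "t \<in> panels (family j)"
  shows "inv n \<otimes> t \<otimes> n \<in> panels (family j)"
proof -
  obtain x i where x: "x \<in> chamber (family j)" "i < r" "t \<in> family j" "t = inv x \<otimes> w i \<otimes> x"
    using t by (auto simp: panels_def)
  have cl: "x \<in> carrier W" "n \<in> carrier W" using x n chamber_closed by auto
  have "inv (x \<otimes> n) \<otimes> w i \<otimes> (x \<otimes> n) = inv n \<otimes> t \<otimes> n"
    using x cl by (simp only: conj_wall_translate)
  moreover have "inv n \<otimes> t \<otimes> n \<in> family j"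
    using family_conj[OF j _ n(2), of t] x cl by simp
  ultimately show ?thesis using panelsI[OF chamber_translate[OF j n x(1)] x(2)] by simp
qed

end

text \<open>Two actions are compared: \<open>A\<close> folds in \<open>W\<close> itself and records the product of the reflections met, while
\<open>B\<close> folds at the finite level \<open>n\<close> and records only the parity of their number.\<close>

locale two_panels = small_coxeter +
  fixes j n :: nat and t1 t2
  assumes j: "j < r" and n: "3 dvd n"
    and t1: "t1 \<in> carrier W" "t1 \<otimes> t1 = \<one>" and t2: "t2 \<in> carrier W" "t2 \<otimes> t2 = \<one>"
    and two: "panels (family j) \<subseteq> {t1, t2}"
    and sep: "\<And>s t. s \<in> panels (family j) \<Longrightarrow> t \<in> panels (family j) \<Longrightarrow> s \<otimes> inv t \<in> cgr n \<Longrightarrow> s = t"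
begin

sublocale A: fold_action W r w m W "\<lambda>g. g" "family j" left_label
  by (rule fold_action_self[OF j])

sublocale B: fold_action W r w m "W Mod cgr n" "\<lambda>g. cgr n #> g" "family j" "\<lambda>_. Not"
  by (rule fold_action_quotient[OF j n]) simp

sublocale N: normal "cgr n" W by (rule cgr_normal)

text \<open>Such an element permutes the bounding walls by conjugation, and level \<open>n\<close> separates these walls.\<close>

lemma centralizes:
  assumes x: "x \<in> chamber (family j)" "x \<in> cgr n" and t: "t \<in> panels (family j)"
  shows "inv x \<otimes> t \<otimes> x = t"
proof (rule sep)
  have x3: "x \<in> cgr 3" using x cgr_mono[OF n] by blast
  have cl: "x \<in> carrier W" "t \<in> carrier W" using x t chamber_closed panels_closed by auto
  show "inv x \<otimes> t \<otimes> x \<in> panels (family j)" by (rule panels_translate[OF j x(1) x3 t])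
  have "inv x \<otimes> (t \<otimes> x \<otimes> inv t) \<in> cgr n"
    by (rule N.m_closed[OF N.m_inv_closed[OF x(2)] N.inv_op_closed2[OF cl(2) x(2)]])
  then show "inv x \<otimes> t \<otimes> x \<otimes> inv t \<in> cgr n" using cl by (simp add: m_assoc)
qed (rule t)

text \<open>Folding commutes with right translation by an element of the component at level \<open>n\<close>, because
the translation carries the walls of the family to walls of the family and fixes the bounding ones.\<close>

lemma fold_translate:
  assumes y: "y \<in> chamber (family j)" "y \<in> cgr n" and p: "p \<in> carrier W" and g: "g \<in> carrier W"
  shows "\<exists>x\<in>chamber (family j). \<exists>q\<in>carrier W. A.fold g (\<one>, \<one>) = (x, q) \<and>
    A.fold g (y, p) = (x \<otimes> y, q \<otimes> p)"
  using g
proof (induction rule: word_induct)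
  case one
  show ?case
    by (rule bexI[of _ \<one>], rule bexI[of _ \<one>]) (use y p chamber_closed[OF y(1)] in \<open>simp_all add: chamber.one\<close>)
next
  case (mult i h)
  then obtain x q where x: "x \<in> chamber (family j)" "q \<in> carrier W" "A.fold h (\<one>, \<one>) = (x, q)"
    "A.fold h (y, p) = (x \<otimes> y, q \<otimes> p)" by blast
  have cl: "x \<in> carrier W" "y \<in> carrier W" using x y chamber_closed by auto
  define t where "t = inv x \<otimes> w i \<otimes> x"
  have tc: "t \<in> carrier W" using mult cl by (simp add: t_def)
  have t': "inv (x \<otimes> y) \<otimes> w i \<otimes> (x \<otimes> y) = inv y \<otimes> t \<otimes> y"
    using cl mult by (simp only: conj_wall_translate t_def)
  have y3: "y \<in> cgr 3" using y cgr_mono[OF n] by blast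
  have iff: "inv y \<otimes> t \<otimes> y \<in> family j \<longleftrightarrow> t \<in> family j" by (rule family_conj[OF j tc y3])
  have f1: "A.fold (w i \<otimes> h) (\<one>, \<one>) =
      (if t \<in> family j then (x, left_label t q) else (w i \<otimes> x, q))"
    using A.fold_gen_mult[of i h "(\<one>, \<one>)" x q] x(3) mult cl unfolding t_def by simp
  have f2: "A.fold (w i \<otimes> h) (y, p) = (if t \<in> family j
      then (x \<otimes> y, left_label (inv y \<otimes> t \<otimes> y) (q \<otimes> p)) else (w i \<otimes> (x \<otimes> y), q \<otimes> p))"
    using A.fold_gen_mult[of i h "(y, p)" "x \<otimes> y" "q \<otimes> p"] x(4) mult cl unfolding t' iff by simp
  show ?case
  proof (cases "t \<in> family j")
    case True
    then have "t \<in> panels (family j)" using panelsI x(1) mult(1) unfolding t_def by blast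
    then have "inv y \<otimes> t \<otimes> y = t" by (rule centralizes[OF y])
    then have "A.fold (w i \<otimes> h) (\<one>, \<one>) = (x, t \<otimes> q)"
      "A.fold (w i \<otimes> h) (y, p) = (x \<otimes> y, (t \<otimes> q) \<otimes> p)" "t \<otimes> q \<in> carrier W"
      using True f1 f2 x(2) tc p by (simp_all add: left_label_def m_assoc)
    then show ?thesis using x(1) by blast
  next
    case False
    then have "w i \<otimes> x \<in> chamber (family j)" using chamber.mult x(1) mult(1) unfolding t_def by blast
    moreover have "A.fold (w i \<otimes> h) (\<one>, \<one>) = (w i \<otimes> x, q)"
      "A.fold (w i \<otimes> h) (y, p) = ((w i \<otimes> x) \<otimes> y, q \<otimes> p)"
      using False f1 f2 cl mult(1) by (simp_all add: m_assoc)
    ultimately show ?thesis using x(2) by blast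
  qed
qed

lemma panel_power_step:
  fixes k :: int
  assumes "t \<in> panels (family j)"
  shows "\<exists>l::int. t \<otimes> (t1 \<otimes> t2) [^] k = t1 \<otimes> (t1 \<otimes> t2) [^] l"
    and "\<exists>l::int. t \<otimes> (t1 \<otimes> (t1 \<otimes> t2) [^] k) = (t1 \<otimes> t2) [^] l"
proof -
  let ?c = "t1 \<otimes> t2"
  have cl: "?c \<in> carrier W" "?c [^] k \<in> carrier W" using t1 t2 by auto
  have canc: "t1 \<otimes> (t1 \<otimes> y) = y" if "y \<in> carrier W" for y
    using that t1 by (simp flip: m_assoc)
  have 1: "t2 \<otimes> ?c [^] k = t1 \<otimes> ?c [^] (1 + k)"
    using t1 t2 cl by (simp only: int_pow_mult int_pow_1) (simp add: m_assoc canc)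
  have "inv ?c = t2 \<otimes> t1"
    using t1 t2 by (intro inv_equality) (simp_all add: m_assoc canc)
  then have "?c [^] (- 1 :: int) = t2 \<otimes> t1" using cl by (simp add: int_pow_neg)
  then have 2: "t2 \<otimes> (t1 \<otimes> ?c [^] k) = ?c [^] (- 1 + k)"
    using t1 t2 cl by (simp only: int_pow_mult) (simp add: m_assoc)
  have t: "t = t1 \<or> t = t2" using assms two by blast
  then show "\<exists>l::int. t \<otimes> ?c [^] k = t1 \<otimes> ?c [^] l" using 1 by blast
  show "\<exists>l::int. t \<otimes> (t1 \<otimes> ?c [^] k) = ?c [^] l" using t 2 canc[OF cl(2)] by metis
qed

text \<open>A product of an even number of bounding reflections is a power of \<open>t\<^sub>1 t\<^sub>2\<close>, and a product of an odd
number is \<open>t\<^sub>1\<close> times such a power.\<close>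

lemma fold_decomposition:
  assumes g: "g \<in> carrier W"
  shows "\<exists>x\<in>chamber (family j). \<exists>q\<in>carrier W. \<exists>b. \<exists>k::int. A.fold g (\<one>, \<one>) = (x, q) \<and> g = x \<otimes> q \<and>
    B.fold g (\<one>\<^bsub>W Mod cgr n\<^esub>, True) = (cgr n #> x, b) \<and>
    q = (if b then (t1 \<otimes> t2) [^] k else t1 \<otimes> (t1 \<otimes> t2) [^] k)"
  using g
proof (induction rule: word_induct)
  case one
  have "B.fold \<one> (\<one>\<^bsub>W Mod cgr n\<^esub>, True) = (cgr n #> \<one>, True)"
    using coset_mult_one[OF N.subset] by simp
  moreover have "\<one> = (if True then (t1 \<otimes> t2) [^] (0::int) else t1 \<otimes> (t1 \<otimes> t2) [^] (0::int))" by simp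
  moreover have "A.fold \<one> (\<one>, \<one>) = (\<one>, \<one>)" "\<one> = \<one> \<otimes> \<one>" by simp_all
  ultimately show ?case using chamber.one one_closed by blast
next
  case (mult i h)
  then obtain x q b k where x: "x \<in> chamber (family j)" "q \<in> carrier W" "A.fold h (\<one>, \<one>) = (x, q)"
    "h = x \<otimes> q" "B.fold h (\<one>\<^bsub>W Mod cgr n\<^esub>, True) = (cgr n #> x, b)"
    "q = (if b then (t1 \<otimes> t2) [^] (k::int) else t1 \<otimes> (t1 \<otimes> t2) [^] k)" by blast
  have cl: "x \<in> carrier W" using x chamber_closed by auto
  define t where "t = inv x \<otimes> w i \<otimes> x"
  have tc: "t \<in> carrier W" using mult cl by (simp add: t_def)
  have f1: "A.fold (w i \<otimes> h) (\<one>, \<one>) =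
      (if t \<in> family j then (x, left_label t q) else (w i \<otimes> x, q))"
    using A.fold_gen_mult[of i h "(\<one>, \<one>)" x q] x(3) mult cl unfolding t_def by simp
  have f2: "B.fold (w i \<otimes> h) (\<one>\<^bsub>W Mod cgr n\<^esub>, True) =
      (if t \<in> family j then (cgr n #> x, \<not> b) else (cgr n #> (w i \<otimes> x), b))"
    using B.fold_gen_mult[OF mult(1,2) x(5) cl] unfolding t_def by simp
  show ?case
  proof (cases "t \<in> family j")
    case True
    then have tp: "t \<in> panels (family j)" using panelsI x(1) mult(1) unfolding t_def by blast
    obtain l :: int where l: "t \<otimes> q = (if \<not> b then (t1 \<otimes> t2) [^] l else t1 \<otimes> (t1 \<otimes> t2) [^] l)"
      using panel_power_step[OF tp, of k] x(6) by (cases b) auto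
    have "w i \<otimes> h = x \<otimes> (t \<otimes> q)" using x(2,4) cl mult(1) by (simp add: t_def m_assoc)
    moreover have "A.fold (w i \<otimes> h) (\<one>, \<one>) = (x, t \<otimes> q)" "t \<otimes> q \<in> carrier W"
      "B.fold (w i \<otimes> h) (\<one>\<^bsub>W Mod cgr n\<^esub>, True) = (cgr n #> x, \<not> b)"
      using True f1 f2 x(2) tc by (simp_all add: left_label_def)
    ultimately show ?thesis using x(1) l by blast
  next
    case False
    then have "w i \<otimes> x \<in> chamber (family j)" using chamber.mult x(1) mult(1) unfolding t_def by blast
    moreover have "A.fold (w i \<otimes> h) (\<one>, \<one>) = (w i \<otimes> x, q)" "w i \<otimes> h = (w i \<otimes> x) \<otimes> q"
      "B.fold (w i \<otimes> h) (\<one>\<^bsub>W Mod cgr n\<^esub>, True) = (cgr n #> (w i \<otimes> x), b)"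
      using False f1 f2 x(2,4) cl mult(1) by (simp_all add: m_assoc)
    ultimately show ?thesis using x(2,6) by blast
  qed
qed

definition stab where
  "stab = {g \<in> carrier W. B.fold g (\<one>\<^bsub>W Mod cgr n\<^esub>, True) = (\<one>\<^bsub>W Mod cgr n\<^esub>, True)}"

lemma stab_inv: "g \<in> stab \<Longrightarrow> inv g \<in> stab"
  using lift_inv(1)[OF B.coxeter_maps_step, of g "(\<one>\<^bsub>W Mod cgr n\<^esub>, True)"]
  by (auto simp: stab_def)

lemma stab_mult: "g \<in> stab \<Longrightarrow> h \<in> stab \<Longrightarrow> g \<otimes> h \<in> stab"
  by (simp add: stab_def lift_mult)

lemma stab_decomposition:
  assumes "g \<in> stab"
  shows "\<exists>x\<in>chamber (family j). \<exists>k::int. x \<in> cgr n \<and> A.fold g (\<one>, \<one>) = (x, (t1 \<otimes> t2) [^] k)"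
proof -
  have g: "g \<in> carrier W" "B.fold g (\<one>\<^bsub>W Mod cgr n\<^esub>, True) = (\<one>\<^bsub>W Mod cgr n\<^esub>, True)"
    using assms by (auto simp: stab_def)
  obtain x q b k where x: "x \<in> chamber (family j)" "A.fold g (\<one>, \<one>) = (x, q)"
    "B.fold g (\<one>\<^bsub>W Mod cgr n\<^esub>, True) = (cgr n #> x, b)"
    "q = (if b then (t1 \<otimes> t2) [^] (k::int) else t1 \<otimes> (t1 \<otimes> t2) [^] k)"
    using fold_decomposition[OF g(1)] by blast
  then have b: "b" "cgr n #> x = cgr n" using g(2) by simp_all
  then have "x \<in> cgr n" using rcos_self[OF chamber_closed[OF x(1)] N.is_subgroup] by simp
  then show ?thesis using x b by auto
qed

text \<open>On the stabiliser the recorded product is a homomorphism into the powers of \<open>t\<^sub>1 t\<^sub>2\<close>, so it is trivial on commutators.\<close>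

lemma stab_commutator:
  assumes g: "g \<in> stab" and h: "h \<in> stab"
  shows "g \<otimes> h \<otimes> inv (h \<otimes> g) \<in> chamber (family j)"
proof -
  let ?c = "t1 \<otimes> t2"
  have c: "?c \<in> carrier W" using t1 t2 by simp
  have gc: "g \<in> carrier W" "h \<in> carrier W" using g h by (auto simp: stab_def)
  have mult: "\<exists>x\<in>chamber (family j). x \<in> cgr n \<and> A.fold (g \<otimes> h) (\<one>, \<one>) = (x, ?c [^] (k + l))"
    if gh: "g \<in> stab" "h \<in> stab" and k: "snd (A.fold g (\<one>, \<one>)) = ?c [^] k"
      and l: "snd (A.fold h (\<one>, \<one>)) = ?c [^] l"
    for g h and k l :: int
  proof -
    have cl: "g \<in> carrier W" "h \<in> carrier W" using gh by (auto simp: stab_def)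
    obtain x where x: "x \<in> chamber (family j)" "x \<in> cgr n" "A.fold g (\<one>, \<one>) = (x, ?c [^] k)"
      using stab_decomposition[OF gh(1)] k by auto
    obtain y where y: "y \<in> chamber (family j)" "y \<in> cgr n" "A.fold h (\<one>, \<one>) = (y, ?c [^] l)"
      using stab_decomposition[OF gh(2)] l by auto
    have "A.fold g (y, ?c [^] l) = (x \<otimes> y, ?c [^] k \<otimes> ?c [^] l)"
      using fold_translate[OF y(1,2) int_pow_closed[OF c] cl(1), of l] x(3) by auto
    then have "A.fold (g \<otimes> h) (\<one>, \<one>) = (x \<otimes> y, ?c [^] (k + l))"
      using cl c y by (simp add: lift_mult int_pow_mult)
    moreover have "y \<in> cgr 3" using y(2) cgr_mono[OF n] by blast
    ultimately show ?thesis using chamber_translate[OF j y(1) _ x(1)] x y by auto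
  qed
  obtain k where k: "snd (A.fold g (\<one>, \<one>)) = ?c [^] (k::int)" using stab_decomposition[OF g] by auto
  obtain l where l: "snd (A.fold h (\<one>, \<one>)) = ?c [^] (l::int)" using stab_decomposition[OF h] by auto
  define y where "y = g \<otimes> h \<otimes> inv (h \<otimes> g)"
  have ys: "y \<in> stab" unfolding y_def using g h by (intro stab_mult stab_inv)
  then have yc: "y \<in> carrier W" by (simp add: stab_def)
  obtain x q where x: "x \<in> chamber (family j)" "q \<in> carrier W" "A.fold y (\<one>, \<one>) = (x, q)" "y = x \<otimes> q"
    using fold_decomposition[OF yc] by blast
  obtain x' where x': "x' \<in> chamber (family j)" "x' \<in> cgr n"
    "A.fold (h \<otimes> g) (\<one>, \<one>) = (x', ?c [^] (l + k))" using mult[OF h g l k] by blast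
  obtain x'' where x'': "A.fold (g \<otimes> h) (\<one>, \<one>) = (x'', ?c [^] (k + l))"
    using mult[OF g h k l] by blast
  have "y \<otimes> (h \<otimes> g) = g \<otimes> h" using gc by (simp add: y_def m_assoc del: inv_mult_group) 
  then have "A.fold y (A.fold (h \<otimes> g) (\<one>, \<one>)) = A.fold (g \<otimes> h) (\<one>, \<one>)"
    using gc yc lift_mult[OF A.coxeter_maps_step yc, of "h \<otimes> g"] by simp
  moreover have "A.fold y (x', ?c [^] (l + k)) = (x \<otimes> x', q \<otimes> ?c [^] (l + k))"
    using fold_translate[OF x'(1,2) int_pow_closed[OF c] yc, of "l + k"] x(3) by auto
  ultimately have "q \<otimes> ?c [^] (k + l) = ?c [^] (k + l)" using x' x'' by (simp add: add.commute)
  then have "q = \<one>" using x(2) c right_cancel[of "?c [^] (k + l)" q \<one>] by simp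
  then show ?thesis using x chamber_closed by (simp add: y_def)
qed

end

context small_coxeter
begin

text \<open>Allowing \<open>t\<^sub>1\<close> and \<open>t\<^sub>2\<close> to be the identity covers fewer than two bounding walls.\<close>

definition few_panels :: "nat \<Rightarrow> bool" where
  "few_panels j \<longleftrightarrow> (\<exists>t1\<in>carrier W. \<exists>t2\<in>carrier W. t1 \<otimes> t1 = \<one> \<and> t2 \<otimes> t2 = \<one> \<and> panels (family j) \<subseteq> {t1, t2})"

text \<open>The subgroup is the common stabiliser of the base points of the finite folded actions, one for each
\<open>j\<close>. A commutator in it lies in every component, so no simple root becomes negative.\<close>

theorem few_panels_imp_virtually_abelian:
  assumes few: "\<And>j. j < r \<Longrightarrow> few_panels j"
  shows "virtually_abelian W"
proof -
  define P where "P = (\<Union>j<r. panels (family j))"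
  have "finite (panels (family j))" if "j < r" for j
    using few[OF that] unfolding few_panels_def by (meson finite.emptyI finite_insert finite_subset)
  then have finP: "finite P" by (simp add: P_def)
  \<comment> \<open>A level avoiding \<open>D\<close> separates all bounding reflections.\<close>
  define D where "D = {s \<otimes> inv t | s t. s \<in> P \<and> t \<in> P \<and> s \<noteq> t}"
  have "D \<subseteq> (\<lambda>(s, t). s \<otimes> inv t) ` (P \<times> P)" unfolding D_def by auto
  then have finD: "finite D" using finP by (meson finite_SigmaI finite_imageI finite_subset)
  have Pc: "t \<in> carrier W" if "t \<in> P" for t using that panels_closed by (auto simp: P_def)
  have eq: "s = t" if "s \<otimes> inv t = \<one>" "s \<in> P" "t \<in> P" for s t
    using that inv_equality[of s "inv t"] Pc by simp
  have "D \<subseteq> carrier W" using Pc by (auto simp: D_def)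
  moreover have "\<one> \<notin> D"
  proof
    assume "\<one> \<in> D"
    then obtain s t where st: "\<one> = s \<otimes> inv t" "s \<in> P" "t \<in> P" "s \<noteq> t" unfolding D_def by blast
    show False using eq[OF st(1)[symmetric] st(2,3)] st(4) by contradiction
  qed
  ultimately obtain n where n: "n > 0" "3 dvd n" "D \<inter> cgr n = {}"
    using separating_level[OF finD] by blast
  have tp: "\<exists>t1 t2. two_panels W r w m j n t1 t2" if j: "j < r" for j
  proof -
    obtain t1 t2 where t: "t1\<in>carrier W" "t2\<in>carrier W" "t1 \<otimes> t1 = \<one>" "t2 \<otimes> t2 = \<one>"
      "panels (family j) \<subseteq> {t1, t2}" using few[OF j] by (auto simp: few_panels_def)
    have "two_panels W r w m j n t1 t2"
    proof
      fix s t assume "s \<in> panels (family j)" "t \<in> panels (family j)" "s \<otimes> inv t \<in> cgr n"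
      then show "s = t" using n(3) j by (auto simp: D_def P_def)
    qed (use t j n in auto)
    then show ?thesis by blast
  qed
  let ?Q = "W Mod cgr n"
  interpret N: normal "cgr n" W by (rule cgr_normal)
  interpret Q: group ?Q by (rule N.factorgroup_is_group)
  have finQ: "finite (carrier ?Q)" using cgr_finite_index[OF n(1)] by (simp add: FactGroup_def)
  define \<beta> where "\<beta> j = fold_action.step w ?Q (\<lambda>g. cgr n #> g) (family j) (\<lambda>_. Not)" for j
  have fa: "fold_action W r w m ?Q (\<lambda>g. cgr n #> g) (family j) (\<lambda>_. Not)" if "j < r" for j
    by (rule fold_action_quotient[OF that n(2)]) simp
  have cm: "coxeter_maps (\<beta> j)" if "j < r" for j
    unfolding \<beta>_def by (rule fold_action.coxeter_maps_step[OF fa[OF that]])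
  define s where "s = (\<one>\<^bsub>?Q\<^esub>, True)"
  have sc: "fst s \<in> carrier ?Q" unfolding s_def fst_conv by (rule Q.one_closed)
  define M where "M = {g \<in> carrier W. \<forall>j<r. lift (\<beta> j) g s = s}"
  have invM: "lift (\<beta> j) (inv g) s = s" if "g \<in> carrier W" "j < r" "lift (\<beta> j) g s = s" for g j
    using lift_inv(1)[OF cm[OF that(2)] that(1), of s] that(3) by simp
  have sub: "subgroup M W"
  proof (rule subgroupI)
    show "M \<noteq> {}" using cm by (auto simp: M_def)
  qed (auto simp: M_def cm lift_mult invM)
  have "finite (rcosets M)"
  proof (rule finite_rcosets_if_finite_invariant[OF sub])
    let ?f = "\<lambda>g. \<lambda>j\<in>{..<r}. lift (\<beta> j) (inv g) s"
    have "lift (\<beta> j) (inv g) s \<in> carrier ?Q \<times> UNIV" if "g \<in> carrier W" "j < r" for g j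
      using fold_action.fold_carrier[OF fa[OF that(2)], of "inv g" s] that sc
      by (simp add: \<beta>_def mem_Times_iff)
    then have "?f ` carrier W \<subseteq> PiE {..<r} (\<lambda>_. carrier ?Q \<times> UNIV)"
      by (intro image_subsetI, subst restrict_PiE_iff) auto
    then show "finite (?f ` carrier W)" by (rule finite_subset) (simp add: finite_PiE finQ)
  next
    fix g h assume gh: "g \<in> carrier W" "h \<in> carrier W"
      and eq: "(\<lambda>j\<in>{..<r}. lift (\<beta> j) (inv g) s) = (\<lambda>j\<in>{..<r}. lift (\<beta> j) (inv h) s)"
    have "lift (\<beta> j) (g \<otimes> inv h) s = s" if j: "j < r" for j
    proof -
      have "lift (\<beta> j) (inv g) s = lift (\<beta> j) (inv h) s" using fun_cong[OF eq, of j] j by simp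
      then show ?thesis using gh lift_inv(2)[OF cm[OF j] gh(1), of s] cm[OF j] by (simp add: lift_mult)
    qed
    then show "g \<otimes> inv h \<in> M" using gh by (simp add: M_def)
  qed
  moreover have "comm_group (W\<lparr>carrier := M\<rparr>)"
  proof (rule group.group_comm_groupI)
    show "group (W\<lparr>carrier := M\<rparr>)" using sub by (rule subgroup_imp_group)
  next
    fix g h assume "g \<in> carrier (W\<lparr>carrier := M\<rparr>)" "h \<in> carrier (W\<lparr>carrier := M\<rparr>)"
    then have gh: "g \<in> M" "h \<in> M" "g \<in> carrier W" "h \<in> carrier W" by (auto simp: M_def)
    have "g \<otimes> h \<otimes> inv (h \<otimes> g) = \<one>"
    proof (rule positive_imp_one)
      fix j assume j: "j < r"
      obtain t1 t2 where "two_panels W r w m j n t1 t2" using tp[OF j] by blast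
      then interpret T: two_panels W r w m j n t1 t2 .
      have "g \<in> T.stab" "h \<in> T.stab" using gh j by (auto simp: T.stab_def M_def \<beta>_def s_def)
      then have "g \<otimes> h \<otimes> inv (h \<otimes> g) \<in> chamber (family j)" by (rule T.stab_commutator)
      then show "nonneg (act (g \<otimes> h \<otimes> inv (h \<otimes> g)) (unit_fun j))" by (rule chamber_positive[OF j])
    qed (use gh in simp)
    then have "g \<otimes> h = h \<otimes> g"
      using gh inv_equality[of "g \<otimes> h" "inv (h \<otimes> g)"] by (simp del: inv_mult_group)
    then show "g \<otimes>\<^bsub>W\<lparr>carrier := M\<rparr>\<^esub> h = h \<otimes>\<^bsub>W\<lparr>carrier := M\<rparr>\<^esub> g" by simp
  qed
  ultimately show ?thesis using sub by (auto simp: virtually_abelian_def)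
qed

lemma many_panels:
  assumes "\<not> few_panels j"
  obtains t1 t2 t3 where "t1 \<in> panels (family j)" "t2 \<in> panels (family j)" "t3 \<in> panels (family j)"
    "t1 \<noteq> t2" "t1 \<noteq> t3" "t2 \<noteq> t3"
proof -
  let ?P = "panels (family j)"
  have nsub: "\<not> ?P \<subseteq> {t1, t2}" if "t1 \<in> ?P \<union> {\<one>}" "t2 \<in> ?P \<union> {\<one>}" for t1 t2
  proof -
    have "t1 \<in> carrier W" "t1 \<otimes> t1 = \<one>" "t2 \<in> carrier W" "t2 \<otimes> t2 = \<one>"
      using that panels_closed panels_sq by auto
    then show ?thesis using assms unfolding few_panels_def by blast
  qed
  obtain t1 where t1: "t1 \<in> ?P" using nsub[of \<one> \<one>] by blast
  obtain t2 where t2: "t2 \<in> ?P" "t2 \<noteq> t1" using nsub[of t1 t1] t1 by blast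
  obtain t3 where t3: "t3 \<in> ?P" "t3 \<noteq> t1" "t3 \<noteq> t2" using nsub[of t1 t2] t1 t2 by blast
  show ?thesis using that[OF t1 t2(1) t3(1)] t2 t3 by auto
qed

end

section \<open>Finite p-groups and their lifts\<close>

text \<open>The class equation: the class of the identity has one element, so not all other classes can have size divisible by \<open>p\<close>.\<close>

lemma (in group) p_group_center_nontrivial:
  assumes p: "prime (p::nat)" and ord: "order G = p ^ a" and a: "a > 0"
  shows "\<exists>z\<in>carrier G. z \<noteq> \<one> \<and> (\<forall>g\<in>carrier G. g \<otimes> z = z \<otimes> g)"
proof (rule ccontr)
  assume neg: "\<not> ?thesis"
  let ?\<phi> = "\<lambda>g. \<lambda>h \<in> carrier G. g \<otimes> h \<otimes> inv g"
  interpret act: group_action G "carrier G" ?\<phi> by (rule action_by_conjugation)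
  let ?O = "orbits G (carrier G) ?\<phi>"
  have pos: "order G > 0" using ord p prime_gt_0_nat by simp
  then have fin: "finite (carrier G)" by (simp add: order_gt_0_iff_finite)
  have finO: "finite ?O" using fin by (simp add: orbits_def setcompr_eq_image)
  have one: "orbit G ?\<phi> \<one> = {\<one>}" by (auto simp: orbit_def intro!: exI[of _ \<one>])
  have big: "p dvd card orb" if orb: "orb \<in> ?O - {{\<one>}}" for orb
  proof -
    obtain z where z: "z \<in> carrier G" "orb = orbit G ?\<phi> z" using orb by (auto simp: orbits_def)
    have "z \<noteq> \<one>" using orb z one by auto
    then obtain g where g: "g \<in> carrier G" "g \<otimes> z \<noteq> z \<otimes> g" using neg z by blast
    have "g \<otimes> z \<otimes> inv g \<noteq> z"
    proof
      assume "g \<otimes> z \<otimes> inv g = z"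
      then have "g \<otimes> z \<otimes> inv g \<otimes> g = z \<otimes> g" by simp
      then show False using g z(1) by (simp add: m_assoc)
    qed
    moreover have "g \<otimes> z \<otimes> inv g \<in> orb" "z \<in> orb"
      using g z act.orbit_refl[OF z(1)] by (auto simp: orbit_def)
    ultimately have "card orb \<noteq> 1" by (metis card_1_singletonE singletonD)
    moreover have "card orb dvd p ^ a"
      using act.orbit_stabilizer_theorem[OF z(1)] unfolding z(2) ord by (rule dvdI[OF HOL.sym])
    ultimately show ?thesis
      using p by (metis divides_primepow_nat dvd_power gr0I power_0)
  qed
  have "(\<Sum>orb\<in>?O. card orb) = (\<Sum>x\<in>carrier G. 1)"
    using act.disjoint_sum[OF fin, of "\<lambda>_. 1 :: nat"] unfolding card_eq_sum .
  then have "p ^ a = (\<Sum>orb\<in>?O. card orb)" using ord by (simp add: order_def)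
  also have "{\<one>} \<in> ?O" unfolding orbits_def using one by force
  then have "(\<Sum>orb\<in>?O. card orb) = 1 + (\<Sum>orb\<in>?O - {{\<one>}}. card orb)"
    using finO by (subst sum.remove[of _ "{\<one>}"]) auto
  finally have eq: "p ^ a = 1 + (\<Sum>orb\<in>?O - {{\<one>}}. card orb)" .
  have "p dvd (\<Sum>orb\<in>?O - {{\<one>}}. card orb)" by (rule dvd_sum) (rule big)
  moreover have "p dvd 1 + (\<Sum>orb\<in>?O - {{\<one>}}. card orb)" unfolding eq[symmetric] using a by simp
  ultimately have "p dvd 1" using dvd_add_left_iff by blast
  then show False using p not_prime_unit by blast
qed

lemma (in group) twisted_commute_pow:
  assumes cl: "x \<in> carrier G" "y \<in> carrier G" "z \<in> carrier G"
    and tw: "x \<otimes> y = z \<otimes> y \<otimes> x" and zx: "z \<otimes> x = x \<otimes> z" and zy: "z \<otimes> y = y \<otimes> z"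
  shows "x [^] (j::nat) \<otimes> y [^] (i::nat) = z [^] (i * j) \<otimes> y [^] i \<otimes> x [^] j"
proof -
  have 1: "x \<otimes> y [^] i = z [^] i \<otimes> y [^] i \<otimes> x" for i :: nat
  proof (induction i)
    case (Suc i)
    have "x \<otimes> y [^] Suc i = (x \<otimes> y [^] i) \<otimes> y" using cl by (simp add: m_assoc)
    also have "\<dots> = z [^] i \<otimes> y [^] i \<otimes> (x \<otimes> y)" using cl by (simp add: Suc.IH m_assoc)
    also have "\<dots> = z [^] i \<otimes> (y [^] i \<otimes> z) \<otimes> (y \<otimes> x)" using cl by (simp add: tw m_assoc)
    also have "y [^] i \<otimes> z = z \<otimes> y [^] i" by (rule group_commutes_pow[OF zy[symmetric] cl(2,3)])
    finally show ?case using cl by (simp add: m_assoc)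
  qed (use cl in simp)
  have zxp: "z [^] i \<otimes> x = x \<otimes> z [^] i" for i :: nat
    by (rule group_commutes_pow[OF zx cl(3,1)])
  show ?thesis
  proof (induction j)
    case (Suc j)
    have "x [^] Suc j \<otimes> y [^] i = x \<otimes> (x [^] j \<otimes> y [^] i)"
      unfolding nat_pow_Suc2[OF cl(1)] using cl by (simp add: m_assoc)
    also have "\<dots> = (x \<otimes> z [^] (i * j)) \<otimes> y [^] i \<otimes> x [^] j" using cl by (simp add: Suc.IH m_assoc)
    also have "\<dots> = z [^] (i * j) \<otimes> (x \<otimes> y [^] i) \<otimes> x [^] j" using cl by (simp add: zxp[symmetric] m_assoc)
    also have "\<dots> = z [^] (i * j) \<otimes> z [^] i \<otimes> y [^] i \<otimes> (x \<otimes> x [^] j)"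
      using cl by (simp add: 1 m_assoc)
    also have "x \<otimes> x [^] j = x [^] Suc j" using cl by (metis nat_pow_Suc2)
    also have "z [^] (i * j) \<otimes> z [^] i = z [^] (i * Suc j)" using cl by (simp add: nat_pow_mult add.commute)
    finally show ?case .
  qed (use cl in simp)
qed

text \<open>Choose \<open>x\<close> central modulo the centre but not central. Its commutators are then central, and replacing \<open>x\<close> by
\<open>x^(p^f)\<close> raises them to the power \<open>p^f\<close>, which brings the order down to \<open>p\<close>.\<close>

lemma (in group) nonabelian_p_group_commutator:
  assumes p: "prime (p::nat)" and ord: "order G = p ^ a"
    and nonab: "u \<in> carrier G" "v \<in> carrier G" "u \<otimes> v \<noteq> v \<otimes> u"
  obtains x y z where "x \<in> carrier G" "y \<in> carrier G" "z \<in> carrier G" "x \<otimes> y = z \<otimes> y \<otimes> x"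
    "z \<otimes> x = x \<otimes> z" "z \<otimes> y = y \<otimes> z" "z [^] p = \<one>" "z \<noteq> \<one>"
proof -
  define Z where "Z = {z \<in> carrier G. \<forall>g\<in>carrier G. g \<otimes> z = z \<otimes> g}"
  have ZD: "z \<in> carrier G" if "z \<in> Z" for z using that unfolding Z_def by blast
  have ZC: "g \<otimes> z = z \<otimes> g" if "z \<in> Z" "g \<in> carrier G" for g z using that unfolding Z_def by blast
  have ZI: "z \<in> Z" if "z \<in> carrier G" "\<And>g. g \<in> carrier G \<Longrightarrow> g \<otimes> z = z \<otimes> g" for z
    using that unfolding Z_def by blast
  have sub: "subgroup Z G"
  proof (rule subgroupI)
    fix z assume z: "z \<in> Z"
    have "g \<otimes> inv z = inv z \<otimes> g" if "g \<in> carrier G" for g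
    proof -
      have "g \<otimes> z = z \<otimes> g" "z \<in> carrier G" using ZC[OF z that] ZD[OF z] by blast+
      then have "inv z \<otimes> (z \<otimes> g) \<otimes> inv z = inv z \<otimes> (g \<otimes> z) \<otimes> inv z" by simp
      moreover have "inv z \<otimes> (z \<otimes> g) = g" using that \<open>z \<in> carrier G\<close> by (simp flip: m_assoc)
      moreover have "inv z \<otimes> (g \<otimes> z) \<otimes> inv z = inv z \<otimes> g"
        using that \<open>z \<in> carrier G\<close> by (simp add: m_assoc)
      ultimately show ?thesis by simp
    qed
    then show "inv z \<in> Z" by (rule ZI[OF inv_closed[OF ZD[OF z]]])
  next
    fix y z assume yz: "y \<in> Z" "z \<in> Z"
    have "g \<otimes> (y \<otimes> z) = y \<otimes> z \<otimes> g" if "g \<in> carrier G" for g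
    proof -
      have c: "g \<otimes> y = y \<otimes> g" "g \<otimes> z = z \<otimes> g" "y \<in> carrier G" "z \<in> carrier G"
        using ZC[OF _ that] ZD yz by blast+
      have "g \<otimes> (y \<otimes> z) = (g \<otimes> y) \<otimes> z" using c(3,4) that by (simp add: m_assoc)
      also have "\<dots> = y \<otimes> (g \<otimes> z)" unfolding c(1) using c(3,4) that by (simp add: m_assoc)
      also have "\<dots> = y \<otimes> z \<otimes> g" unfolding c(2) using c(3,4) that by (simp add: m_assoc)
      finally show ?thesis .
    qed
    then show "y \<otimes> z \<in> Z" by (rule ZI[OF m_closed[OF ZD[OF yz(1)] ZD[OF yz(2)]]])
  next
    show "Z \<subseteq> carrier G" unfolding Z_def by blast
    have "\<one> \<in> Z" by (rule ZI) simp_all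
    then show "Z \<noteq> {}" by blast
  qed
  have "x \<otimes> z \<otimes> inv x \<in> Z" if "x \<in> carrier G" "z \<in> Z" for x z
  proof -
    have "x \<otimes> z \<otimes> inv x = z" unfolding ZC[OF that(2,1)] using ZD[OF that(2)] that(1) by (simp add: m_assoc)
    then show ?thesis using that by simp
  qed
  then have nrm: "Z \<lhd> G" using sub by (simp add: normal_inv_iff)
  then interpret Z: normal Z G .
  interpret Q: group "G Mod Z" by (rule Z.factorgroup_is_group)
  have "card (rcosets Z) * card Z = p ^ a" using lagrange[OF sub] ord by simp
  then have "order (G Mod Z) dvd p ^ a" unfolding order_def FactGroup_def by (simp add: dvdI[OF HOL.sym])
  then obtain b where b: "order (G Mod Z) = p ^ b" using p divides_primepow_nat by blast
  have cos: "g \<in> Z" if "g \<in> carrier G" "Z #> g = Z" for g using that rcos_self[OF that(1) sub] by simp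
  have "b > 0"
  proof (rule ccontr)
    assume "\<not> b > 0"
    then have "card (carrier (G Mod Z)) = 1" using b by (simp add: order_def)
    then obtain C where C: "carrier (G Mod Z) = {C}" by (rule card_1_singletonE)
    have "Z #> u \<in> carrier (G Mod Z)" "Z \<in> carrier (G Mod Z)"
      using nonab Q.one_closed by (auto simp: FactGroup_def RCOSETS_def)
    then have "Z #> u = Z" using C by simp
    then have "u \<in> Z" using cos nonab by simp
    then show False using ZC nonab by metis
  qed
  then obtain C where C: "C \<in> carrier (G Mod Z)" "C \<noteq> \<one>\<^bsub>G Mod Z\<^esub>"
    "\<And>D. D \<in> carrier (G Mod Z) \<Longrightarrow> D \<otimes>\<^bsub>G Mod Z\<^esub> C = C \<otimes>\<^bsub>G Mod Z\<^esub> D"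
    using Q.p_group_center_nontrivial[OF p b] by blast
  obtain x0 where x0: "x0 \<in> carrier G" "C = Z #> x0" using C(1) by (auto simp: FactGroup_def RCOSETS_def)
  have "x0 \<notin> Z" using C(2) x0 coset_join2[OF x0(1) sub] by auto
  then obtain y where y: "y \<in> carrier G" "y \<otimes> x0 \<noteq> x0 \<otimes> y" using x0(1) ZI by blast
  define z0 where "z0 = x0 \<otimes> y \<otimes> inv (y \<otimes> x0)"
  have z0c: "z0 \<in> carrier G" using x0 y by (simp add: z0_def)
  have z0xy: "x0 \<otimes> y = z0 \<otimes> y \<otimes> x0" using x0 y by (simp add: z0_def m_assoc del: inv_mult_group)
  have "z0 \<noteq> \<one>" using z0xy y x0 by auto
  have "(Z #> y) \<otimes>\<^bsub>G Mod Z\<^esub> C = C \<otimes>\<^bsub>G Mod Z\<^esub> (Z #> y)"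
    by (rule C(3)) (use y in \<open>auto simp: FactGroup_def RCOSETS_def\<close>)
  then have "Z #> (y \<otimes> x0) = Z #> (x0 \<otimes> y)" using x0 y by (simp add: FactGroup_def Z.rcos_sum)
  then have "x0 \<otimes> y \<in> Z #> (y \<otimes> x0)" using rcos_self[OF _ sub, of "x0 \<otimes> y"] x0 y by simp
  then obtain k where "k \<in> Z" "x0 \<otimes> y = k \<otimes> (y \<otimes> x0)" by (auto simp: r_coset_def)
  then have k: "k \<in> Z" "k \<in> carrier G" "x0 \<otimes> y = k \<otimes> (y \<otimes> x0)" using ZD by auto
  have "z0 = k" unfolding z0_def k(3) using k(2) x0 y by (simp add: m_assoc del: inv_mult_group)
  then have z0Z: "z0 \<in> Z" using k(1) by simp
  have "z0 [^] (p ^ a) = \<one>" using pow_order_eq_1[OF z0c] ord by simp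
  \<comment> \<open>The order of \<open>z\<^sub>0\<close> is \<open>p^e\<close>, so its power \<open>p^(e - 1)\<close> has order \<open>p\<close>.\<close>
  define e where "e = (LEAST e. z0 [^] (p ^ e) = \<one>)"
  have e: "z0 [^] (p ^ e) = \<one>" unfolding e_def by (rule LeastI) fact
  have "e \<noteq> 0" using e \<open>z0 \<noteq> \<one>\<close> z0c by (auto intro!: gr0I)
  then obtain f where f: "e = Suc f" by (cases e) auto
  define q where "q = p ^ f"
  have ne: "z0 [^] q \<noteq> \<one>" using not_less_Least[of f "\<lambda>e. z0 [^] (p ^ e) = \<one>"] f by (simp add: e_def q_def)
  have zp: "(z0 [^] q) [^] p = \<one>" using e f z0c by (simp add: q_def nat_pow_pow mult.commute)
  have comm: "z0 \<otimes> g = g \<otimes> z0" if "g \<in> carrier G" for g by (rule ZC[OF z0Z that, symmetric])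
  have commq: "z0 [^] q \<otimes> g = g \<otimes> z0 [^] q" if "g \<in> carrier G" for g
    by (rule group_commutes_pow[OF comm[OF that] z0c that])
  have "x0 [^] q \<otimes> y [^] (1::nat) = z0 [^] (1 * q) \<otimes> y [^] (1::nat) \<otimes> x0 [^] q"
    by (rule twisted_commute_pow) (use x0 y z0c z0xy comm in auto)
  then have "x0 [^] q \<otimes> y = z0 [^] q \<otimes> y \<otimes> x0 [^] q" using y by simp
  then show ?thesis
    by (intro that[of "x0 [^] q" y "z0 [^] q"]) (use x0 y z0c commq zp ne in auto)
qed

lemma (in group_hom) card_subgroup_image:
  assumes K: "subgroup K G" "finite K"
  shows "card K = card {x \<in> K. h x = \<one>\<^bsub>H\<^esub>} * card (h ` K)"
proof -
  have Kc: "x \<in> carrier G" if "x \<in> K" for x by (rule subgroup.mem_carrier[OF K(1) that])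
  have fib: "card {x \<in> K. h x = y} = card {x \<in> K. h x = \<one>\<^bsub>H\<^esub>}" if yK: "y \<in> h ` K" for y
  proof -
    obtain k where k: "k \<in> K" "y = h k" using yK by blast
    have "bij_betw (\<lambda>x. x \<otimes> k) {x \<in> K. h x = \<one>\<^bsub>H\<^esub>} {x \<in> K. h x = y}"
    proof (rule bij_betw_byWitness[where f' = "\<lambda>x. x \<otimes> inv k"])
      show "(\<lambda>x. x \<otimes> k) ` {x \<in> K. h x = \<one>\<^bsub>H\<^esub>} \<subseteq> {x \<in> K. h x = y}"
        using k(1) unfolding k(2) by (auto intro: subgroup.m_closed[OF K(1)] simp: Kc)
      show "(\<lambda>x. x \<otimes> inv k) ` {x \<in> K. h x = y} \<subseteq> {x \<in> K. h x = \<one>\<^bsub>H\<^esub>}"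
        using k(1) unfolding k(2)
        by (auto intro: subgroup.m_closed[OF K(1)] subgroup.m_inv_closed[OF K(1)] simp: Kc)
    qed (use k(1) Kc in \<open>auto simp: G.m_assoc\<close>)
    then show ?thesis by (simp add: bij_betw_same_card)
  qed
  have "card K = (\<Sum>y\<in>h ` K. card {x \<in> K. h x = y})"
    using sum.image_gen[OF K(2), of "\<lambda>_. 1::nat" h] by simp
  also have "\<dots> = (\<Sum>y\<in>h ` K. card {x \<in> K. h x = \<one>\<^bsub>H\<^esub>})" by (rule sum.cong) (use fib in auto)
  finally show ?thesis by simp
qed

text \<open>Compare the powers of \<open>p\<close> in the orders of the group, of the kernel, and of their intersections with a Sylow subgroup.\<close>

lemma (in group_hom) sylow_maps_onto_p_group:
  assumes p: "prime (p::nat)" and fin: "finite (carrier G)"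
    and onto: "h ` carrier G = carrier H" and ordH: "order H = p ^ b"
  obtains S a where "subgroup S G" "card S = p ^ a" "h ` S = carrier H"
proof -
  have "order G > 0" using fin by (simp add: G.order_gt_0_iff_finite)
  then obtain a n where n: "\<not> p dvd n" "order G = n * p ^ a"
    using prime_power_canonical[OF p] by blast
  then obtain S where S: "subgroup S G" "card S = p ^ a"
    using sylow_thm[OF p G.is_group, of a n] fin by (auto simp: mult.commute)
  have finS: "finite S" using S fin by (meson finite_subset subgroup.subset)
  define Kr where "Kr = {x \<in> carrier G. h x = \<one>\<^bsub>H\<^esub>}"
  define L where "L = {x \<in> S. h x = \<one>\<^bsub>H\<^esub>}"
  have Kr: "n * p ^ a = card Kr * p ^ b"
    using card_subgroup_image[OF G.subgroup_self fin] n onto ordH by (simp add: Kr_def order_def)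
  have cS: "p ^ a = card L * card (h ` S)"
    using card_subgroup_image[OF S(1) finS] S(2) by (simp add: L_def)
  have "subgroup Kr G" using subgroup_kernel by (simp add: Kr_def kernel_def)
  then have sL: "subgroup (S \<inter> Kr) G" using S(1) by (simp add: G.subgroups_Inter_pair)
  have "S \<inter> Kr = L" using S(1) subgroup.subset by (auto simp: L_def Kr_def)
  then have "subgroup L (G\<lparr>carrier := Kr\<rparr>)"
    using sL G.subgroup_incl[OF sL \<open>subgroup Kr G\<close>] by auto
  then have "card (rcosets\<^bsub>G\<lparr>carrier := Kr\<rparr>\<^esub> L) * card L = card Kr"
    using group.lagrange[OF G.subgroup_imp_group[OF \<open>subgroup Kr G\<close>]] by (simp add: order_def)
  then have Ldvd: "card L dvd card Kr" by (metis dvd_triv_right)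
  have "card L dvd p ^ a" using cS by simp
  then obtain c where c: "c \<le> a" "card L = p ^ c" using p divides_primepow_nat by blast
  have "p ^ (c + b) dvd n * p ^ a"
    using Ldvd c Kr by (simp add: power_add mult_dvd_mono)
  moreover have "coprime (p ^ (c + b)) n" using n(1) p by (simp add: prime_imp_coprime coprime_power_left_iff)
  ultimately have "p ^ (c + b) dvd p ^ a" by (simp add: coprime_dvd_mult_right_iff)
  then have "p ^ (c + b) \<le> p ^ c * card (h ` S)"
    using cS c p by (metis dvd_imp_le prime_gt_0_nat zero_less_power)
  then have "card (carrier H) \<le> card (h ` S)"
    using ordH p prime_gt_0_nat[OF p] by (simp add: power_add order_def)
  moreover have "h ` S \<subseteq> carrier H" using S(1) subgroup.subset by (metis image_mono onto)
  moreover have "finite (carrier H)" using fin onto by (metis finite_imageI)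
  ultimately have "h ` S = carrier H" by (metis card_seteq)
  then show ?thesis using that S by blast
qed

text \<open>The relation \<open>R\<close> is a correspondence between \<open>G\<close> and the \<open>p\<close>-group \<open>P\<close>, for instance ``\<open>g\<close> acts on a given
set as \<open>s\<close>''. Its image in \<open>(G Mod H) \<times> P\<close> is finite and maps onto \<open>P\<close>, so a Sylow subgroup of it does too,
and the projection of that Sylow subgroup to \<open>G Mod H\<close> is abelian.\<close>

lemma (in normal) commuting_p_lifts:
  assumes fin: "finite (rcosets H)" and p: "prime (p::nat)"
    and abelian: "\<And>S a x y. subgroup S (G Mod H) \<Longrightarrow> card S = p ^ a \<Longrightarrow> x \<in> S \<Longrightarrow> y \<in> S \<Longrightarrow>
      x \<otimes>\<^bsub>G Mod H\<^esub> y = y \<otimes>\<^bsub>G Mod H\<^esub> x"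
    and P: "group P" "order P = p ^ b"
    and R: "subgroup R (G \<times>\<times> P)" and onto: "\<And>s. s \<in> carrier P \<Longrightarrow> \<exists>g. (g, s) \<in> R"
    and uv: "u \<in> carrier P" "v \<in> carrier P"
  obtains x y where "(x, u) \<in> R" "(y, v) \<in> R" "x \<otimes> y \<otimes> inv (y \<otimes> x) \<in> H"
proof -
  interpret P: group P by fact
  interpret Q: group "G Mod H" by (rule factorgroup_is_group)
  interpret QP: group "(G Mod H) \<times>\<times> P" by (rule DirProd_group) unfold_locales
  define K where "K = (\<lambda>(g, s). (H #> g, s)) ` R"
  have RD: "g \<in> carrier G" "s \<in> carrier P" if "(g, s) \<in> R" for g s
    using that subgroup.subset[OF R] by (auto simp: DirProd_def)
  interpret GP: group "G \<times>\<times> P" by (rule DirProd_group) unfold_locales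
  have "group_hom (G \<times>\<times> P) ((G Mod H) \<times>\<times> P) (\<lambda>(g, s). (H #> g, s))"
    using r_coset_hom_Mod
    by (auto simp: group_hom_def group_hom_axioms_def GP.is_group QP.is_group hom_def Pi_def)
  then have K: "subgroup K ((G Mod H) \<times>\<times> P)"
    unfolding K_def by (rule group_hom.subgroup_img_is_subgroup[OF _ R])
  let ?K = "((G Mod H) \<times>\<times> P)\<lparr>carrier := K\<rparr>"
  interpret K: group ?K by (rule QP.subgroup_imp_group[OF K])
  have finP: "finite (carrier P)" using P p prime_gt_0_nat by (simp flip: P.order_gt_0_iff_finite)
  have finQ: "finite (carrier (G Mod H))" using fin by (simp add: FactGroup_def)
  have Kc: "K \<subseteq> carrier (G Mod H) \<times> carrier P" using subgroup.subset[OF K] by (simp add: DirProd_def)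
  have finK: "finite K" using Kc finP finQ by (meson finite_SigmaI finite_subset)
  interpret snd: group_hom ?K P snd
    by unfold_locales (use Kc in \<open>auto simp: hom_def DirProd_def\<close>)
  have onto': "snd ` carrier ?K = carrier P"
  proof
    show "carrier P \<subseteq> snd ` carrier ?K"
    proof
      fix s assume "s \<in> carrier P"
      then obtain g where "(g, s) \<in> R" using onto by blast
      then have "(H #> g, s) \<in> K" unfolding K_def by (rule image_eqI[rotated]) simp
      then show "s \<in> snd ` carrier ?K" by force
    qed
  qed (use Kc in auto)
  obtain S a where S: "subgroup S ?K" "card S = p ^ a" "snd ` S = carrier P"
    by (rule snd.sylow_maps_onto_p_group[OF p _ onto' P(2)]) (use finK in simp)
  have SK: "S \<subseteq> K" using subgroup.subset[OF S(1)] by simp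
  interpret fst: group_hom ?K "G Mod H" fst
    by unfold_locales (use Kc in \<open>auto simp: hom_def DirProd_def\<close>)
  have "subgroup (fst ` S) (G Mod H)" by (rule fst.subgroup_img_is_subgroup[OF S(1)])
  moreover have "card (fst ` S) dvd p ^ a"
    using fst.card_subgroup_image[OF S(1) finite_subset[OF SK finK]] unfolding S(2)
    by (rule dvdI[OF HOL.trans[OF _ mult.commute]])
  ultimately have ab: "x \<otimes>\<^bsub>G Mod H\<^esub> y = y \<otimes>\<^bsub>G Mod H\<^esub> x" if "x \<in> fst ` S" "y \<in> fst ` S" for x y
    using abelian p divides_primepow_nat that by metis
  obtain X where X: "(X, u) \<in> S" using S(3) uv by (metis imageE prod.collapse)
  obtain Y where Y: "(Y, v) \<in> S" using S(3) uv by (metis imageE prod.collapse)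
  obtain x where x: "(x, u) \<in> R" "X = H #> x" using X SK by (auto simp: K_def)
  obtain y where y: "(y, v) \<in> R" "Y = H #> y" using Y SK by (auto simp: K_def)
  have cl: "x \<in> carrier G" "y \<in> carrier G" using x y RD by auto
  have "X \<otimes>\<^bsub>G Mod H\<^esub> Y = Y \<otimes>\<^bsub>G Mod H\<^esub> X" using ab X Y by force
  then have "H #> (x \<otimes> y) = H #> (y \<otimes> x)" using x y cl by (simp add: FactGroup_def rcos_sum)
  then have "x \<otimes> y \<in> H #> (y \<otimes> x)" using rcos_self[OF _ is_subgroup, of "x \<otimes> y"] cl by simp
  then obtain k where k: "k \<in> H" "x \<otimes> y = k \<otimes> (y \<otimes> x)" by (auto simp: r_coset_def)
  then have "x \<otimes> y \<otimes> inv (y \<otimes> x) = k" using cl mem_carrier by (simp add: m_assoc del: inv_mult_group)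
  then show ?thesis using that x y k by simp
qed

section \<open>Abelian p-subgroups of congruence quotients\<close>

text \<open>Fraction-free Gaussian elimination of one equation at a time.\<close>

lemma integer_dependency:
  fixes M :: "'i \<Rightarrow> 'j \<Rightarrow> int"
  assumes "finite J" "finite I" "card J < card I"
  shows "\<exists>c. (\<exists>i\<in>I. c i \<noteq> 0) \<and> (\<forall>j\<in>J. (\<Sum>i\<in>I. c i * M i j) = 0)"
  using assms
proof (induction J arbitrary: I M rule: finite_induct)
  case empty
  then obtain i where "i \<in> I" by (metis card.empty equals0I less_irrefl)
  then show ?case by (intro exI[of _ "\<lambda>_. 1"]) auto
next
  case (insert j J)
  show ?case
  proof (cases "\<forall>i\<in>I. M i j = 0")
    case True
    have "card J < card I" using insert by simp
    then obtain c where "\<exists>i\<in>I. c i \<noteq> 0" "\<forall>j\<in>J. (\<Sum>i\<in>I. c i * M i j) = 0"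
      using insert.IH[OF insert.prems(1)] by blast
    then show ?thesis using True by (intro exI[of _ c]) simp
  next
    case False
    then obtain i0 where i0: "i0 \<in> I" "M i0 j \<noteq> 0" by blast
    let ?I = "I - {i0}"
    have "card J < card ?I" using insert i0 by simp
    then obtain c where c: "\<exists>i\<in>?I. c i \<noteq> 0"
      "\<And>k. k \<in> J \<Longrightarrow> (\<Sum>i\<in>?I. c i * (M i0 j * M i k - M i j * M i0 k)) = 0"
      using insert.IH[of ?I "\<lambda>i k. M i0 j * M i k - M i j * M i0 k"] insert.prems by auto
    define s where "s = (\<Sum>i\<in>?I. c i * M i j)"
    \<comment> \<open>The coefficient of the pivot \<open>i\<^sub>0\<close> is chosen to solve equation \<open>j\<close>.\<close>
    define c' where "c' = (\<lambda>i. if i = i0 then - s else c i * M i0 j)"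
    have split: "(\<Sum>i\<in>I. c' i * M i k) = (\<Sum>i\<in>?I. c i * M i0 j * M i k) - s * M i0 k" for k
    proof -
      have "(\<Sum>i\<in>I. c' i * M i k) = c' i0 * M i0 k + (\<Sum>i\<in>?I. c' i * M i k)"
        using i0 insert.prems by (simp add: sum.remove)
      also have "(\<Sum>i\<in>?I. c' i * M i k) = (\<Sum>i\<in>?I. c i * M i0 j * M i k)"
        by (rule sum.cong) (auto simp: c'_def)
      finally show ?thesis by (simp add: c'_def)
    qed
    have "(\<Sum>i\<in>I. c' i * M i k) = 0" if "k \<in> insert j J" for k
    proof (cases "k = j")
      case True
      then show ?thesis by (simp add: split s_def sum_distrib_left sum_distrib_right mult_ac)
    next
      case False
      then have "k \<in> J" using that by simp
      have "(\<Sum>i\<in>?I. c i * M i0 j * M i k) - s * M i0 k =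
          (\<Sum>i\<in>?I. c i * (M i0 j * M i k - M i j * M i0 k))"
        by (simp add: s_def sum_distrib_left sum_distrib_right sum_subtractf algebra_simps)
      then show ?thesis using c(2)[OF \<open>k \<in> J\<close>] by (simp add: split)
    qed
    moreover have "\<exists>i\<in>I. c' i \<noteq> 0" using c(1) i0 by (auto simp: c'_def)
    ultimately show ?thesis by blast
  qed
qed

lemma primitive_integer_dependency:
  fixes M :: "'i \<Rightarrow> 'j \<Rightarrow> int"
  assumes "finite J" "finite I" "card J < card I"
  shows "\<exists>c. Gcd (c ` I) = 1 \<and> (\<forall>j\<in>J. (\<Sum>i\<in>I. c i * M i j) = 0)"
proof -
  obtain c where c: "\<exists>i\<in>I. c i \<noteq> 0" "\<forall>j\<in>J. (\<Sum>i\<in>I. c i * M i j) = 0"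
    using integer_dependency[OF assms] by blast
  define g where "g = Gcd (c ` I)"
  have g0: "g \<noteq> 0" using c(1) by (auto simp: g_def Gcd_0_iff)
  define c' where "c' = (\<lambda>i. c i div g)"
  have c': "c i = g * c' i" if "i \<in> I" for i
    using that by (simp add: c'_def g_def Gcd_dvd)
  have "c ` I = (*) g ` c' ` I" using c' by (auto simp: image_image)
  then have "Gcd (c ` I) = normalize (g * Gcd (c' ` I))" by (simp only: Gcd_mult)
  then have "g = normalize (g * Gcd (c' ` I))" by (simp only: g_def[symmetric])
  moreover have "0 \<le> g" by (simp add: g_def)
  ultimately have "g = g * Gcd (c' ` I)" by (simp add: abs_mult)
  then have "Gcd (c' ` I) = 1" using g0 by simp
  moreover have "(\<Sum>i\<in>I. c' i * M i j) = 0" if "j \<in> J" for j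
  proof -
    have "g * (\<Sum>i\<in>I. c' i * M i j) = (\<Sum>i\<in>I. c i * M i j)"
      by (simp add: sum_distrib_left c' mult.assoc cong: sum.cong)
    then show ?thesis using c(2) that g0 by simp
  qed
  ultimately show ?thesis by blast
qed

context small_coxeter
begin

text \<open>Congruence of lattice vectors; the coordinates from \<open>r\<close> on are fixed by the action.\<close>

definition eqmod :: "nat \<Rightarrow> (nat \<Rightarrow> int) \<Rightarrow> (nat \<Rightarrow> int) \<Rightarrow> bool" where
  "eqmod n u v \<longleftrightarrow> (\<forall>k<r. [u k = v k] (mod int n))"

lemma eqmod_refl [simp]: "eqmod n u u"
  by (simp add: eqmod_def)

lemma eqmod_sym: "eqmod n u v \<Longrightarrow> eqmod n v u"
  by (simp add: eqmod_def cong_sym)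

lemma eqmod_trans [trans]: "eqmod n u v \<Longrightarrow> eqmod n v t \<Longrightarrow> eqmod n u t"
  unfolding eqmod_def using cong_trans by blast

lemma eqmod_sum:
  assumes "\<And>i. i \<in> I \<Longrightarrow> eqmod n (u i) (v i)"
  shows "eqmod n (\<lambda>k. \<Sum>i\<in>I. c i * u i k) (\<lambda>k. \<Sum>i\<in>I. c i * v i k)"
  using assms unfolding eqmod_def by (auto intro!: cong_sum cong_scalar_left)

lemma eqmod_act:
  assumes "g \<in> carrier W" "eqmod n u v"
  shows "eqmod n (act g u) (act g v)"
  using assms unfolding eqmod_def
  by (auto simp: act_expand[OF assms(1)] intro!: cong_sum cong_scalar_left)

lemma eqmod_coset:
  assumes "g \<in> carrier W" "h \<in> carrier W" "cgr n #> g = cgr n #> h"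
  shows "eqmod n (act g v) (act h v)"
proof -
  have "g \<in> cgr n #> h" using rcos_self[OF assms(1) cgr_subgroup] assms(3) by metis
  then obtain k where k: "k \<in> cgr n" "g = k \<otimes> h" by (auto simp: r_coset_def)
  then have "act g v = act k (act h v)" using assms(2) cgrD(1) by (simp add: lift_mult)
  then show ?thesis using cgrD(2)[OF k(1)] by (simp add: eqmod_def cong_iff_dvd_diff)
qed

lemma act_above:
  assumes "g \<in> carrier W" "\<not> k < r"
  shows "act g v k = v k"
  using assms(1)
proof (induction rule: word_induct)
  case (mult i h)
  have "rfl i u k = u k" for u using assms(2) mult by (simp add: rfl_def)
  then show ?case using mult by (simp add: lift_mult)
qed simp

text \<open>The powers of \<open>y\<close> are \<open>r\<^sup>2 + 1\<close> elements of the lattice of \<open>r\<times>r\<close> matrices. A primitive dependency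
stays nontrivial modulo every number.\<close>

lemma powers_dependent:
  assumes y: "y \<in> carrier W"
  obtains c :: "nat \<Rightarrow> int" where "Gcd (c ` {..r * r}) = 1"
    "\<And>v k. k < r \<Longrightarrow> (\<Sum>i\<le>r * r. c i * act (y [^] i) v k) = 0"
proof -
  obtain c :: "nat \<Rightarrow> int" where c: "Gcd (c ` {..r * r}) = 1"
    "\<And>a b. a < r \<Longrightarrow> b < r \<Longrightarrow> (\<Sum>i\<le>r * r. c i * act (y [^] i) (unit_fun b) a) = 0"
    using primitive_integer_dependency[of "{..<r} \<times> {..<r}" "{..r * r}"
        "\<lambda>i (a, b). act (y [^] i) (unit_fun b) a"] by auto
  have "(\<Sum>i\<le>r * r. c i * act (y [^] i) v k) = 0" if k: "k < r" for v k
  proof -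
    have "(\<Sum>i\<le>r * r. c i * act (y [^] i) v k) =
        (\<Sum>i\<le>r * r. \<Sum>j<r. c i * act (y [^] i) (unit_fun j) k * v j)"
      using y k by (simp add: act_expand[of _ k v] sum_distrib_left mult.assoc)
    also have "\<dots> = (\<Sum>j<r. (\<Sum>i\<le>r * r. c i * act (y [^] i) (unit_fun j) k) * v j)"
      by (subst sum.swap) (simp add: sum_distrib_right)
    finally show ?thesis using c(2)[OF k] by simp
  qed
  then show ?thesis using that c(1) by blast
qed

text \<open>Modulo \<open>W[n]\<close>, conjugating \<open>\<Sum> c\<^sub>i y\<^sup>i = 0\<close> by \<open>x\<^sup>j\<close> gives \<open>\<Sum> c\<^sub>i z^(i j) y\<^sup>i = 0\<close> for every \<open>j\<close>. Multiply by \<open>z^(- i\<^sub>0 j)\<close>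
and sum over \<open>j < l\<close>. The term \<open>i\<^sub>0\<close> becomes \<open>l c\<^sub>i\<^sub>0 y^(i\<^sub>0)\<close>, while in the others the powers of \<open>z\<close> run
over all of \<open>\<langle>z\<rangle>\<close>, because \<open>\<bar>i - i\<^sub>0\<bar> \<le> r\<^sup>2 < l\<close>; multiplication by \<open>z - 1\<close> kills them.
So \<open>l c\<^sub>i\<^sub>0 (z - 1) = 0\<close> for every \<open>i\<^sub>0\<close>, and \<open>z = 1\<close> since \<open>l\<close> is a unit and the \<open>c\<^sub>i\<close> are coprime.\<close>

lemma twisted_commutator_in_cgr:
  assumes l: "prime (l::nat)" "r * r < l" "coprime l n"
    and cl: "x \<in> carrier W" "y \<in> carrier W" "z \<in> carrier W"
    and xy: "cgr n #> (x \<otimes> y) = cgr n #> (z \<otimes> y \<otimes> x)"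
    and zx: "cgr n #> (z \<otimes> x) = cgr n #> (x \<otimes> z)"
    and zy: "cgr n #> (z \<otimes> y) = cgr n #> (y \<otimes> z)"
    and zl: "cgr n #> (z [^] l) = cgr n"
  shows "z \<in> cgr n"
proof -
  interpret N: normal "cgr n" W by (rule cgr_normal)
  let ?Q = "W Mod cgr n"
  interpret Q: group ?Q by (rule N.factorgroup_is_group)
  interpret q: group_hom W ?Q "\<lambda>g. cgr n #> g"
    by unfold_locales (rule N.r_coset_hom_Mod)
  define X Y Z where "X = cgr n #> x" and "Y = cgr n #> y" and "Z = cgr n #> z"
  have Qcl: "X \<in> carrier ?Q" "Y \<in> carrier ?Q" "Z \<in> carrier ?Q"
    using cl q.hom_closed by (auto simp: X_def Y_def Z_def)
  have pow: "cgr n #> (g [^] (i::nat)) = (cgr n #> g) [^]\<^bsub>?Q\<^esub> i" if "g \<in> carrier W" for g i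
    using q.hom_nat_pow[OF that] .
  have rel: "X \<otimes>\<^bsub>?Q\<^esub> Y = Z \<otimes>\<^bsub>?Q\<^esub> Y \<otimes>\<^bsub>?Q\<^esub> X" using xy cl by (simp add: X_def Y_def Z_def)
  have rel': "Z \<otimes>\<^bsub>?Q\<^esub> X = X \<otimes>\<^bsub>?Q\<^esub> Z" "Z \<otimes>\<^bsub>?Q\<^esub> Y = Y \<otimes>\<^bsub>?Q\<^esub> Z"
    using zx zy cl by (simp_all add: X_def Y_def Z_def)
  have Zl: "Z [^]\<^bsub>?Q\<^esub> l = \<one>\<^bsub>?Q\<^esub>" using zl pow[OF cl(3), of l] by (simp add: Z_def)
  have zmod: "cgr n #> (z [^] a) = cgr n #> (z [^] (a mod l))" for a :: nat
  proof -
    have "Z [^]\<^bsub>?Q\<^esub> a = Z [^]\<^bsub>?Q\<^esub> (l * (a div l) + a mod l)" by simp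
    also have "\<dots> = Z [^]\<^bsub>?Q\<^esub> (a mod l)"
      unfolding Q.nat_pow_mult[OF Qcl(3), symmetric] Q.nat_pow_pow[OF Qcl(3), symmetric] Zl
      by (simp only: Q.nat_pow_one Q.l_one Q.nat_pow_closed Qcl)
    finally show ?thesis using cl by (simp add: pow Z_def)
  qed
  obtain c :: "nat \<Rightarrow> int" where c: "Gcd (c ` {..r * r}) = 1"
    "\<And>v k. k < r \<Longrightarrow> (\<Sum>i\<le>r * r. c i * act (y [^] i) v k) = 0"
    using powers_dependent[OF cl(2)] by blast
  have dep: "eqmod n (\<lambda>k. \<Sum>i\<le>r * r. c i * act (z [^] (i * j)) (act (y [^] i) u) k) (\<lambda>k. 0)" for j u
  proof -
    define v where "v = act (inv (x [^] j)) u"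
    define s where "s = (\<lambda>k. \<Sum>i\<le>r * r. c i * act (y [^] i) v k)"
    have s0: "s k = 0" if "k < r" for k using c(2)[OF that] by (simp add: s_def)
    have "eqmod n (act (z [^] (i * j)) (act (y [^] i) u)) (act (x [^] j) (act (y [^] i) v))" for i
    proof -
      have "X [^]\<^bsub>?Q\<^esub> j \<otimes>\<^bsub>?Q\<^esub> Y [^]\<^bsub>?Q\<^esub> i = Z [^]\<^bsub>?Q\<^esub> (i * j) \<otimes>\<^bsub>?Q\<^esub> Y [^]\<^bsub>?Q\<^esub> i \<otimes>\<^bsub>?Q\<^esub> X [^]\<^bsub>?Q\<^esub> j"
        by (rule Q.twisted_commute_pow[OF Qcl rel rel'])
      then have "cgr n #> (x [^] j \<otimes> y [^] i) = cgr n #> (z [^] (i * j) \<otimes> y [^] i \<otimes> x [^] j)"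
        using cl by (simp add: X_def Y_def Z_def pow)
      then have "eqmod n (act (z [^] (i * j) \<otimes> y [^] i \<otimes> x [^] j) v) (act (x [^] j \<otimes> y [^] i) v)"
        using cl by (intro eqmod_coset) auto
      then show ?thesis using cl by (simp add: lift_mult v_def)
    qed
    then have "eqmod n (\<lambda>k. \<Sum>i\<le>r * r. c i * act (z [^] (i * j)) (act (y [^] i) u) k)
        (\<lambda>k. \<Sum>i\<le>r * r. c i * act (x [^] j) (act (y [^] i) v) k)"
      by (intro eqmod_sum)
    also have "(\<lambda>k. \<Sum>i\<le>r * r. c i * act (x [^] j) (act (y [^] i) v) k) = act (x [^] j) s"
      unfolding s_def using cl by (simp add: act_sum)
    also have "act (x [^] j) s = s" by (rule act_outside) (use cl s0 in auto)
    also have "eqmod n s (\<lambda>k. 0)" by (simp add: eqmod_def s0)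
    finally show ?thesis .
  qed
  \<comment> \<open>The sum over \<open>\<langle>z\<rangle>\<close>, on which \<open>z\<close> acts trivially modulo \<open>n\<close>. The factor \<open>1\<close> gives it the shape expected by \<open>act_sum\<close>.\<close>
  define T where "T s = (\<lambda>k. \<Sum>a<l. 1 * act (z [^] a) s k)" for s
  have zT: "eqmod n (act z (T s)) (T s)" for s
  proof -
    have sw: "act z (act (z [^] a) s) = act (z [^] Suc a) s" for a
      unfolding nat_pow_Suc2[OF cl(3)] using cl by (simp add: lift_mult)
    have "act z (T s) = (\<lambda>k. \<Sum>a<l. 1 * act z (act (z [^] a) s) k)"
      unfolding T_def using cl by (subst act_sum) auto
    also have "\<dots> = (\<lambda>k. \<Sum>a<l. act (z [^] Suc a) s k)"
      by (simp only: sw mult_1)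
    also have "\<dots> = (\<lambda>k. T s k + act (z [^] l) s k - s k)"
    proof
      fix k
      have "(\<Sum>a<Suc l. act (z [^] a) s k) = s k + (\<Sum>a<l. act (z [^] Suc a) s k)"
        by (subst sum.lessThan_Suc_shift) simp
      then show "(\<Sum>a<l. act (z [^] Suc a) s k) = T s k + act (z [^] l) s k - s k"
        by (simp add: T_def)
    qed
    finally have eq: "act z (T s) = (\<lambda>k. T s k + act (z [^] l) s k - s k)" .
    show ?thesis unfolding eq
    proof -
      have "eqmod n (act (z [^] l) s) (act \<one> s)"
        using cl zl coset_mult_one[OF N.subset] by (intro eqmod_coset) auto
      then have "[T s k + (act (z [^] l) s k - s k) = T s k + (s k - s k)] (mod int n)" if "k < r" for k
        using that by (intro cong_add cong_diff) (auto simp: eqmod_def)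
      then show "eqmod n (\<lambda>k. T s k + act (z [^] l) s k - s k) (T s)"
        by (simp add: eqmod_def algebra_simps)
    qed
  qed
  have reindex: "eqmod n (\<lambda>k. \<Sum>j<l. 1 * act (z [^] (b * j)) s k) (T s)" if "coprime b l" for b s
  proof -
    have "eqmod n (\<lambda>k. \<Sum>j<l. 1 * act (z [^] (b * j)) s k)
        (\<lambda>k. \<Sum>j<l. 1 * act (z [^] (b * j mod l)) s k)"
      by (rule eqmod_sum, rule eqmod_coset) (use cl zmod in auto)
    also have "(\<lambda>k. \<Sum>j<l. 1 * act (z [^] (b * j mod l)) s k) = T s"
    proof
      fix k
      have "inj_on (\<lambda>j. b * j mod l) {..<l}"
      proof (rule inj_onI)
        fix i j assume ij: "i \<in> {..<l}" "j \<in> {..<l}" "b * i mod l = b * j mod l"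
        then have "[i = j] (mod l)" using that cong_mult_lcancel_nat[of b l i j] by (simp add: cong_def)
        then show "i = j" using ij by (simp add: cong_def)
      qed
      moreover have "(\<lambda>j. b * j mod l) ` {..<l} \<subseteq> {..<l}" using l(1) prime_gt_0_nat by auto
      ultimately have "bij_betw (\<lambda>j. b * j mod l) {..<l} {..<l}"
        by (simp add: bij_betw_def endo_inj_surj)
      then show "(\<Sum>j<l. 1 * act (z [^] (b * j mod l)) s k) = T s k"
        unfolding T_def by (rule sum.reindex_bij_betw)
    qed
    finally show ?thesis .
  qed
  have key: "int n dvd int l * (c i0 * (act z v k - v k))" if i0: "i0 \<le> r * r" and k: "k < r" for i0 v k
  proof -
    define u where "u = act (inv (y [^] i0)) v"
    \<comment> \<open>Modulo \<open>l\<close> the exponent \<open>e\<close> is \<open>- i\<^sub>0\<close>, written as a natural number.\<close>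
    define e where "e = i0 * (l - 1)"
    define s where "s i = act (y [^] i) u" for i :: nat
    define P where "P i = (\<lambda>k. \<Sum>j<l. 1 * act (z [^] ((e + i) * j)) (s i) k)" for i :: nat
    have s_i0: "s i0 = v" using cl by (simp add: s_def u_def)
    have "eqmod n (\<lambda>k. \<Sum>i\<le>r * r. c i * act (z [^] ((e + i) * j)) (s i) k) (\<lambda>k. 0)" for j
    proof -
      have "eqmod n (act (z [^] (e * j)) (\<lambda>k. \<Sum>i\<le>r * r. c i * act (z [^] (i * j)) (s i) k))
          (act (z [^] (e * j)) (\<lambda>k. 0))"
        using cl dep unfolding s_def by (intro eqmod_act) auto
      also have "act (z [^] (e * j)) (\<lambda>k. 0) = (\<lambda>k. 0)" using cl by (simp add: act_zero)
      also have "act (z [^] (e * j)) (\<lambda>k. \<Sum>i\<le>r * r. c i * act (z [^] (i * j)) (s i) k) =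
          (\<lambda>k. \<Sum>i\<le>r * r. c i * act (z [^] ((e + i) * j)) (s i) k)"
        using cl by (simp add: act_sum distrib_right flip: nat_pow_mult lift_mult)
      finally show ?thesis .
    qed
    then have "eqmod n (\<lambda>k. \<Sum>j<l. 1 * (\<Sum>i\<le>r * r. c i * act (z [^] ((e + i) * j)) (s i) k))
        (\<lambda>k. \<Sum>j<l. 1 * 0)"
      by (intro eqmod_sum)
    moreover have "(\<lambda>k. \<Sum>j<l. 1 * (\<Sum>i\<le>r * r. c i * act (z [^] ((e + i) * j)) (s i) k)) =
        (\<lambda>k. \<Sum>i\<le>r * r. c i * P i k)"
      unfolding P_def by (simp add: sum_distrib_left sum.swap[of _ "{..<l}"])
    ultimately have P0: "eqmod n (\<lambda>k. \<Sum>i\<le>r * r. c i * P i k) (\<lambda>k. 0)" by simp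
    then have "eqmod n (act z (\<lambda>k. \<Sum>i\<le>r * r. c i * P i k)) (act z (\<lambda>k. 0))"
      using cl by (intro eqmod_act)
    then have zP0: "eqmod n (\<lambda>k. \<Sum>i\<le>r * r. c i * act z (P i) k) (\<lambda>k. 0)"
      using cl by (simp add: act_sum act_zero)
    have same: "eqmod n (act z (P i)) (P i)" if i: "i \<le> r * r" "i \<noteq> i0" for i
    proof -
      have "coprime (e + i) l"
      proof -
        have "\<not> l dvd e + i"
        proof
          assume "l dvd e + i"
          then have "int l dvd int (e + i)" by (simp only: int_dvd_int_iff)
          moreover have "int (e + i) = int l * int i0 + (int i - int i0)"
            using prime_gt_0_nat[OF l(1)] by (cases l) (simp_all add: e_def algebra_simps)
          ultimately have "int l dvd int l * int i0 + (int i - int i0)" by argo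
          then have "int l dvd int i - int i0" using dvd_add_right_iff[of "int l" "int l * int i0"] by simp
          then have "int l \<le> \<bar>int i - int i0\<bar>"
            using i dvd_imp_le_int[of "int i - int i0" "int l"] by simp
          then show False using i i0 l(2) by linarith
        qed
        then show ?thesis using l(1) by (simp add: prime_imp_coprime coprime_commute)
      qed
      then have PT: "eqmod n (P i) (T (s i))" unfolding P_def by (rule reindex)
      then have "eqmod n (act z (P i)) (act z (T (s i)))" using cl by (intro eqmod_act)
      also note zT
      also note eqmod_sym[OF PT]
      finally show ?thesis .
    qed
    have "eqmod n (P i0) (\<lambda>k. \<Sum>j<l. 1 * v k)"
      unfolding P_def
    proof (rule eqmod_sum)
      fix j
      have "(e + i0) * j = l * (i0 * j)"
        using prime_gt_0_nat[OF l(1)] by (cases l) (simp_all add: e_def algebra_simps)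
      then have "(e + i0) * j mod l = 0" by (simp only: mod_mult_self1_is_0)
      then have "cgr n #> (z [^] ((e + i0) * j)) = cgr n #> \<one>"
        using zmod[of "(e + i0) * j"] by (simp only: nat_pow_0)
      then have "eqmod n (act (z [^] ((e + i0) * j)) v) (act \<one> v)" using cl by (intro eqmod_coset) auto
      then show "eqmod n (act (z [^] ((e + i0) * j)) (s i0)) v" by (simp add: s_i0)
    qed
    then have Pi0: "eqmod n (P i0) (\<lambda>k. int l * v k)" by simp
    then have "eqmod n (act z (P i0)) (act z (\<lambda>k. int l * v k))" using cl by (intro eqmod_act)
    then have zPi0: "eqmod n (act z (P i0)) (\<lambda>k. int l * act z v k)" using cl by (simp add: act_scale)
    have "int n dvd (\<Sum>i\<le>r * r. c i * act z (P i) k) - (\<Sum>i\<le>r * r. c i * P i k)"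
      using P0 zP0 k by (auto simp: eqmod_def cong_iff_dvd_diff)
    also have "(\<Sum>i\<le>r * r. c i * act z (P i) k) - (\<Sum>i\<le>r * r. c i * P i k) =
        (\<Sum>i\<le>r * r. c i * (act z (P i) k - P i k))"
      by (simp add: sum_subtractf right_diff_distrib)
    also have "\<dots> = c i0 * (act z (P i0) k - P i0 k) +
        (\<Sum>i\<in>{..r * r} - {i0}. c i * (act z (P i) k - P i k))"
      using i0 by (subst sum.remove[of _ i0]) auto
    finally have "int n dvd \<dots>" .
    moreover have "int n dvd (\<Sum>i\<in>{..r * r} - {i0}. c i * (act z (P i) k - P i k))"
      using same k by (intro dvd_sum dvd_mult) (auto simp: eqmod_def cong_iff_dvd_diff)
    ultimately have "int n dvd c i0 * (act z (P i0) k - P i0 k)" using dvd_add_left_iff by blast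
    then have "[c i0 * (act z (P i0) k - P i0 k) = 0] (mod int n)" by (simp add: cong_0_iff)
    moreover have "[c i0 * (act z (P i0) k - P i0 k) = c i0 * (int l * act z v k - int l * v k)] (mod int n)"
      using Pi0 zPi0 k by (intro cong_scalar_left cong_diff) (auto simp: eqmod_def)
    ultimately have "[c i0 * (int l * act z v k - int l * v k) = 0] (mod int n)"
      using cong_sym cong_trans by blast
    then show ?thesis by (simp add: cong_0_iff algebra_simps)
  qed
  show ?thesis unfolding cgr_def
  proof (intro CollectI conjI allI)
    fix v k
    show "int n dvd act z v k - v k"
    proof (cases "k < r")
      case True
      let ?d = "act z v k - v k"
      have "coprime (int n) (int l)" using l(3) by (simp add: coprime_commute)
      then have "int n dvd ?d * c i" if "i \<le> r * r" for i
        using key[OF that True, of v] by (simp add: coprime_dvd_mult_right_iff mult.commute)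
      then have "int n dvd Gcd ((*) ?d ` c ` {..r * r})" by (intro Gcd_greatest) auto
      then show ?thesis by (simp only: Gcd_mult c(1)) simp
    next
      case False
      then show ?thesis using cl by (simp add: act_above)
    qed
  qed (rule cl)
qed

theorem p_subgroups_mod_cgr_abelian:
  assumes l: "prime (l::nat)" "r * r < l" "coprime l n"
    and S: "subgroup S (W Mod cgr n)" "card S = l ^ a" and uv: "u \<in> S" "v \<in> S"
  shows "u \<otimes>\<^bsub>W Mod cgr n\<^esub> v = v \<otimes>\<^bsub>W Mod cgr n\<^esub> u"
proof (rule ccontr)
  assume ne: "u \<otimes>\<^bsub>W Mod cgr n\<^esub> v \<noteq> v \<otimes>\<^bsub>W Mod cgr n\<^esub> u"
  interpret N: normal "cgr n" W by (rule cgr_normal)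
  let ?Q = "W Mod cgr n"
  interpret Q: group ?Q by (rule N.factorgroup_is_group)
  interpret q: group_hom W ?Q "\<lambda>g. cgr n #> g"
    by unfold_locales (rule N.r_coset_hom_Mod)
  interpret S: group "?Q\<lparr>carrier := S\<rparr>" by (rule Q.subgroup_imp_group[OF S(1)])
  have ord: "order (?Q\<lparr>carrier := S\<rparr>) = l ^ a" using S(2) by (simp add: order_def)
  obtain X Y Z where XYZ: "X \<in> S" "Y \<in> S" "Z \<in> S" "X \<otimes>\<^bsub>?Q\<^esub> Y = Z \<otimes>\<^bsub>?Q\<^esub> Y \<otimes>\<^bsub>?Q\<^esub> X"
    "Z \<otimes>\<^bsub>?Q\<^esub> X = X \<otimes>\<^bsub>?Q\<^esub> Z" "Z \<otimes>\<^bsub>?Q\<^esub> Y = Y \<otimes>\<^bsub>?Q\<^esub> Z"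
    "Z [^]\<^bsub>?Q\<lparr>carrier := S\<rparr>\<^esub> l = \<one>\<^bsub>?Q\<^esub>" "Z \<noteq> \<one>\<^bsub>?Q\<^esub>"
    by (rule S.nonabelian_p_group_commutator[OF l(1) ord, of u v]) (use uv ne in auto)
  have Zl: "Z [^]\<^bsub>?Q\<^esub> l = \<one>\<^bsub>?Q\<^esub>" using XYZ(7) Q.nat_pow_consistent by metis
  have "\<exists>g\<in>carrier W. C = cgr n #> g" if "C \<in> S" for C
    using subgroup.subset[OF S(1)] that by (auto simp: FactGroup_def RCOSETS_def)
  then obtain x y z where g: "x \<in> carrier W" "X = cgr n #> x" "y \<in> carrier W" "Y = cgr n #> y"
    "z \<in> carrier W" "Z = cgr n #> z" using XYZ(1-3) by metis
  have "z \<in> cgr n"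
  proof (rule twisted_commutator_in_cgr[OF l g(1,3,5)])
    show "cgr n #> (z [^] l) = cgr n" using Zl g q.hom_nat_pow[of z l] by simp
  qed (use XYZ(4-6) g in simp_all)
  then have "Z = cgr n" using g coset_join2[OF g(5) N.is_subgroup] by simp
  then show False using XYZ(8) by simp
qed

end

section \<open>Involutions generating a symmetric group, and Heisenberg permutations\<close>

definition reverse_below :: "nat \<Rightarrow> nat \<Rightarrow> nat" where
  "reverse_below N p = (if p < N then N - 1 - p else p)"

text \<open>Negation modulo \<open>N\<close>. Together with the reversal it generates the cyclic shift.\<close>

definition negate_below :: "nat \<Rightarrow> nat \<Rightarrow> nat" where
  "negate_below N p = (if 0 < p \<and> p < N then N - p else p)"

lemma reverse_below_invol: "reverse_below N (reverse_below N p) = p"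
  by (auto simp: reverse_below_def)

lemma negate_below_invol: "negate_below N (negate_below N p) = p"
  by (auto simp: negate_below_def)

lemma below_bounds: "p < N \<Longrightarrow> reverse_below N p < N" "p < N \<Longrightarrow> negate_below N p < N"
  by (auto simp: reverse_below_def negate_below_def)

text \<open>Conjugating \<open>(0 1)\<close> by the shift gives the adjacent transpositions, and these generate everything.\<close>

lemma three_involutions_generate:
  assumes N: "2 \<le> N"
    and gens: "reverse_below N \<in> S" "negate_below N \<in> S" "Transposition.transpose 0 1 \<in> S"
    and id: "id \<in> S" and comp: "\<And>f g. f \<in> S \<Longrightarrow> g \<in> S \<Longrightarrow> f \<circ> g \<in> S"
    and s: "s permutes {..<N}"
  shows "s \<in> S"
proof -
  define u d where "u = negate_below N \<circ> reverse_below N" and "d = reverse_below N \<circ> negate_below N"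
  have ud: "u \<in> S" "d \<in> S" using gens comp by (auto simp: u_def d_def)
  have u_eq: "u p = (if p < N then if Suc p = N then 0 else Suc p else p)" for p
    using N by (auto simp: u_def negate_below_def reverse_below_def)
  have d_eq: "d p = (if p < N then if p = 0 then N - 1 else p - 1 else p)" for p
    using N by (auto simp: d_def negate_below_def reverse_below_def)
  have adj: "Suc k < N \<Longrightarrow> Transposition.transpose k (Suc k) \<in> S" for k
  proof (induction k)
    case (Suc k)
    have "u \<circ> (Transposition.transpose k (Suc k) \<circ> d) = Transposition.transpose (Suc k) (Suc (Suc k))"
    proof
      fix p
      show "(u \<circ> (Transposition.transpose k (Suc k) \<circ> d)) p = Transposition.transpose (Suc k) (Suc (Suc k)) p"
        using Suc.prems by (cases p) (auto simp: u_eq d_eq transpose_def)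
    qed
    then show ?case using comp[OF ud(1) comp[OF Suc.IH ud(2)]] Suc.prems by simp
  qed (use gens in simp)
  have tr: "i < j \<Longrightarrow> j < N \<Longrightarrow> Transposition.transpose i j \<in> S" for i j
  proof (induction j)
    case (Suc j)
    show ?case
    proof (cases "i = j")
      case False
      then have "Transposition.transpose i j \<in> S" "Transposition.transpose j (Suc j) \<in> S" using Suc adj by auto
      then have "Transposition.transpose j (Suc j) \<circ> (Transposition.transpose i j \<circ> Transposition.transpose j (Suc j)) \<in> S" using comp by blast
      also have "Transposition.transpose j (Suc j) \<circ> (Transposition.transpose i j \<circ> Transposition.transpose j (Suc j)) = Transposition.transpose i (Suc j)"
        using False Suc.prems by (auto simp: fun_eq_iff transpose_def)
      finally show ?thesis .
    qed (use Suc adj in auto)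
  qed simp
  have tr': "Transposition.transpose i j \<in> S" if "i < N" "j < N" for i j
  proof (cases i j rule: linorder_cases)
    case equal
    then show ?thesis using id by simp
  next
    case greater
    then show ?thesis using tr[of j i] that by (simp add: transpose_commute)
  qed (use tr that in auto)
  show ?thesis
    using s finite_lessThan[of N]
  proof (induction s rule: permutes_induct)
    case (swap a b p)
    show ?case by (rule comp[OF tr']) (use swap in auto)
  qed (rule id)
qed

text \<open>The permutation \<open>(u, v) \<mapsto> (u + a, v + b u + c)\<close> of pairs of residues modulo \<open>l\<close>, where \<open>(u, v)\<close> is encoded by the
number with digits \<open>u\<close> and \<open>v\<close> in base \<open>l\<close>. These permutations form the Heisenberg group of order \<open>l\<^sup>3\<close>.\<close>

definition heis :: "nat \<Rightarrow> nat \<Rightarrow> nat \<Rightarrow> nat \<Rightarrow> nat \<Rightarrow> nat" where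
  "heis l a b c p = (if p < l * l
     then (p div l + a) mod l * l + (p mod l + b * (p div l) + c) mod l else p)"

lemma digits_less: "u < l \<Longrightarrow> v < l \<Longrightarrow> u * l + v < l * (l::nat)"
proof -
  assume "u < l" "v < l"
  then have "u * l + v < Suc u * l" by simp
  also have "\<dots> \<le> l * l" using \<open>u < l\<close> by (intro mult_le_mono1) simp
  finally show ?thesis .
qed

lemma heis_digits:
  assumes "p < l * l"
  shows "heis l a b c p < l * l" "heis l a b c p div l = (p div l + a) mod l"
    "heis l a b c p mod l = (p mod l + b * (p div l) + c) mod l"
proof -
  have l: "0 < l" using assms by (cases l) auto
  then show "heis l a b c p < l * l" using assms digits_less by (simp add: heis_def)
  show "heis l a b c p div l = (p div l + a) mod l"
    "heis l a b c p mod l = (p mod l + b * (p div l) + c) mod l"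
    using l assms by (simp_all add: heis_def)
qed

lemma eq_by_digits:
  fixes x y l :: nat
  shows "x div l = y div l \<Longrightarrow> x mod l = y mod l \<Longrightarrow> x = y"
  by (metis div_mult_mod_eq)

lemma heis_comp: "heis l a b c \<circ> heis l a' b' c' = heis l (a + a') (b + b') (c + c' + b * a')"
proof
  fix p
  show "(heis l a b c \<circ> heis l a' b' c') p = heis l (a + a') (b + b') (c + c' + b * a') p"
  proof (cases "p < l * l")
    case True
    have "[(p mod l + b' * (p div l) + c') mod l + b * ((p div l + a') mod l) + c =
        (p mod l + b' * (p div l) + c') + b * (p div l + a') + c] (mod l)"
      by (intro cong_add cong_mult) (simp_all add: cong_def)
    then have eq: "((p mod l + b' * (p div l) + c') mod l + b * ((p div l + a') mod l) + c) mod l =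
        (p mod l + (b + b') * (p div l) + (c + c' + b * a')) mod l"
      by (simp add: cong_def algebra_simps)
    show ?thesis
    proof (rule eq_by_digits[of _ l])
      have "((p div l + a') mod l + a) mod l = (p div l + (a + a')) mod l"
        by (simp only: mod_add_left_eq) (simp add: add_ac)
      then show "(heis l a b c \<circ> heis l a' b' c') p div l =
          heis l (a + a') (b + b') (c + c' + b * a') p div l"
        using True by (simp add: heis_digits)
      show "(heis l a b c \<circ> heis l a' b' c') p mod l =
          heis l (a + a') (b + b') (c + c' + b * a') p mod l"
        using True eq by (simp only: comp_apply heis_digits)
    qed
  qed (simp add: heis_def)
qed

lemma heis_mod: "heis l (a mod l) (b mod l) (c mod l) = heis l a b c"
proof
  fix p
  have "[p mod l + b mod l * (p div l) + c mod l = p mod l + b * (p div l) + c] (mod l)"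
    by (intro cong_add cong_mult) (simp_all add: cong_def)
  then show "heis l (a mod l) (b mod l) (c mod l) p = heis l a b c p"
    by (simp add: heis_def cong_def mod_add_right_eq)
qed

lemma heis_zero: "heis l 0 0 0 = id"
proof
  fix p show "heis l 0 0 0 p = id p"
  proof (cases "p < l * l")
    case True
    then have "p div l < l" by (simp add: less_mult_imp_div_less)
    then show ?thesis
      by (intro box_equals[OF _ HOL.refl id_apply[symmetric]] eq_by_digits[of "heis l 0 0 0 p" l p])
        (use True in \<open>simp_all add: heis_digits\<close>)
  qed (simp add: heis_def)
qed

lemma heis_left_inverse: "\<exists>a' b' c'. heis l a' b' c' \<circ> heis l a b c = id"
proof (cases l)
  case (Suc k)
  have "k * x + x = l * x" for x using Suc by simp
  then have z: "(k * x + x) mod l = 0" for x by (simp only: mod_mult_self1_is_0)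
  \<comment> \<open>Multiplication by \<open>k = l - 1\<close> is negation modulo \<open>l\<close>.\<close>
  define b' where "b' = k * b"
  define c' where "c' = k * (c + b' * a)"
  have "heis l (k * a) b' c' \<circ> heis l a b c = heis l (k * a + a) (b' + b) (c' + (c + b' * a))"
    by (simp add: heis_comp add.assoc)
  also have "\<dots> = heis l 0 0 0"
    by (subst heis_mod[symmetric]) (simp only: z b'_def c'_def)
  finally show ?thesis using heis_zero by auto
qed (auto simp: heis_def fun_eq_iff)

definition heis_group :: "nat \<Rightarrow> (nat \<Rightarrow> nat) monoid" where
  "heis_group l = \<lparr>carrier = {heis l a b c | a b c. True}, monoid.mult = (\<circ>), one = id\<rparr>"

lemma heis_in_group [simp]: "heis l a b c \<in> carrier (heis_group l)"
  by (auto simp: heis_group_def)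

lemma heis_group: "group (heis_group l)"
proof (rule groupI)
  show "\<one>\<^bsub>heis_group l\<^esub> \<in> carrier (heis_group l)"
    using heis_in_group[of l 0 0 0] by (simp add: heis_group_def heis_zero)
next
  fix x assume "x \<in> carrier (heis_group l)"
  then obtain a b c where "x = heis l a b c" by (auto simp: heis_group_def)
  then obtain a' b' c' where "heis l a' b' c' \<circ> x = id" using heis_left_inverse by blast
  then show "\<exists>y\<in>carrier (heis_group l). y \<otimes>\<^bsub>heis_group l\<^esub> x = \<one>\<^bsub>heis_group l\<^esub>"
    by (intro bexI[of _ "heis l a' b' c'"] heis_in_group) (simp add: heis_group_def)
next
  fix x y assume "x \<in> carrier (heis_group l)" "y \<in> carrier (heis_group l)"
  then obtain a b c a' b' c' where "x = heis l a b c" "y = heis l a' b' c'"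
    by (auto simp: heis_group_def)
  then have "x \<circ> y = heis l (a + a') (b + b') (c + c' + b * a')" by (simp add: heis_comp)
  then show "x \<otimes>\<^bsub>heis_group l\<^esub> y \<in> carrier (heis_group l)" by (auto simp: heis_group_def)
qed (auto simp: heis_group_def)

lemma heis_group_order:
  assumes l: "2 \<le> l"
  shows "order (heis_group l) = l ^ 3"
proof -
  let ?h = "\<lambda>(a, b, c). heis l a b c"
  let ?D = "{..<l} \<times> {..<l} \<times> {..<l}"
  have "carrier (heis_group l) = ?h ` ?D"
  proof
    show "carrier (heis_group l) \<subseteq> ?h ` ?D"
    proof
      fix x assume "x \<in> carrier (heis_group l)"
      then obtain a b c where "x = heis l a b c" by (auto simp: heis_group_def)
      then have "x = ?h (a mod l, b mod l, c mod l)" by (simp add: heis_mod)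
      then show "x \<in> ?h ` ?D" by (rule image_eqI) (use l in auto)
    qed
  qed auto
  moreover have "inj_on ?h ?D"
  proof (rule inj_onI)
    fix s t assume st: "s \<in> ?D" "t \<in> ?D" "?h s = ?h t"
    obtain a b c a' b' c' where e: "s = (a, b, c)" "t = (a', b', c')" by (cases s, cases t) auto
    have lt: "a < l" "b < l" "c < l" "a' < l" "b' < l" "c' < l" using st e by auto
    have h: "heis l a b c p = heis l a' b' c' p" for p using st(3) e by (simp add: fun_eq_iff)
    have p0: "0 < l * l" and pl: "l < l * l" using l by auto
    have "a = a'" using arg_cong[OF h[of 0], of "\<lambda>x. x div l"] lt p0 by (simp add: heis_digits)
    moreover have "c = c'" using arg_cong[OF h[of 0], of "\<lambda>x. x mod l"] lt p0 by (simp add: heis_digits)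
    moreover have "[b + c = b' + c'] (mod l)"
      using arg_cong[OF h[of l], of "\<lambda>x. x mod l"] l pl by (simp add: heis_digits cong_def)
    then have "[b = b'] (mod l)" using \<open>c = c'\<close> by (simp add: cong_add_rcancel_nat)
    then have "b = b'" using lt by (simp add: cong_def)
    ultimately show "s = t" using e by simp
  qed
  ultimately show ?thesis by (simp add: order_def card_image power3_eq_cube mult.assoc)
qed

lemma heis_permutes:
  assumes s: "s \<in> carrier (heis_group l)" and N: "l * l \<le> N"
  shows "s permutes {..<N}"
proof -
  obtain a b c where e: "s = heis l a b c" using s by (auto simp: heis_group_def)
  have outside: "s p = p" if "p \<notin> {..<N}" for p
    using that N e by (auto simp: heis_def)
  obtain a' b' c' where "heis l a' b' c' \<circ> s = id" using heis_left_inverse e by blast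
  then have "inj s" by (metis inj_on_id inj_on_imageI2)
  then have inj: "inj_on s {..<N}" by (rule inj_on_subset) simp
  have "s p < N" if "p < N" for p
    using that N e heis_digits(1)[of p l a b c] by (cases "p < l * l") (auto simp: heis_def)
  then have "s ` {..<N} = {..<N}" by (intro endo_inj_surj[OF finite_lessThan _ inj]) auto
  then show ?thesis using inj outside by (intro bij_imp_permutes) (auto simp: bij_betw_def)
qed

text \<open>So the commutator of these two elements is the shift of the second coordinate.\<close>

lemma heis_commutator: "heis l 0 1 0 \<circ> heis l 1 0 0 = heis l 0 0 1 \<circ> (heis l 1 0 0 \<circ> heis l 0 1 0)"
  by (simp add: heis_comp)

text \<open>At \<open>l\<^sub>1 - 1\<close> the smaller shift wraps around to \<open>0\<close> while the larger one moves on to \<open>l\<^sub>1\<close>.\<close>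

lemma heis_shift_noncommuting:
  assumes "2 \<le> l1" "l1 < l2"
  shows "heis l1 0 0 1 (heis l2 0 0 1 (l1 - 1)) \<noteq> heis l2 0 0 1 (heis l1 0 0 1 (l1 - 1))"
proof -
  have sq: "l1 \<le> l1 * l1" "l2 \<le> l2 * l2" by simp_all
  have "l1 < l1 * l1" "0 < l2 * l2" using assms by simp_all
  moreover have "l1 - 1 < l2 * l2" "l1 - 1 < l1 * l1" using assms sq by linarith+
  ultimately have "heis l2 0 0 1 (l1 - 1) = l1" "heis l1 0 0 1 l1 = l1 + 1"
    "heis l1 0 0 1 (l1 - 1) = 0" "heis l2 0 0 1 0 = 1"
    using assms by (simp_all add: heis_def)
  then show ?thesis using assms by simp
qed

section \<open>Components with three bounding walls\<close>

context fold_action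
begin

lemma fold_invariant:
  assumes g: "g \<in> carrier W" and s: "fst s \<in> carrier \<Gamma>" "snd s \<in> A"
    and lab: "\<And>t p. p \<in> A \<Longrightarrow> lab t p \<in> A"
  shows "fold g s \<in> carrier \<Gamma> \<times> A"
  using g
proof (induction rule: word_induct)
  case (mult i h)
  have "step i t \<in> carrier \<Gamma> \<times> A" if "t \<in> carrier \<Gamma> \<times> A" for t
    using that mult lab by (cases t) (simp add: step_def \<pi>_closed)
  then show ?case using mult by (simp add: lift_mult)
qed (use s in \<open>simp add: mem_Times_iff\<close>)

end

text \<open>The level \<open>n\<close> separates three bounding walls, so that the involutions attached to them can be chosen independently.\<close>

locale three_panels = small_coxeter +
  fixes j n N :: nat and t1 t2 t3
  assumes j: "j < r" and n: "3 dvd n" "0 < n" and N: "2 \<le> N"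
    and panels: "t1 \<in> panels (family j)" "t2 \<in> panels (family j)" "t3 \<in> panels (family j)"
    and distinct: "cgr n #> t1 \<noteq> cgr n #> t2" "cgr n #> t1 \<noteq> cgr n #> t3"
      "cgr n #> t2 \<noteq> cgr n #> t3"
begin

definition label where
  "label y = (if y = cgr n #> t1 then reverse_below N
     else if y = cgr n #> t2 then negate_below N
     else if y = cgr n #> t3 then Transposition.transpose 0 1 else id)"

sublocale F: fold_action W r w m "W Mod cgr n" "\<lambda>g. cgr n #> g" "family j" label
  by (rule fold_action_quotient[OF j n(1)])
    (simp add: label_def reverse_below_invol negate_below_invol)

lemma label_below: "p \<in> {..<N} \<Longrightarrow> label y p \<in> {..<N}"
  using below_bounds[of p N] N by (auto simp: label_def transpose_def)

text \<open>The chamber of the identity at level \<open>n\<close>.\<close>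

abbreviation base where
  "base \<equiv> \<one>\<^bsub>W Mod cgr n\<^esub>"

definition realizes where
  "realizes g s \<longleftrightarrow> g \<in> carrier W \<and> (\<forall>p<N. F.fold g (base, p) = (base, s p))"

lemma realizes_mult:
  assumes "realizes g s" "realizes h t" "t ` {..<N} \<subseteq> {..<N}"
  shows "realizes (g \<otimes> h) (s \<circ> t)"
  using assms unfolding realizes_def by (auto simp: lift_mult image_subset_iff simp del: one_FactGroup)

lemma realizes_inv:
  assumes g: "realizes g s" and st: "\<And>p. p < N \<Longrightarrow> t p < N \<and> s (t p) = p"
  shows "realizes (inv g) t"
proof -
  have gc: "g \<in> carrier W" using g by (simp add: realizes_def)
  have "F.fold (inv g) (base, p) = (base, t p)" if p: "p < N" for p
  proof -
    have "F.fold g (base, t p) = (base, p)" using g st[OF p] by (simp add: realizes_def del: one_FactGroup)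
    then show ?thesis using lift_inv(1)[OF F.coxeter_maps_step gc, of "(base, t p)"] by simp
  qed
  then show ?thesis using gc by (simp add: realizes_def del: one_FactGroup)
qed

text \<open>Reflecting in the bounding walls realises the three attached involutions, and these generate the symmetric group.\<close>

lemma realizes_permutation:
  assumes "s permutes {..<N}"
  shows "\<exists>g. realizes g s"
proof -
  define S where "S = {s. s ` {..<N} \<subseteq> {..<N} \<and> (\<exists>g. realizes g s)}"
  have panel: "realizes t (label (cgr n #> t))" if "t \<in> panels (family j)" for t
    using F.fold_panel[OF that] panels_closed[OF that] by (simp add: realizes_def del: one_FactGroup)
  have img: "label y ` {..<N} \<subseteq> {..<N}" for y using label_below by auto
  have "label (cgr n #> t) \<in> S" if "t \<in> panels (family j)" for t
    using panel[OF that] img by (auto simp: S_def)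
  then have "label (cgr n #> t1) \<in> S" "label (cgr n #> t2) \<in> S" "label (cgr n #> t3) \<in> S"
    using panels by auto
  then have gens: "reverse_below N \<in> S" "negate_below N \<in> S" "Transposition.transpose 0 1 \<in> S"
    using distinct by (simp_all add: label_def)
  have "realizes \<one> id" by (simp add: realizes_def)
  then have idS: "id \<in> S" by (auto simp: S_def)
  have "f \<circ> g \<in> S" if fg: "f \<in> S" "g \<in> S" for f g
  proof -
    obtain g' h' where gh: "realizes g' f" "realizes h' g" "f ` {..<N} \<subseteq> {..<N}" "g ` {..<N} \<subseteq> {..<N}"
      using fg by (auto simp: S_def)
    have "(f \<circ> g) ` {..<N} \<subseteq> {..<N}" using gh(3,4) by (force simp: image_subset_iff)
    then show ?thesis using realizes_mult[OF gh(1,2,4)] unfolding S_def by blast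
  qed
  then have "s \<in> S" using three_involutions_generate[OF N gens idS _ assms] by blast
  then show ?thesis by (simp add: S_def)
qed

definition fold_kernel where
  "fold_kernel = {g \<in> carrier W. \<forall>y\<in>carrier (W Mod cgr n). \<forall>p<N. F.fold g (y, p) = (y, p)}"

lemma fold_kernel_subgroup: "subgroup fold_kernel W"
proof (rule subgroupI)
  have "\<one> \<in> fold_kernel" by (simp add: fold_kernel_def)
  then show "fold_kernel \<noteq> {}" by blast
next
  fix g assume g: "g \<in> fold_kernel"
  then have gc: "g \<in> carrier W" by (simp add: fold_kernel_def)
  have "F.fold (inv g) (y, p) = (y, p)" if "y \<in> carrier (W Mod cgr n)" "p < N" for y p
  proof -
    have "F.fold g (y, p) = (y, p)" using g that by (simp add: fold_kernel_def)
    then show ?thesis using lift_inv(1)[OF F.coxeter_maps_step gc, of "(y, p)"] by simp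
  qed
  then show "inv g \<in> fold_kernel" using gc by (simp add: fold_kernel_def)
qed (auto simp: fold_kernel_def lift_mult)

lemma fold_kernel_finite_index: "finite (rcosets fold_kernel)"
proof (rule finite_rcosets_if_finite_invariant[OF fold_kernel_subgroup])
  let ?X = "carrier (W Mod cgr n) \<times> {..<N}"
  let ?f = "\<lambda>g. \<lambda>s\<in>?X. F.fold (inv g) s"
  have fin: "finite ?X" using cgr_finite_index[OF n(2)] by (simp add: FactGroup_def)
  have "F.fold (inv g) s \<in> ?X" if "g \<in> carrier W" "s \<in> ?X" for g s
    using F.fold_invariant[OF _ _ _ label_below, of "inv g" s] that by (simp add: mem_Times_iff)
  then have "?f ` carrier W \<subseteq> PiE ?X (\<lambda>_. ?X)"
    by (intro image_subsetI, subst restrict_PiE_iff) blast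
  then show "finite (?f ` carrier W)" using finite_PiE[OF fin, of "\<lambda>_. ?X"] fin finite_subset by blast
next
  let ?X = "carrier (W Mod cgr n) \<times> {..<N}"
  fix g h assume gh: "g \<in> carrier W" "h \<in> carrier W"
    and eq: "(\<lambda>s\<in>?X. F.fold (inv g) s) = (\<lambda>s\<in>?X. F.fold (inv h) s)"
  have "F.fold (g \<otimes> inv h) s = s" if s: "s \<in> ?X" for s
  proof -
    have "F.fold (inv g) s = F.fold (inv h) s" using fun_cong[OF eq, of s] s by simp
    then show ?thesis using gh lift_inv(2)[OF F.coxeter_maps_step gh(1), of s] by (simp add: lift_mult)
  qed
  then show "g \<otimes> inv h \<in> fold_kernel" using gh by (simp add: fold_kernel_def)
qed

text \<open>The shift is a commutator in the Heisenberg group, which is a nonabelian \<open>l\<close>-group all of whose elements are realised.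
As the \<open>l\<close>-subgroups of \<open>W/W[a]\<close> are abelian, the lifts can be chosen with commutator in \<open>W[a]\<close>.\<close>

lemma realizes_heis_shift:
  assumes l: "prime l" "r * r < l" "coprime l a" "0 < a" and lN: "l * l \<le> N"
  shows "\<exists>c\<in>cgr a. realizes c (heis l 0 0 1)"
proof -
  interpret A: normal "cgr a" W by (rule cgr_normal)
  let ?P = "heis_group l"
  interpret P: group ?P by (rule heis_group)
  define R where "R = {(g, s). s \<in> carrier ?P \<and> realizes g s}"
  have img: "s ` {..<N} \<subseteq> {..<N}" if "s \<in> carrier ?P" for s
    using permutes_image[OF heis_permutes[OF that lN]] by simp
  have mult: "s \<otimes>\<^bsub>?P\<^esub> t = s \<circ> t" "\<one>\<^bsub>?P\<^esub> = id" for s t by (simp_all add: heis_group_def)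
  have R: "subgroup R (W \<times>\<times> ?P)"
  proof (rule group.subgroupI)
    show "group (W \<times>\<times> ?P)" by (rule DirProd_group) unfold_locales
    show "R \<subseteq> carrier (W \<times>\<times> ?P)" by (auto simp: R_def realizes_def)
    have "(\<one>, \<one>\<^bsub>?P\<^esub>) \<in> R" using P.one_closed by (simp add: R_def realizes_def mult)
    then show "R \<noteq> {}" by blast
  next
    fix x assume "x \<in> R"
    then obtain g s where x: "x = (g, s)" "s \<in> carrier ?P" "realizes g s" by (auto simp: R_def)
    have gc: "g \<in> carrier W" using x(3) by (simp add: realizes_def)
    let ?t = "inv\<^bsub>?P\<^esub> s"
    have "s \<circ> ?t = id" using P.r_inv[OF x(2)] by (simp add: mult)
    then have "s (?t p) = p" for p by (simp add: fun_eq_iff)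
    moreover have "?t p < N" if "p < N" for p using img[OF P.inv_closed[OF x(2)]] that by auto
    ultimately have "realizes (inv g) ?t" by (intro realizes_inv[OF x(3)]) auto
    then show "inv\<^bsub>W \<times>\<times> ?P\<^esub> x \<in> R"
      using x gc by (simp add: inv_DirProd[OF group_W P.is_group] R_def)
  next
    fix x y assume "x \<in> R" "y \<in> R"
    then show "x \<otimes>\<^bsub>W \<times>\<times> ?P\<^esub> y \<in> R"
      using realizes_mult img P.m_closed by (auto simp: R_def mult)
  qed
  have onto: "\<exists>g. (g, s) \<in> R" if "s \<in> carrier ?P" for s
    using realizes_permutation[OF heis_permutes[OF that lN]] that by (simp add: R_def)
  obtain x y where xy: "(x, heis l 0 1 0) \<in> R" "(y, heis l 1 0 0) \<in> R"
    "x \<otimes> y \<otimes> inv (y \<otimes> x) \<in> cgr a"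
  proof (rule A.commuting_p_lifts[where u = "heis l 0 1 0" and v = "heis l 1 0 0",
        OF cgr_finite_index[OF l(4)] l(1) _ heis_group heis_group_order R onto])
    show "2 \<le> l" using prime_ge_2_nat[OF l(1)] .
  next
    fix S b u v
    assume "subgroup S (W Mod cgr a)" "card S = l ^ b" "u \<in> S" "v \<in> S"
    then show "u \<otimes>\<^bsub>W Mod cgr a\<^esub> v = v \<otimes>\<^bsub>W Mod cgr a\<^esub> u"
      by (rule p_subgroups_mod_cgr_abelian[OF l(1-3)])
  qed auto
  let ?c = "x \<otimes> y \<otimes> inv (y \<otimes> x)"
  have real: "realizes x (heis l 0 1 0)" "realizes y (heis l 1 0 0)" using xy by (auto simp: R_def)
  have im: "heis l a b c ` {..<N} \<subseteq> {..<N}" for a b c by (rule img) simp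
  have cl: "x \<in> carrier W" "y \<in> carrier W" using real by (auto simp: realizes_def)
  have "F.fold ?c (base, p) = (base, heis l 0 0 1 p)" if p: "p < N" for p
  proof -
    let ?yx = "heis l 1 0 0 \<circ> heis l 0 1 0"
    have perm: "?yx permutes {..<N}" by (rule heis_permutes[OF _ lN]) (simp add: heis_comp)
    then obtain q where q: "q < N" "p = ?yx q" using p permutes_image[OF perm] by (metis imageE lessThan_iff)
    have yx: "F.fold (y \<otimes> x) (base, q) = (base, p)"
      using realizes_mult[OF real(2,1) im] q by (simp add: realizes_def del: one_FactGroup comp_apply)
    have "F.fold ?c (base, p) = F.fold ?c (F.fold (y \<otimes> x) (base, q))" by (simp only: yx)
    also have "\<dots> = F.fold (x \<otimes> y) (base, q)"
      using cl by (simp add: lift_mult[symmetric] m_assoc del: inv_mult_group one_FactGroup)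
    also have "\<dots> = (base, (heis l 0 1 0 \<circ> heis l 1 0 0) q)"
      using realizes_mult[OF real im] q by (simp add: realizes_def del: one_FactGroup comp_apply)
    also have "(heis l 0 1 0 \<circ> heis l 1 0 0) q = heis l 0 0 1 p"
      unfolding heis_commutator q(2) by simp
    finally show ?thesis .
  qed
  then have "realizes ?c (heis l 0 0 1)" using cl by (simp add: realizes_def del: inv_mult_group one_FactGroup)
  then show ?thesis using xy(3) by blast
qed

text \<open>Let \<open>a\<^sub>1\<close> and \<open>a\<^sub>2\<close> be the parts of \<open>d\<close> prime to \<open>l\<^sub>1\<close> and to \<open>l\<^sub>2\<close>. The two Heisenberg shifts are realised in
\<open>W[a\<^sub>1]\<close> and \<open>W[a\<^sub>2]\<close>, hence would commute modulo \<open>W[d]\<close>, but they do not commute as permutations.\<close>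

theorem fold_kernel_not_congruence:
  assumes N2: "l2 * l2 \<le> N" and l: "prime l1" "prime l2" "r * r < l1" "l1 < l2" and d: "0 < d"
  shows "\<not> cgr d \<subseteq> fold_kernel"
proof
  assume sub: "cgr d \<subseteq> fold_kernel"
  obtain k1 a1 where a1: "\<not> l1 dvd a1" "d = a1 * l1 ^ k1" using prime_power_canonical[OF l(1) d] by blast
  obtain k2 a2 where a2: "\<not> l2 dvd a2" "d = a2 * l2 ^ k2" using prime_power_canonical[OF l(2) d] by blast
  have a: "0 < a1" "0 < a2" using d a1 a2 by (auto intro!: gr0I)
  have "l1 * l1 \<le> l2 * l2" using l(4) by (intro mult_le_mono) auto
  then have N1: "l1 * l1 \<le> N" using N2 by simp
  obtain c1 where c1: "c1 \<in> cgr a1" "realizes c1 (heis l1 0 0 1)"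
    using realizes_heis_shift[OF l(1,3) _ a(1) N1] a1(1) l(1) by (auto simp: prime_imp_coprime)
  obtain c2 where c2: "c2 \<in> cgr a2" "realizes c2 (heis l2 0 0 1)"
    using realizes_heis_shift[OF l(2) _ _ a(2) N2] a2(1) l by (auto simp: prime_imp_coprime)
  have "coprime (l1 ^ k1) (l2 ^ k2)" using l by (simp add: primes_coprime)
  moreover have "l1 ^ k1 dvd a2 * l2 ^ k2" using a1(2) a2(2) by (metis dvd_triv_right)
  ultimately have "l1 ^ k1 dvd a2" by (simp add: coprime_dvd_mult_left_iff)
  then have "d dvd a1 * a2" using a1(2) by (simp add: mult_dvd_mono)
  then have "c1 \<otimes> c2 \<otimes> inv (c2 \<otimes> c1) \<in> fold_kernel"
    using cgr_commutator[OF c1(1) c2(1)] cgr_mono sub by blast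
  then have triv: "F.fold (c1 \<otimes> c2 \<otimes> inv (c2 \<otimes> c1)) (base, p) = (base, p)" if "p < N" for p
    using that F.\<Gamma>.one_closed unfolding fold_kernel_def by blast
  have cl: "c1 \<in> carrier W" "c2 \<in> carrier W" using c1 c2 cgrD by auto
  have im1: "heis l1 0 0 1 ` {..<N} \<subseteq> {..<N}" and im2: "heis l2 0 0 1 ` {..<N} \<subseteq> {..<N}"
    using permutes_image[OF heis_permutes[OF heis_in_group N1]]
      permutes_image[OF heis_permutes[OF heis_in_group N2]] by auto
  define p where "p = l1 - 1"
  have "l1 \<le> l1 * l1" by simp
  then have p: "p < N" using N1 prime_gt_0_nat[OF l(1)] unfolding p_def by linarith
  have f12: "F.fold (c1 \<otimes> c2) (base, p) = (base, heis l1 0 0 1 (heis l2 0 0 1 p))"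
    using realizes_mult[OF c1(2) c2(2) im2] p by (simp add: realizes_def del: one_FactGroup)
  have f21: "F.fold (c2 \<otimes> c1) (base, p) = (base, heis l2 0 0 1 (heis l1 0 0 1 p))"
    using realizes_mult[OF c2(2) c1(2) im1] p by (simp add: realizes_def del: one_FactGroup)
  have lt: "heis l2 0 0 1 (heis l1 0 0 1 p) < N" using im1 im2 p by auto
  have "F.fold (c1 \<otimes> c2) (base, p) =
      F.fold (c1 \<otimes> c2 \<otimes> inv (c2 \<otimes> c1)) (F.fold (c2 \<otimes> c1) (base, p))"
    using cl by (simp add: lift_mult[symmetric] m_assoc del: inv_mult_group one_FactGroup)
  then have "heis l1 0 0 1 (heis l2 0 0 1 p) = heis l2 0 0 1 (heis l1 0 0 1 p)"
    unfolding f12 f21 triv[OF lt] by simp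
  then show False
    using heis_shift_noncommuting[OF prime_ge_2_nat[OF l(1)] l(4)] by (simp add: p_def)
qed

end

theorem (in small_coxeter) many_panels_imp_no_csp:
  assumes j: "j < r" and many: "\<not> few_panels j"
  shows "\<not> congruence_subgroup_property W r w m"
proof
  assume csp: "congruence_subgroup_property W r w m"
  obtain t1 t2 t3 where t: "t1 \<in> panels (family j)" "t2 \<in> panels (family j)" "t3 \<in> panels (family j)"
    "t1 \<noteq> t2" "t1 \<noteq> t3" "t2 \<noteq> t3" by (rule many_panels[OF many])
  have tc: "t1 \<in> carrier W" "t2 \<in> carrier W" "t3 \<in> carrier W" using t panels_closed by auto
  have ne: "s \<otimes> inv t \<noteq> \<one>" if "s \<in> carrier W" "t \<in> carrier W" "s \<noteq> t" for s t
    using that inv_equality[of s "inv t"] by auto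
  obtain n where n: "0 < n" "3 dvd n" "{t1 \<otimes> inv t2, t1 \<otimes> inv t3, t2 \<otimes> inv t3} \<inter> cgr n = {}"
    using separating_level[of "{t1 \<otimes> inv t2, t1 \<otimes> inv t3, t2 \<otimes> inv t3}"] tc
      ne[OF tc(1,2) t(4), symmetric] ne[OF tc(1,3) t(5), symmetric] ne[OF tc(2,3) t(6), symmetric]
    by auto
  have dist: "cgr n #> s \<noteq> cgr n #> t" if "s \<otimes> inv t \<notin> cgr n" "s \<in> carrier W" "t \<in> carrier W" for s t
  proof
    assume "cgr n #> s = cgr n #> t"
    then have "s \<in> cgr n #> t" using rcos_self[OF that(2) cgr_subgroup] by metis
    then obtain k where k: "k \<in> cgr n" "s = k \<otimes> t" by (auto simp: r_coset_def)
    then have "s \<otimes> inv t = k" using that(3) cgrD(1) by (simp add: m_assoc)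
    then show False using k that(1) by simp
  qed
  obtain l1 where l1: "prime l1" "r * r < l1" using bigger_prime by blast
  obtain l2 where l2: "prime l2" "l1 < l2" using bigger_prime by blast
  have "2 \<le> l2 * l2" using mult_le_mono[OF prime_ge_2_nat[OF l2(1)] prime_ge_2_nat[OF l2(1)]] by simp
  then interpret T: three_panels W r w m j n "l2 * l2" t1 t2 t3
    by unfold_locales (use j n t dist tc in auto)
  obtain d where d: "2 \<le> d" "principal_congruence_subgroup W r w m d \<subseteq> T.fold_kernel"
    using csp T.fold_kernel_subgroup T.fold_kernel_finite_index
    unfolding congruence_subgroup_property_def by blast
  then have "cgr d \<subseteq> T.fold_kernel" using cgr_subset_principal by blast
  then show False
    using T.fold_kernel_not_congruence[of l2 l1 d] l1 l2 d by simp
qed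

theorem theorem3p8:
  fixes W :: "('g, 'x) monoid_scheme"
    and r :: nat
    and w :: "nat \<Rightarrow> 'g"
    and m :: "nat \<Rightarrow> nat \<Rightarrow> enat"
  assumes "small_coxeter_system W r w m"
    and "infinite (carrier W)"
    and "\<not> virtually_abelian W"
  shows "\<not> congruence_subgroup_property W r w m"
proof -
  interpret small_coxeter W r w m by (rule small_coxeter.intro) fact
  obtain j where "j < r" "\<not> few_panels j"
    using few_panels_imp_virtually_abelian assms(3) by blast
  then show ?thesis by (rule many_panels_imp_no_csp)
qed

end
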